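(* Let $G$ be an $H$-type group, $2n=\dim\mathfrak v$. Let $f\in L^1(G)$ and $\lambda\in\mathfrak z^*\setminus\{0\}$, and suppose $I_{\nu,\lambda}f=0$ for all $\nu\in S(\mathfrak v^* )$. If $n>1$ then $\mathcal F(f)(\mu)=0$ for all $\mu\in\Gamma_\lambda^*\setminus\{0\}$. If $n=1$ then $\mathcal F(f)(\mu)=0$ for all $\mu\in\Gamma_{\lambda,\mathrm{odd}}^*$.
   Context: $H$-type group: $\mathfrak g$ is a finite-dimensional real Lie algebra with $[\mathfrak g,[\mathfrak g,\mathfrak g]]=0$ and an inner product; $\mathfrak z\ne0$ is its center, $\mathfrak v\neq 0$ the orthogonal complement of $\mathfrak z$, $2n=\dim\mathfrak v$. For $\mu\in\mathfrak z^*$ let $J_\mu:\mathfrak v\to\mathfrak v$ be the skew-adjoint map with $\langle J_\mu V,W\rangle=\mu([V,W])$; one requires $J_\mu^2=-|\mu|^2\mathrm{Id}$ for all $\mu$. $G$ is $\mathfrak v\times\mathfrak z$ with product $(x,u)(x',u')=(x+x',u+u'+\tfrac12[x,x'])$ and Haar measure $dx\,du$. The inner product identifies $\mathfrak v^*\cong\mathfrak v$, $\mathfrak z^*\cong\mathfrak z$; $S(\mathfrak v^* )$ is the unit sphere; $\hat\lambda=\lambda/|\lambda|$. X-ray transform: $\gamma_{\nu,\lambda}(s)=\big(e^{sJ_\lambda}J_\lambda^{-1}\nu,\tfrac{s}{2|\lambda|}\hat\lambda\big)$, $\Gamma_\lambda=\{(0,j\pi|\lambda|^{-2}\hat\lambda):j\in\mathbb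 Z\}$, $G_\lambda=G/\Gamma_\lambda$, and $I_{\nu,\lambda}f(x,u)=\int_{\mathbb R}f((x,u)\gamma_{\nu,\lambda}(s))ds\in L^1(G_\lambda)$. $\Gamma_\lambda^*=\{\mu\in\mathfrak z^*:\mu\cdot\lambda\in2|\lambda|^3\mathbb Z\}$ and $\Gamma_{\lambda,\mathrm{odd}}^*=\{\mu\in\mathfrak z^*:\mu\cdot\lambda\in2|\lambda|^3(2\mathbb Z+1)\}$. Fourier transform: $\mathcal F(\mathbb C^n)$ is the Hilbert space of holomorphic $F:\mathbb C^n\to\mathbb C$ with $\pi^{-n}\int|F(\zeta)|^2e^{-|\zeta|^2}d\zeta<\infty$. For $h>0$, $\pi_h(z,t)F(\zeta)=e^{iht-\sqrt{h/2}\,\zeta\cdot\bar z-\frac h4|z|^2}F(\zeta+\sqrt{h/2}\,z)$, $z\in\mathbb C^n$, $t\in\mathbb R$. For $\mu\in\mathfrak z^*\setminus\{0\}$ fix an orthogonal map $R_\mu:\mathbb R^{2n}\to\mathfrak v$, depending only on $\mu/|\mu|$, with $J_\mu=|\mu|R_\mu JR_\mu^t$, where $J$ is multiplication by $i$ on $\mathbb R^{2n}\cong\mathbb C^n$. Then $\pi_\mu(x,u)=\pi_{|\mu|}\big(R_\mu^tx,\tfrac{\mu\cdot u}{|\mu|}\big)$ is an irreducible unitary representation of $G$ on $\mathcal F(\mathbb C^n)$, and $\mathcal F(f)(\mu)=\int_Gf(g)\pi_\mu(g)^*dg$. *)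

theory Defs
  imports "HOL-Analysis.Analysis"
begin

section \<open>H-type algebras and groups\<close>

text \<open>
  The underlying inner product space of the Lie algebra is split orthogonally as the product
  of \<open>'v\<close> (the complement of the centre) and \<open>'z\<close> (the centre). Both types belong to
  \<^class>\<open>euclidean_space\<close>, so both factors are nonzero and finite-dimensional. The inner product
  identifies the dual spaces with \<open>'v\<close> and \<open>'z\<close>: a functional \<open>\<mu>\<close> is given by a vector, and its
  value at \<open>u\<close> is \<open>\<mu> \<bullet> u\<close>.
\<close>

definition center_bracket ::
  "('v::euclidean_space \<times> 'z::euclidean_space \<Rightarrow> 'v \<times> 'z \<Rightarrow> 'v \<times> 'z) \<Rightarrow> 'v \<Rightarrow> 'v \<Rightarrow> 'z"
  where "center_bracket br x x' = snd (br (x, 0) (x', 0))"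

definition J_map ::
  "('v::euclidean_space \<times> 'z::euclidean_space \<Rightarrow> 'v \<times> 'z \<Rightarrow> 'v \<times> 'z) \<Rightarrow> 'z \<Rightarrow> 'v \<Rightarrow> 'v"
  where "J_map br \<mu> = (THE J. \<forall>V W. J V \<bullet> W = \<mu> \<bullet> center_bracket br V W)"

locale h_type_algebra =
  fixes br :: "'v::euclidean_space \<times> 'z::euclidean_space \<Rightarrow> 'v \<times> 'z \<Rightarrow> 'v \<times> 'z"
  assumes bilinear: "bilinear br"
    and alternating: "br X X = 0"
    and jacobi: "br X (br Y Z) + br Y (br Z X) + br Z (br X Y) = 0"
    and two_step: "br X (br Y Z) = 0"
    and center: "{X. \<forall>Y. br X Y = 0} = {0} \<times> UNIV"
    and J_map_square: "J_map br \<mu> (J_map br \<mu> x) = - ((norm \<mu>)\<^sup>2 *\<^sub>R x)"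

lemma J_map_inner:
  assumes "bilinear br"
  shows "J_map br \<mu> V \<bullet> W = \<mu> \<bullet> center_bracket br V W"
proof -
  let ?P = "\<lambda>J. \<forall>V W. J V \<bullet> W = \<mu> \<bullet> center_bracket br V W"
  have lin: "linear (center_bracket br V)" for V
  proof (rule linearI)
    have l: "linear (br (V, 0))"
      using assms by (simp add: bilinear_def)
    show "center_bracket br V (x + y) = center_bracket br V x + center_bracket br V y" for x y
      using linear_add[OF l, of "(x, 0)" "(y, 0)"] by (simp add: center_bracket_def)
    show "center_bracket br V (c *\<^sub>R x) = c *\<^sub>R center_bracket br V x" for c x
      using linear_scale[OF l, of c "(x, 0)"] by (simp add: center_bracket_def)
  qed
  have ex: "?P (\<lambda>V. adjoint (center_bracket br V) \<mu>)"
    using adjoint_works[OF lin] by (metis inner_commute)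
  have "?P (J_map br \<mu>)"
    unfolding J_map_def
  proof (rule theI[where P = ?P, OF ex])
    fix J assume "?P J"
    then have "J V \<bullet> W = adjoint (center_bracket br V) \<mu> \<bullet> W" for V W
      using ex by simp
    then show "J = (\<lambda>V. adjoint (center_bracket br V) \<mu>)"
      by (intro ext) (metis vector_eq_rdot)
  qed
  then show ?thesis by blast
qed

text \<open>The group is the type \<open>'v \<times> 'z\<close> itself, with Haar measure \<^const>\<open>lborel\<close>.\<close>

definition gmult ::
  "('v::euclidean_space \<times> 'z::euclidean_space \<Rightarrow> 'v \<times> 'z \<Rightarrow> 'v \<times> 'z)
    \<Rightarrow> 'v \<times> 'z \<Rightarrow> 'v \<times> 'z \<Rightarrow> 'v \<times> 'z"
  where "gmult br g g' =
    (fst g + fst g', snd g + snd g' + (1/2) *\<^sub>R center_bracket br (fst g) (fst g'))"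


section \<open>The X-ray transform\<close>

definition op_exp :: "('a::real_normed_vector \<Rightarrow> 'a) \<Rightarrow> 'a \<Rightarrow> 'a"
  where "op_exp T x = (\<Sum>k. (T ^^ k) x /\<^sub>R fact k)"

text \<open>Here \<open>sgn lam = lam /\<^sub>R norm lam\<close> is the normalized covector.\<close>

definition geodesic ::
  "('v::euclidean_space \<times> 'z::euclidean_space \<Rightarrow> 'v \<times> 'z \<Rightarrow> 'v \<times> 'z)
    \<Rightarrow> 'v \<Rightarrow> 'z \<Rightarrow> real \<Rightarrow> 'v \<times> 'z"
  where "geodesic br \<nu> lam s =
    (op_exp (\<lambda>V. s *\<^sub>R J_map br lam V) (inv (J_map br lam) \<nu>), (s / (2 * norm lam)) *\<^sub>R sgn lam)"

definition Gamma_lat :: "'z::euclidean_space \<Rightarrow> ('v::euclidean_space \<times> 'z) set"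
  where "Gamma_lat lam = range (\<lambda>j::int. (0, (of_int j * pi / (norm lam)\<^sup>2) *\<^sub>R sgn lam))"

definition Gamma_coset ::
  "('v::euclidean_space \<times> 'z::euclidean_space \<Rightarrow> 'v \<times> 'z \<Rightarrow> 'v \<times> 'z)
    \<Rightarrow> 'z \<Rightarrow> 'v \<times> 'z \<Rightarrow> ('v \<times> 'z) set"
  where "Gamma_coset br lam g = gmult br g ` Gamma_lat lam"

text \<open>
  The quotient of the group by \<open>Gamma_lat lam\<close>, with the quotient Borel structure. Its Haar measure
  is the image of Lebesgue measure on a fundamental domain of the lattice under the projection.
\<close>

definition Gamma_fund :: "'z::euclidean_space \<Rightarrow> ('v::euclidean_space \<times> 'z) set"
  where "Gamma_fund lam = {(x, u). 0 \<le> u \<bullet> sgn lam \<and> u \<bullet> sgn lam < pi / (norm lam)\<^sup>2}"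

definition quotient_haar ::
  "('v::euclidean_space \<times> 'z::euclidean_space \<Rightarrow> 'v \<times> 'z \<Rightarrow> 'v \<times> 'z)
    \<Rightarrow> 'z \<Rightarrow> ('v \<times> 'z) set measure"
  where "quotient_haar br lam =
    distr (restrict_space lborel (Gamma_fund lam))
      (sigma (range (Gamma_coset br lam))
        {A. A \<subseteq> range (Gamma_coset br lam) \<and> Gamma_coset br lam -` A \<in> sets borel})
      (Gamma_coset br lam)"

definition xray ::
  "('v::euclidean_space \<times> 'z::euclidean_space \<Rightarrow> 'v \<times> 'z \<Rightarrow> 'v \<times> 'z)
    \<Rightarrow> 'v \<Rightarrow> 'z \<Rightarrow> ('v \<times> 'z \<Rightarrow> complex) \<Rightarrow> 'v \<times> 'z \<Rightarrow> complex"
  where "xray br \<nu> lam f g = (LINT s|lborel. f (gmult br g (geodesic br \<nu> lam s)))"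

text \<open>
  For an H-type algebra the function \<open>xray br \<nu> lam f\<close> is constant on each coset of \<open>Gamma_lat lam\<close>,
  since \<open>geodesic br \<nu> lam (s + 2 * pi / norm lam)\<close> is \<open>geodesic br \<nu> lam s\<close> times the generator of that
  lattice. So it is a function on the quotient, and the following says that it is zero as an
  element of \<open>L\<^sup>1\<close> of the quotient.
\<close>

definition xray_zero ::
  "('v::euclidean_space \<times> 'z::euclidean_space \<Rightarrow> 'v \<times> 'z \<Rightarrow> 'v \<times> 'z)
    \<Rightarrow> 'v \<Rightarrow> 'z \<Rightarrow> ('v \<times> 'z \<Rightarrow> complex) \<Rightarrow> bool"
  where "xray_zero br \<nu> lam f \<longleftrightarrow> (AE c in quotient_haar br lam. \<forall>g\<in>c. xray br \<nu> lam f g = 0)"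

definition Gamma_dual :: "'z::euclidean_space \<Rightarrow> 'z set"
  where "Gamma_dual lam = {\<mu>. \<exists>k::int. \<mu> \<bullet> lam = 2 * norm lam ^ 3 * of_int k}"

definition Gamma_dual_odd :: "'z::euclidean_space \<Rightarrow> 'z set"
  where "Gamma_dual_odd lam = {\<mu>. \<exists>k::int. \<mu> \<bullet> lam = 2 * norm lam ^ 3 * of_int (2 * k + 1)}"


section \<open>Fock space and the representations\<close>

definition holomorphic_Cn :: "(complex^'n \<Rightarrow> complex) \<Rightarrow> bool"
  where "holomorphic_Cn F \<longleftrightarrow>
    (\<forall>z. \<exists>D. (F has_derivative D) (at z) \<and> (\<forall>c w. D (c *s w) = c * D w))"

definition fock_space :: "(complex^'n \<Rightarrow> complex) set"
  where "fock_space = {F. holomorphic_Cn F \<and>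
    integrable lborel (\<lambda>\<zeta>. (cmod (F \<zeta>))\<^sup>2 * exp (- (norm \<zeta>)\<^sup>2))}"

definition fock_inner :: "(complex^'n \<Rightarrow> complex) \<Rightarrow> (complex^'n \<Rightarrow> complex) \<Rightarrow> complex"
  where "fock_inner F H =
    of_real (1 / pi ^ CARD('n)) *
      (LINT \<zeta>|lborel. F \<zeta> * cnj (H \<zeta>) * of_real (exp (- (norm \<zeta>)\<^sup>2)))"

definition fock_adjoint ::
  "((complex^'n \<Rightarrow> complex) \<Rightarrow> complex^'n \<Rightarrow> complex) \<Rightarrow> (complex^'n \<Rightarrow> complex) \<Rightarrow> complex^'n \<Rightarrow> complex"
  where "fock_adjoint T F =
    (THE K. K \<in> fock_space \<and> (\<forall>H\<in>fock_space. fock_inner (T H) F = fock_inner H K))"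

definition pi_heis ::
  "real \<Rightarrow> complex^'n \<Rightarrow> real \<Rightarrow> (complex^'n \<Rightarrow> complex) \<Rightarrow> complex^'n \<Rightarrow> complex"
  where "pi_heis h z t F \<zeta> =
    exp (\<i> * of_real (h * t) - of_real (sqrt (h / 2)) * (\<Sum>i\<in>UNIV. \<zeta> $ i * cnj (z $ i))
           - of_real (h / 4 * (norm z)\<^sup>2))
      * F (\<zeta> + sqrt (h / 2) *\<^sub>R z)"

text \<open>
  The choice of the orthogonal maps \<open>R \<mu>\<close>. Their domain, real \<open>2n\<close>-space, is \<open>complex^'n\<close> with its
  real inner product, on which multiplication by \<open>\<i>\<close> acts.
\<close>

definition frame_choice ::
  "('v::euclidean_space \<times> 'z::euclidean_space \<Rightarrow> 'v \<times> 'z \<Rightarrow> 'v \<times> 'z)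
    \<Rightarrow> ('z \<Rightarrow> complex^'n \<Rightarrow> 'v) \<Rightarrow> bool"
  where "frame_choice br R \<longleftrightarrow>
    (\<forall>\<mu>. \<mu> \<noteq> 0 \<longrightarrow>
      linear (R \<mu>) \<and> bij (R \<mu>) \<and> (\<forall>z w. R \<mu> z \<bullet> R \<mu> w = z \<bullet> w) \<and>
      (\<forall>V. J_map br \<mu> V = norm \<mu> *\<^sub>R R \<mu> (\<i> *s adjoint (R \<mu>) V))) \<and>
    (\<forall>\<mu> \<mu>'. \<mu> \<noteq> 0 \<longrightarrow> \<mu>' \<noteq> 0 \<longrightarrow> sgn \<mu> = sgn \<mu>' \<longrightarrow> R \<mu> = R \<mu>')"

definition pi_rep ::
  "('z::euclidean_space \<Rightarrow> complex^'n \<Rightarrow> 'v::euclidean_space) \<Rightarrow> 'z \<Rightarrow> 'v \<times> 'z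
    \<Rightarrow> (complex^'n \<Rightarrow> complex) \<Rightarrow> complex^'n \<Rightarrow> complex"
  where "pi_rep R \<mu> g = pi_heis (norm \<mu>) (adjoint (R \<mu>) (fst g)) ((\<mu> \<bullet> snd g) / norm \<mu>)"

text \<open>
  The operator-valued integral of \<open>f g\<close> times the adjoint of \<open>pi_rep R \<mu> g\<close> is taken in the weak
  sense: its value at \<open>F\<close> is the element of Fock space whose inner product with each \<open>H\<close> is the
  integral of the matrix coefficients. For integrable \<open>f\<close> it exists, because the representation
  is unitary. It is meaningful for arguments \<open>F\<close> in Fock space only.
\<close>

definition group_fourier ::
  "('z::euclidean_space \<Rightarrow> complex^'n \<Rightarrow> 'v::euclidean_space) \<Rightarrow> ('v \<times> 'z \<Rightarrow> complex) \<Rightarrow> 'z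
    \<Rightarrow> (complex^'n \<Rightarrow> complex) \<Rightarrow> complex^'n \<Rightarrow> complex"
  where "group_fourier R f \<mu> F =
    (THE K. K \<in> fock_space \<and>
      (\<forall>H\<in>fock_space. fock_inner K H =
        (LINT g|lborel. f g * fock_inner (fock_adjoint (pi_rep R \<mu> g) F) H)))"

definition fock_op_zero ::
  "((complex^'n \<Rightarrow> complex) \<Rightarrow> complex^'n \<Rightarrow> complex) \<Rightarrow> bool"
  where "fock_op_zero T \<longleftrightarrow> (\<forall>F\<in>fock_space. T F = (\<lambda>_. 0))"

end

theory Submission
  imports Defs "HOL-Complex_Analysis.Complex_Analysis"
begin

text \<open>
  Evaluated at a point, the Fourier transform of \<open>f\<close> applied to \<open>F\<close> is
  \<open>\<psi> z = \<integral> f g * (\<pi> (- g) F) z dg\<close>. This function is entire, because elements of Fock space grow at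
  most like \<open>exp (|z|\<^sup>2 / 2)\<close> and the representation respects this bound. Unfolding the integral of
  \<open>\<pi> (- g) F * I f\<close> over a fundamental domain of the lattice turns the hypothesis into
  \<open>\<integral> \<pi> (\<gamma> s) \<psi> ds = 0\<close>, the integral being over one period of the curve \<open>\<gamma>\<close>. In the coordinates of \<open>\<mu>\<close>
  this says that \<open>\<psi>\<close> is annihilated by twisted averages over the circles
  \<open>z + \<surd>K (cos \<theta> w + sin \<theta> S w)\<close>, where \<open>|w| = 1\<close>, \<open>S = \<i>\<kappa> + S'\<close> with \<open>S'\<close> antilinear, \<open>\<kappa>\<close> is the cosine of the
  angle between \<open>\<lambda>\<close> and \<open>\<mu>\<close>, and \<open>k = K\<kappa>\<close> is an integer.

  If \<open>|\<kappa>| = 1\<close> these are complex circles. When \<open>z\<close> is orthogonal to the direction \<open>w\<close>, each Taylor coefficient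
  of \<open>\<psi>\<close> along that complex line is multiplied by a scalar; for the constant coefficient, which suffices when
  \<open>n > 1\<close>, it is a nonzero power divided by a factorial, and for \<open>n = 1\<close> it is a nonzero rational multiple of an odd integer when \<open>k\<close>
  is odd. If \<open>|\<kappa>| < 1\<close>, put \<open>z = e\<^sup>i\<^sup>\<tau> \<eta> - \<surd>K y w\<close> with real \<open>|y| < 1\<close> and average over the unit vectors \<open>w\<close>: the circle
  becomes a rotated sphere, holomorphy removes the directions orthogonal to \<open>\<eta>\<close>, and each Taylor coefficient of
  \<open>\<psi>\<close> along \<open>\<eta>\<close> is multiplied by a power series in \<open>y\<close> that does not vanish identically.
\<close>

section \<open>Integrals over bounded sets\<close>

text \<open>The Fourier transform is a weak integral, and a weak vector offers no points at which
  holomorphy could act. This is why the scalar function \<psi> carries the argument; of it only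
  continuity and holomorphy along complex lines are used. The obstacle is that J_\<lambda> is
  complex linear for the complex structure of J_\<mu> only if \<lambda> and \<mu> are parallel.
  Otherwise a circle spans a real plane that is not a complex line, and Cauchy's formula says
  nothing about a single slice. Averaging over all w repairs this, because exp (2 pi t S) - y is a
  positive multiple of an orthogonal map. The parameter y is needed because a single spherical
  average gives one scalar per Taylor coefficient, which might be zero; with y free it becomes a
  power series, and only its not being identically zero matters. The integer k expresses that the
  central character of \<mu> is trivial on the lattice. The same integer is the frequency of the
  twist.\<close>

lemma pair_integrable_bounded:
  fixes F :: "'a::euclidean_space \<times> 'b::euclidean_space \<Rightarrow> complex"
  assumes A: "bounded A" "A \<in> sets borel" and B: "bounded B" "B \<in> sets borel"
    and F: "F \<in> borel_measurable borel"
    and bd: "\<And>x y. x \<in> A \<Longrightarrow> y \<in> B \<Longrightarrow> cmod (F (x, y)) \<le> C"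
  shows "integrable (lborel \<Otimes>\<^sub>M lborel) (\<lambda>(x, y). indicator A x *\<^sub>R indicator B y *\<^sub>R F (x, y))"
proof -
  have fin: "emeasure (lborel \<Otimes>\<^sub>M lborel) (A \<times> B) < \<infinity>"
    using A B emeasure_bounded_finite[OF A(1)] emeasure_bounded_finite[OF B(1)]
    by (simp add: lborel.emeasure_pair_measure_Times ennreal_mult_less_top)
  have F': "F \<in> borel_measurable (lborel \<Otimes>\<^sub>M lborel)"
    using F by (simp add: lborel_prod)
  have AB: "A \<times> B \<in> sets (lborel \<Otimes>\<^sub>M lborel)"
    using A B by auto
  have "integrable (lborel \<Otimes>\<^sub>M lborel) (\<lambda>p. indicator (A \<times> B) p *\<^sub>R F p)"
  proof (rule Bochner_Integration.integrable_bound)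
    show "integrable (lborel \<Otimes>\<^sub>M lborel) (\<lambda>p. indicator (A \<times> B) p *\<^sub>R C)"
      using fin AB by (intro integrable_indicator integrable_scaleR_left) auto
    show "(\<lambda>p. indicator (A \<times> B) p *\<^sub>R F p) \<in> borel_measurable (lborel \<Otimes>\<^sub>M lborel)"
      using F' AB by measurable
    show "AE p in lborel \<Otimes>\<^sub>M lborel. norm (indicator (A \<times> B) p *\<^sub>R F p) \<le> norm (indicator (A \<times> B) p *\<^sub>R C)"
      using bd by (intro AE_I2) (auto simp: indicator_def intro: order_trans[OF _ abs_ge_self])
  qed
  then show ?thesis
    by (rule arg_cong[where f = "integrable _", THEN iffD1, rotated])
       (auto simp: fun_eq_iff indicator_def)
qed

lemma set_Fubini_bounded:
  fixes F :: "'a::euclidean_space \<times> 'b::euclidean_space \<Rightarrow> complex"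
  assumes A: "bounded A" "A \<in> sets borel" and B: "bounded B" "B \<in> sets borel"
    and F: "F \<in> borel_measurable borel"
    and bd: "\<And>x y. x \<in> A \<Longrightarrow> y \<in> B \<Longrightarrow> cmod (F (x, y)) \<le> C"
  shows "(LINT x:A|lborel. LINT y:B|lborel. F (x, y)) = (LINT y:B|lborel. LINT x:A|lborel. F (x, y))"
proof -
  have "(LINT x|lborel. LINT y|lborel. indicator A x *\<^sub>R indicator B y *\<^sub>R F (x, y))
      = (LINT y|lborel. LINT x|lborel. indicator A x *\<^sub>R indicator B y *\<^sub>R F (x, y))"
    using lborel_pair.Fubini_integral[OF pair_integrable_bounded[OF assms], symmetric] .
  then show ?thesis
    unfolding set_lebesgue_integral_def
    by (simp flip: integral_scaleR_right add: mult.commute)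
qed

lemma set_integrable_bounded:
  fixes F :: "'a::euclidean_space \<Rightarrow> complex"
  assumes "bounded A" "A \<in> sets borel" "F \<in> borel_measurable borel"
    and bd: "\<And>x. x \<in> A \<Longrightarrow> cmod (F x) \<le> C"
  shows "set_integrable lborel A F"
  unfolding set_integrable_def
proof (rule Bochner_Integration.integrable_bound)
  show "integrable lborel (\<lambda>x. indicator A x *\<^sub>R C)"
    using assms emeasure_bounded_finite[of A] by (intro integrable_scaleR_left integrable_real_indicator) auto
  show "(\<lambda>x. indicator A x *\<^sub>R F x) \<in> borel_measurable lborel"
    using assms by measurable
  show "AE x in lborel. norm (indicator A x *\<^sub>R F x) \<le> norm (indicator A x *\<^sub>R C)"
    using bd by (intro AE_I2) (auto simp: indicator_def intro: order_trans[OF _ abs_ge_self])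
qed

lemma set_integral_bound:
  fixes F :: "'a::euclidean_space \<Rightarrow> complex"
  assumes "bounded A" "A \<in> sets borel" "F \<in> borel_measurable borel"
    and bd: "\<And>x. x \<in> A \<Longrightarrow> cmod (F x) \<le> C" and C: "0 \<le> C"
  shows "cmod (LINT x:A|lborel. F x) \<le> measure lborel A * C"
proof -
  have "cmod (LINT x:A|lborel. F x) \<le> (LINT x|lborel. indicator A x * C)"
    unfolding set_lebesgue_integral_def
  proof (rule Bochner_Integration.integral_norm_bound_integral)
    show "integrable lborel (\<lambda>x. indicator A x *\<^sub>R F x)"
      using set_integrable_bounded[OF assms(1-3) bd] by (simp add: set_integrable_def)
    show "integrable lborel (\<lambda>x. indicator A x * C)"
      using assms emeasure_bounded_finite[of A] by (intro integrable_mult_left integrable_real_indicator) auto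
  qed (use bd C in \<open>auto simp: indicator_def\<close>)
  also have "\<dots> = measure lborel A * C"
    using assms by simp
  finally show ?thesis .
qed

text \<open>Three swaps of neighbouring variables; the middle one treats the inner integral as a
  bounded measurable function of the other two.\<close>

lemma set_Fubini_bounded3:
  fixes F :: "'a::euclidean_space \<times> 'b::euclidean_space \<times> 'c::euclidean_space \<Rightarrow> complex"
  assumes A: "bounded A" "A \<in> sets borel" and B: "bounded B" "B \<in> sets borel"
    and D: "bounded D" "D \<in> sets borel"
    and F: "F \<in> borel_measurable borel"
    and bd: "\<And>x y z. x \<in> A \<Longrightarrow> y \<in> B \<Longrightarrow> z \<in> D \<Longrightarrow> cmod (F (x, y, z)) \<le> C"
  shows "(LINT x:A|lborel. LINT y:B|lborel. LINT z:D|lborel. F (x, y, z))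
       = (LINT z:D|lborel. LINT y:B|lborel. LINT x:A|lborel. F (x, y, z))"
proof -
  define C' where "C' = max C 0"
  have bd': "cmod (F (x, y, z)) \<le> C'" if "x \<in> A" "y \<in> B" "z \<in> D" for x y z
    using bd[OF that] by (simp add: C'_def)
  have C': "0 \<le> C'" by (simp add: C'_def)
  have Fm: "F \<in> borel_measurable (borel \<Otimes>\<^sub>M borel \<Otimes>\<^sub>M borel)"
    using F by (simp add: borel_prod)
  have 1: "(LINT y:B|lborel. LINT z:D|lborel. F (x, y, z)) = (LINT z:D|lborel. LINT y:B|lborel. F (x, y, z))"
    if "x \<in> A" for x
  proof (rule set_Fubini_bounded[OF B D, where F = "\<lambda>p. F (x, p)" and C = C'])
    show "(\<lambda>p. F (x, p)) \<in> borel_measurable borel"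
      using F by (rule measurable_compose[rotated]) (simp add: borel_prod[symmetric])
  qed (use bd' that in auto)
  have 2: "(LINT x:A|lborel. LINT z:D|lborel. (LINT y:B|lborel. F (x, y, z)))
      = (LINT z:D|lborel. LINT x:A|lborel. LINT y:B|lborel. F (x, y, z))"
  proof -
    have "(\<lambda>p. LINT y:B|lborel. F (fst p, y, snd p)) \<in> borel_measurable (borel \<Otimes>\<^sub>M borel)"
      unfolding set_lebesgue_integral_def
    proof (rule lborel.borel_measurable_lebesgue_integral)
      have "(\<lambda>q. (fst (fst q), snd q, snd (fst q))) \<in> measurable ((borel \<Otimes>\<^sub>M borel) \<Otimes>\<^sub>M lborel) (borel \<Otimes>\<^sub>M (borel \<Otimes>\<^sub>M borel))"
        by measurable
      from measurable_compose[OF this Fm]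
      show "(\<lambda>(p, y). indicator B y *\<^sub>R F (fst p, y, snd p)) \<in> borel_measurable ((borel \<Otimes>\<^sub>M borel) \<Otimes>\<^sub>M lborel)"
        using B by (simp add: case_prod_unfold)
    qed
    then have m: "(\<lambda>p. LINT y:B|lborel. F (fst p, y, snd p)) \<in> borel_measurable borel"
      by (simp add: borel_prod)
    have b: "cmod (LINT y:B|lborel. F (x, y, z)) \<le> measure lborel B * C'" if "x \<in> A" "z \<in> D" for x z
    proof (rule set_integral_bound[OF B])
      show "(\<lambda>y. F (x, y, z)) \<in> borel_measurable borel"
        using F by (rule measurable_compose[rotated]) (simp add: borel_prod[symmetric])
    qed (use bd' that C' in auto)
    show ?thesis
      using set_Fubini_bounded[OF A D m, of "measure lborel B * C'"] b by simp
  qed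
  have 3: "(LINT x:A|lborel. LINT y:B|lborel. F (x, y, z)) = (LINT y:B|lborel. LINT x:A|lborel. F (x, y, z))"
    if "z \<in> D" for z
  proof (rule set_Fubini_bounded[OF A B, where F = "\<lambda>p. F (fst p, snd p, z)" and C = C', simplified])
    show "(\<lambda>p. F (fst p, snd p, z)) \<in> borel_measurable borel"
      using F by (rule measurable_compose[rotated]) (simp add: borel_prod[symmetric])
  qed (use bd' that in auto)
  have "(LINT x:A|lborel. LINT y:B|lborel. LINT z:D|lborel. F (x, y, z))
      = (LINT x:A|lborel. LINT z:D|lborel. LINT y:B|lborel. F (x, y, z))"
    using A 1 by (intro set_lebesgue_integral_cong) auto
  also note 2
  also have "(LINT z:D|lborel. LINT x:A|lborel. LINT y:B|lborel. F (x, y, z))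
      = (LINT z:D|lborel. LINT y:B|lborel. LINT x:A|lborel. F (x, y, z))"
    using D 3 by (intro set_lebesgue_integral_cong) auto
  finally show ?thesis .
qed

section \<open>Invariance of Lebesgue measure under linear isometries\<close>

text \<open>Applied to the set where a continuous function is nonzero, this turns vanishing almost
  everywhere into vanishing everywhere.\<close>

lemma open_AE_notin_empty:
  fixes V :: "'a::euclidean_space set"
  assumes "open V" and ae: "AE x in lborel. x \<notin> V"
  shows "V = {}"
proof -
  have "V \<in> null_sets lborel"
    by (intro AE_iff_null_sets[THEN iffD2, OF _ ae]) (simp add: borel_open \<open>open V\<close>)
  then have "negligible V"
    by (simp add: negligible_iff_null_sets null_sets_completionI)
  then show ?thesis
    using \<open>open V\<close> open_not_negligible by blast
qed

lemma nn_integral_lborel_translate: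
  fixes f :: "'a::euclidean_space \<Rightarrow> ennreal"
  assumes "f \<in> borel_measurable borel"
  shows "(\<integral>\<^sup>+x. f (c + x) \<partial>lborel) = (\<integral>\<^sup>+x. f x \<partial>lborel)"
  using assms by (subst (2) lborel_distr_plus[of c, symmetric]) (simp add: nn_integral_distr)

lemma lborel_distr_isometry:
  fixes T :: "'a::euclidean_space \<Rightarrow> 'a"
  assumes lin: "linear T" and iso: "\<And>x. norm (T x) = norm x"
  shows "distr lborel borel T = lborel"
proof (rule measure_eqI)
  show "sets (distr lborel borel T) = sets (lborel :: 'a measure)" by simp
  fix A assume "A \<in> sets (distr lborel borel T)"
  then have A[measurable]: "A \<in> sets borel" by simp
  have T[measurable]: "T \<in> borel_measurable borel"
    using lin by (intro borel_measurable_continuous_onI linear_continuous_on linear_conv_bounded_linear[THEN iffD1])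
  have inj: "inj T"
    by (rule linear_injective_0[OF lin, THEN iffD2]) (metis iso norm_eq_zero)
  then have surj: "surj T"
    using lin linear_injective_imp_surjective by blast
  let ?B = "cball (0::'a) 1"
  have [measurable]: "?B \<in> sets borel" by simp
  let ?a = "emeasure lborel (T -` A)"
  text \<open>Uniqueness of the translation invariant measure: integrate \<open>1\<^sub>A(T x) 1\<^sub>B(T x + T y)\<close>, where the
    ball \<open>B\<close> is invariant under \<open>T\<close>, in both orders.\<close>
  have "?a * emeasure lborel ?B = (\<integral>\<^sup>+x. \<integral>\<^sup>+y. indicator A (T x) * indicator ?B y \<partial>lborel \<partial>lborel)"
  proof -
    have "(\<integral>\<^sup>+x. \<integral>\<^sup>+y. indicator A (T x) * indicator ?B y \<partial>lborel \<partial>lborel)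
        = (\<integral>\<^sup>+x. indicator (T -` A) x * emeasure lborel ?B \<partial>lborel)"
      by (intro nn_integral_cong) (subst nn_integral_cmult_indicator, simp_all add: indicator_vimage)
    also have "\<dots> = ?a * emeasure lborel ?B"
      using measurable_sets[OF T A] by (simp add: nn_integral_multc)
    finally show ?thesis by simp
  qed
  also have "\<dots> = (\<integral>\<^sup>+x. \<integral>\<^sup>+y. indicator A (T x) * indicator ?B (T x + y) \<partial>lborel \<partial>lborel)"
  proof (rule nn_integral_cong)
    fix x
    show "(\<integral>\<^sup>+y. indicator A (T x) * indicator ?B y \<partial>lborel)
        = (\<integral>\<^sup>+y. indicator A (T x) * indicator ?B (T x + y) \<partial>lborel :: ennreal)"
      by (rule nn_integral_lborel_translate[symmetric]) measurable
  qed
  also have "\<dots> = (\<integral>\<^sup>+y. \<integral>\<^sup>+x. indicator A (T x) * indicator ?B (T x + y) \<partial>lborel \<partial>lborel)"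
    by (rule lborel_pair.Fubini') measurable
  also have "\<dots> = (\<integral>\<^sup>+y. \<integral>\<^sup>+x. indicator A (T x - y) * indicator ?B (T x) \<partial>lborel \<partial>lborel)"
  proof (rule nn_integral_cong)
    fix y :: 'a
    obtain c where c: "T c = - y" using surj by (metis surjD)
    show "(\<integral>\<^sup>+x. indicator A (T x) * indicator ?B (T x + y) \<partial>lborel)
        = (\<integral>\<^sup>+x. indicator A (T x - y) * indicator ?B (T x) \<partial>lborel :: ennreal)"
      using nn_integral_lborel_translate[of "\<lambda>x. indicator A (T x) * indicator ?B (T x + y)" c]
      by (simp add: linear_add[OF lin] c del: mem_cball)
  qed
  also have "\<dots> = (\<integral>\<^sup>+x. \<integral>\<^sup>+y. indicator A (T x - y) * indicator ?B (T x) \<partial>lborel \<partial>lborel)"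
    by (rule lborel_pair.Fubini'[symmetric]) measurable
  also have "\<dots> = (\<integral>\<^sup>+x. emeasure lborel A * indicator ?B x \<partial>lborel)"
  proof (intro nn_integral_cong)
    fix x :: 'a
    have refl: "distr lborel borel (\<lambda>y. T x - y) = lborel"
      using lborel_affine[of "-1" "T x"] by (simp add: density_1)
    have "(\<integral>\<^sup>+y. indicator A (T x - y) * indicator ?B (T x) \<partial>lborel)
        = (\<integral>\<^sup>+y. indicator A y * indicator ?B (T x) \<partial>distr lborel borel (\<lambda>y. T x - y))"
      by (subst nn_integral_distr) auto
    also have "\<dots> = (\<integral>\<^sup>+y. indicator A y * indicator ?B (T x) \<partial>lborel)"
      by (simp only: refl)
    also have "\<dots> = emeasure lborel A * indicator ?B x"
      by (simp add: nn_integral_multc) (simp add: indicator_def iso)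
    finally show "(\<integral>\<^sup>+y. indicator A (T x - y) * indicator ?B (T x) \<partial>lborel)
        = emeasure lborel A * indicator ?B x" .
  qed
  also have "\<dots> = emeasure lborel A * emeasure lborel ?B"
    by (simp add: nn_integral_cmult)
  finally have "?a * emeasure lborel ?B = emeasure lborel A * emeasure lborel ?B" .
  moreover have "emeasure lborel ?B \<noteq> 0" "emeasure lborel ?B \<noteq> \<infinity>"
    using content_cball_pos[of 1 "0::'a"] emeasure_lborel_cball_finite[of "0::'a" 1] by (auto simp: measure_def)
  ultimately have "?a = emeasure lborel A"
    by (metis ennreal_mult_cancel_left infinity_ennreal_def mult.commute)
  then show "emeasure (distr lborel borel T) A = emeasure lborel A"
    by (simp add: emeasure_distr)
qed

lemma integral_lborel_isometry:
  fixes T :: "'a::euclidean_space \<Rightarrow> 'a" and f :: "'a \<Rightarrow> complex"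
  assumes lin: "linear T" and iso: "\<And>x. norm (T x) = norm x" and f: "f \<in> borel_measurable borel"
  shows "(LINT x|lborel. f (T x)) = (LINT x|lborel. f x)"
proof -
  have T: "T \<in> borel_measurable borel"
    using lin by (intro borel_measurable_continuous_onI linear_continuous_on linear_conv_bounded_linear[THEN iffD1])
  show ?thesis
    using T f by (subst (2) lborel_distr_isometry[OF lin iso, symmetric]) (simp add: integral_distr)
qed

section \<open>Fourier coefficients of entire functions\<close>

abbreviation circle_mean :: "(real \<Rightarrow> complex) \<Rightarrow> complex" where
  "circle_mean f \<equiv> (LINT t:{0..1}|lborel. f t)"

lemma set_integrable_continuous_01:
  fixes f :: "real \<Rightarrow> complex"
  assumes "continuous_on UNIV f"
  shows "set_integrable lborel {0..1} f"
  using assms by (intro borel_integrable_atLeastAtMost' continuous_on_subset[OF assms]) auto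

lemma circle_mean_eq_integral:
  assumes "continuous_on UNIV f"
  shows "circle_mean f = integral {0..1} f"
  by (rule set_borel_integral_eq_integral(2)) (rule set_integrable_continuous_01[OF assms])

text \<open>Cauchy's formula for the m-th derivative at 0 over the unit circle, in the parameter u =
  cis (2 pi t) with du = 2 pi i u dt.\<close>

lemma circle_mean_coefficient:
  assumes G: "G holomorphic_on UNIV"
  shows "circle_mean (\<lambda>t. cis (- (2 * pi * real m * t)) * G (cis (2 * pi * t))) = (deriv ^^ m) G 0 / fact m"
proof -
  have cont: "continuous_on UNIV G"
    using G holomorphic_on_imp_continuous_on by blast
  have exp_cis: "exp (2 * complex_of_real pi * \<i> * of_real t) = cis (2 * pi * t)" for t
    by (simp add: cis_conv_exp mult_ac)
  have c: "continuous_on UNIV (\<lambda>t. cis (- (2 * pi * real m * t)) * G (cis (2 * pi * t)))"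
    by (intro continuous_intros continuous_on_compose2[OF cont]) auto
  have "((\<lambda>u. G u / (u - 0) ^ Suc m) has_contour_integral (2 * pi * \<i>) / fact m * (deriv ^^ m) G 0) (circlepath 0 1)"
    by (rule Cauchy_has_contour_integral_higher_derivative_circlepath)
       (use G cont in \<open>auto intro: continuous_on_subset holomorphic_on_subset\<close>)
  then have "((\<lambda>t. G (cis (2 * pi * t)) / cis (2 * pi * t) ^ Suc m * (2 * pi * \<i> * cis (2 * pi * t))) has_integral
     (2 * pi * \<i>) / fact m * (deriv ^^ m) G 0) {0..1}"
    unfolding has_contour_integral_def
  proof (rule has_integral_eq[rotated])
    fix t :: real assume "t \<in> {0..1}"
    then have "vector_derivative (circlepath 0 1) (at t within {0..1}) = 2 * pi * \<i> * cis (2 * pi * t)"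
      using vector_derivative_circlepath01[of t 0 1] exp_cis[of t] by simp
    moreover have "circlepath 0 1 t = cis (2 * pi * t)"
      using exp_cis[of t] by (simp add: circlepath)
    ultimately show "G (circlepath 0 1 t) / (circlepath 0 1 t - 0) ^ Suc m * vector_derivative (circlepath 0 1) (at t within {0..1})
        = G (cis (2 * pi * t)) / cis (2 * pi * t) ^ Suc m * (2 * pi * \<i> * cis (2 * pi * t))"
      by simp
  qed
  then have "((\<lambda>t. inverse (2 * pi * \<i>) * (G (cis (2 * pi * t)) / cis (2 * pi * t) ^ Suc m * (2 * pi * \<i> * cis (2 * pi * t)))) has_integral
     inverse (2 * pi * \<i>) * ((2 * pi * \<i>) / fact m * (deriv ^^ m) G 0)) {0..1}"
    by (rule has_integral_mult_right)
  moreover have "inverse (2 * pi * \<i>) * (G (cis (2 * pi * t)) / cis (2 * pi * t) ^ Suc m * (2 * pi * \<i> * cis (2 * pi * t)))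
      = cis (- (2 * pi * real m * t)) * G (cis (2 * pi * t))" for t
  proof -
    have "cis (- (2 * pi * real m * t)) = inverse (cis (2 * pi * t) ^ m)"
      by (simp add: Complex.DeMoivre mult_ac flip: cis_inverse)
    then show ?thesis
      by (simp add: field_simps)
  qed
  moreover have "inverse (2 * pi * \<i>) * ((2 * pi * \<i>) / fact m * (deriv ^^ m) G 0) = (deriv ^^ m) G 0 / fact m"
    by (simp add: field_simps)
  ultimately have "((\<lambda>t. cis (- (2 * pi * real m * t)) * G (cis (2 * pi * t))) has_integral (deriv ^^ m) G 0 / fact m) {0..1}"
    by simp
  then show ?thesis
    by (simp add: circle_mean_eq_integral[OF c] integral_unique)
qed

lemma circle_mean_value:
  assumes "G holomorphic_on UNIV"
  shows "circle_mean (\<lambda>t. G (cis (2 * pi * t))) = G 0"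
  using circle_mean_coefficient[OF assms, of 0] by simp

text \<open>Both sides are Taylor coefficients at 0, so s may be any complex number, not only a
  phase. This is how moving a point within a complex line becomes a scalar acting on the m-th
  coefficient.\<close>

lemma circle_mean_coefficient_scaled:
  assumes G: "G holomorphic_on UNIV"
  shows "circle_mean (\<lambda>t. cis (- (2 * pi * real m * t)) * G (cis (2 * pi * t) * s))
       = s ^ m * circle_mean (\<lambda>t. cis (- (2 * pi * real m * t)) * G (cis (2 * pi * t)))"
proof -
  have "(\<lambda>w. G (w * s)) holomorphic_on UNIV"
    by (rule holomorphic_on_compose_gen[OF _ G, unfolded o_def]) (auto intro!: holomorphic_intros)
  from circle_mean_coefficient[OF this, of m]
  have "circle_mean (\<lambda>t. cis (- (2 * pi * real m * t)) * G (cis (2 * pi * t) * s)) = (deriv ^^ m) (\<lambda>w. G (w * s)) 0 / fact m" .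
  also have "(deriv ^^ m) (\<lambda>w. G (s * w)) 0 = s ^ m * (deriv ^^ m) G (s * 0)"
    by (rule higher_deriv_compose_linear[OF G, where S = UNIV]) auto
  then have "(deriv ^^ m) (\<lambda>w. G (w * s)) 0 = s ^ m * (deriv ^^ m) G 0"
    by (simp add: mult.commute)
  finally show ?thesis
    by (simp add: circle_mean_coefficient[OF G])
qed

lemma entire_zero_if_circle_means_zero:
  assumes G: "G holomorphic_on UNIV"
    and zero: "\<And>m. circle_mean (\<lambda>t. cis (- (2 * pi * real m * t)) * G (cis (2 * pi * t))) = 0"
  shows "G w = 0"
proof -
  have "(deriv ^^ m) G 0 = 0" for m
    using zero[of m] by (simp add: circle_mean_coefficient[OF G])
  then show ?thesis
    by (intro holomorphic_fun_eq_0_on_connected[OF G, of 0]) auto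
qed

lemma circle_mean_cis_exp:
  "circle_mean (\<lambda>t. cis (- (2 * pi * real m * t)) * exp (a * cis (2 * pi * t))) = a ^ m / fact m"
proof -
  have "(deriv ^^ m) (\<lambda>w. exp (a * w)) 0 = a ^ m * (deriv ^^ m) exp (a * 0)"
    by (rule higher_deriv_compose_linear[where S = UNIV and T = UNIV]) (auto intro!: holomorphic_intros)
  moreover have "(deriv ^^ m) exp = (exp :: complex \<Rightarrow> complex)"
  proof (induction m)
    case (Suc m)
    then show ?case
      by (auto intro!: ext DERIV_imp_deriv)
  qed simp
  moreover have "(\<lambda>w. exp (a * w)) holomorphic_on UNIV"
    by (intro holomorphic_intros)
  ultimately show ?thesis
    by (subst circle_mean_coefficient) auto
qed

lemma circle_mean_cis_exp_conj:
  "circle_mean (\<lambda>t. cis (2 * pi * real m * t) * exp (a * cis (- (2 * pi * t)))) = a ^ m / fact m"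
proof -
  have "circle_mean (\<lambda>t. cis (2 * pi * real m * t) * exp (a * cis (- (2 * pi * t))))
      = circle_mean (\<lambda>t. cnj (cis (- (2 * pi * real m * t)) * exp (cnj a * cis (2 * pi * t))))"
    by (simp add: cis_cnj exp_cnj)
  also have "\<dots> = cnj (circle_mean (\<lambda>t. cis (- (2 * pi * real m * t)) * exp (cnj a * cis (2 * pi * t))))"
    unfolding set_lebesgue_integral_def
    by (simp only: complex_cnj_scaleR[symmetric] Bochner_Integration.integral_cnj)
  also have "\<dots> = a ^ m / fact m"
    unfolding circle_mean_cis_exp by simp
  finally show ?thesis .
qed

text \<open>The i-th binomial term has frequency p + i and so pairs with exactly one term of the
  exponential series. The sum is the scalar of the parallel case.\<close>

lemma circle_mean_binomial_exp:
  "circle_mean (\<lambda>t. cis (2 * pi * real p * t) * (exp (a * cis (- (2 * pi * t))) * (b + d * cis (2 * pi * t)) ^ m))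
    = (\<Sum>i\<le>m. of_nat (m choose i) * d ^ i * b ^ (m - i) * (a ^ (p + i) / fact (p + i)))"
proof -
  have "circle_mean (\<lambda>t. cis (2 * pi * real p * t) * (exp (a * cis (- (2 * pi * t))) * (b + d * cis (2 * pi * t)) ^ m))
    = circle_mean (\<lambda>t. \<Sum>i\<le>m. of_nat (m choose i) * d ^ i * b ^ (m - i) *
        (cis (2 * pi * real (p + i) * t) * exp (a * cis (- (2 * pi * t)))))"
  proof (rule arg_cong[where f = circle_mean], rule ext)
    fix t
    have "(b + d * cis (2 * pi * t)) ^ m = (\<Sum>i\<le>m. of_nat (m choose i) * (d * cis (2 * pi * t)) ^ i * b ^ (m - i))"
      by (subst add.commute) (rule binomial_ring)
    moreover have "cis (2 * pi * real (p + i) * t) = cis (2 * pi * real p * t) * cis (2 * pi * t) ^ i" for i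
      by (simp only: Complex.DeMoivre cis_mult) (simp add: algebra_simps)
    ultimately show "cis (2 * pi * real p * t) * (exp (a * cis (- (2 * pi * t))) * (b + d * cis (2 * pi * t)) ^ m)
      = (\<Sum>i\<le>m. of_nat (m choose i) * d ^ i * b ^ (m - i) *
        (cis (2 * pi * real (p + i) * t) * exp (a * cis (- (2 * pi * t)))))"
      by (simp add: sum_distrib_left power_mult_distrib mult_ac)
  qed
  also have "\<dots> = (\<Sum>i\<le>m. circle_mean (\<lambda>t. of_nat (m choose i) * d ^ i * b ^ (m - i) *
        (cis (2 * pi * real (p + i) * t) * exp (a * cis (- (2 * pi * t))))))"
    unfolding set_lebesgue_integral_def scaleR_sum_right
    by (rule Bochner_Integration.integral_sum)
       (intro set_integrable_continuous_01[unfolded set_integrable_def] continuous_intros | simp)+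
  also have "\<dots> = (\<Sum>i\<le>m. of_nat (m choose i) * d ^ i * b ^ (m - i) * (a ^ (p + i) / fact (p + i)))"
    by (simp only: set_integral_mult_right circle_mean_cis_exp_conj)
  finally show ?thesis .
qed

lemma circle_mean_cis_int:
  "circle_mean (\<lambda>t. cis (2 * pi * of_int j * t)) = (if j = 0 then 1 else 0)"
proof -
  have pos: "circle_mean (\<lambda>t. cis (2 * pi * real m * t)) = (if m = 0 then 1 else 0)" for m
    using circle_mean_cis_exp_conj[of m 0] by (auto simp: power_0_left)
  have neg: "circle_mean (\<lambda>t. cis (- (2 * pi * real m * t))) = (if m = 0 then 1 else 0)" for m
    using circle_mean_cis_exp[of m 0] by (auto simp: power_0_left)
  show ?thesis
  proof (cases "j \<ge> 0")
    case True then show ?thesis using pos[of "nat j"] by auto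
  next
    case False then show ?thesis using neg[of "nat (- j)"] by auto
  qed
qed

section \<open>Spherical means in complex vector spaces\<close>

definition herm :: "complex^'n \<Rightarrow> complex^'n \<Rightarrow> complex" where
  "herm x y = (\<Sum>i\<in>UNIV. x $ i * cnj (y $ i))"

lemma herm_add_left: "herm (x + y) z = herm x z + herm y z"
  by (simp add: herm_def sum.distrib algebra_simps)

lemma herm_add_right: "herm x (y + z) = herm x y + herm x z"
  by (simp add: herm_def sum.distrib algebra_simps)

lemma herm_diff_left: "herm (x - y) z = herm x z - herm y z"
  by (simp add: herm_def sum_subtractf algebra_simps)

lemma herm_diff_right: "herm x (y - z) = herm x y - herm x z"
  by (simp add: herm_def sum_subtractf algebra_simps)

lemma herm_smult_left: "herm (c *s x) y = c * herm x y"
  by (simp add: herm_def sum_distrib_left mult_ac)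

lemma herm_smult_right: "herm x (c *s y) = cnj c * herm x y"
  by (simp add: herm_def sum_distrib_left mult_ac)

lemma scaleR_eq_smult: "r *\<^sub>R (x :: complex^'n) = of_real r *s x"
  by (simp add: vec_eq_iff) (simp add: scaleR_conv_of_real)

lemma herm_scaleR_left: "herm (r *\<^sub>R x) y = of_real r * herm x y"
  by (simp add: scaleR_eq_smult herm_smult_left)

lemma herm_scaleR_right: "herm x (r *\<^sub>R y) = of_real r * herm x y"
  by (simp add: scaleR_eq_smult herm_smult_right)

lemma herm_zero_left: "herm 0 y = 0"
  by (simp add: herm_def)

lemma herm_zero_right: "herm y 0 = 0"
  by (simp add: herm_def)

lemma herm_minus_right: "herm x (- y) = - herm x y"
  by (simp add: herm_def sum_negf)

lemma cnj_herm: "cnj (herm x y) = herm y x"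
  by (simp add: herm_def mult.commute)

lemma Re_herm: "Re (herm x y) = x \<bullet> y"
  by (simp add: herm_def inner_vec_def inner_complex_def Re_sum)

lemma herm_self: "herm x x = of_real ((norm x)\<^sup>2)"
proof -
  have "Im (herm x x) = 0" by (simp add: herm_def Im_sum)
  then show ?thesis
    by (simp add: complex_eq_iff Re_herm power2_norm_eq_inner)
qed

lemmas herm_simps = herm_add_left herm_add_right herm_diff_left herm_diff_right herm_smult_left
  herm_smult_right herm_scaleR_left herm_scaleR_right herm_zero_left herm_zero_right

lemma continuous_on_herm [continuous_intros]:
  "continuous_on A f \<Longrightarrow> continuous_on A g \<Longrightarrow> continuous_on A (\<lambda>x. herm (f x) (g x))"
  unfolding herm_def by (intro continuous_intros)

lemma continuous_on_smult [continuous_intros]: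
  fixes g :: "_ \<Rightarrow> complex^'n"
  assumes "continuous_on A f" "continuous_on A g"
  shows "continuous_on A (\<lambda>x. f x *s g x)"
proof -
  have eq: "(\<lambda>x. f x *s g x) = (\<lambda>x. \<chi> i. f x * g x $ i)"
    by (simp add: fun_eq_iff vec_eq_iff)
  show ?thesis
    unfolding eq using assms by (intro continuous_intros)
qed

lemma of_real_cmod_square: "(complex_of_real (cmod z))\<^sup>2 = z * cnj z"
  by (metis complex_norm_square of_real_power)

lemma norm_smult: "norm (c *s (x :: complex^'n)) = cmod c * norm x"
proof -
  have "complex_of_real ((norm (c *s x))\<^sup>2) = of_real ((cmod c * norm x)\<^sup>2)"
    unfolding herm_self[symmetric] herm_smult_left herm_smult_right
    by (simp add: herm_self power_mult_distrib of_real_cmod_square mult_ac)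
  then have "(norm (c *s x))\<^sup>2 = (cmod c * norm x)\<^sup>2"
    by (simp only: of_real_eq_iff)
  then show ?thesis by (simp add: power2_eq_iff_nonneg)
qed

lemma smult_add_right: "c *s (x + y) = c *s x + c *s (y :: complex^'n)"
  by (simp add: vec_eq_iff algebra_simps)

lemma linear_smult: "linear ((*s) c :: complex^'n \<Rightarrow> complex^'n)"
  by (rule linearI) (simp_all add: vec_eq_iff algebra_simps)

lemma norm_add_orthogonal:
  assumes "herm p q = 0"
  shows "(norm (p + q))\<^sup>2 = (norm p)\<^sup>2 + (norm q)\<^sup>2"
proof -
  have "p \<bullet> q = 0" using assms Re_herm[of p q] by simp
  then show ?thesis
    by (simp add: power2_norm_eq_inner inner_add_left inner_add_right inner_commute)
qed

section \<open>Means over the unit sphere\<close>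

definition line_holomorphic :: "(complex^'n \<Rightarrow> complex) \<Rightarrow> bool" where
  "line_holomorphic G \<longleftrightarrow> (\<forall>a b. (\<lambda>\<zeta>. G (a + \<zeta> *s b)) holomorphic_on UNIV)"

text \<open>A radially constant integrand over the ball stands in for surface measure, up to a
  positive factor. The value \<open>sgn 0 = 0\<close> concerns one point only.\<close>

abbreviation sphere_mean :: "(complex^'n \<Rightarrow> complex) \<Rightarrow> complex" where
  "sphere_mean f \<equiv> (LINT w:cball 0 1|lborel. f (sgn w))"

lemma borel_measurable_sgn_vec: "(sgn :: 'a::euclidean_space \<Rightarrow> 'a) \<in> borel_measurable borel"
  unfolding sgn_div_norm by measurable

lemma norm_sgn_le: "norm (sgn (w::'a::real_normed_vector)) \<le> 1"
  by (simp add: norm_sgn)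

lemma bounded_on_cball_box:
  fixes H :: "'a::euclidean_space \<times> 'b::euclidean_space \<Rightarrow> complex"
  assumes "continuous_on UNIV H" "compact A" "compact B"
  obtains C where "\<And>x y. x \<in> A \<Longrightarrow> y \<in> B \<Longrightarrow> cmod (H (x, y)) \<le> C"
proof -
  have "compact (H ` (A \<times> B))"
    using assms by (intro compact_continuous_image compact_Times) (auto intro: continuous_on_subset)
  then obtain C where "\<forall>x\<in>H ` (A \<times> B). cmod x \<le> C"
    using compact_imp_bounded bounded_iff by blast
  then show ?thesis by (intro that[of C]) auto
qed

lemma circle_circle_swap:
  assumes "continuous_on UNIV H"
  shows "circle_mean (\<lambda>s. circle_mean (\<lambda>t. H (s, t))) = circle_mean (\<lambda>t. circle_mean (\<lambda>s. H (s, t)))"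
proof -
  obtain C where C: "\<And>x y. x \<in> {0..1} \<Longrightarrow> y \<in> {0..1} \<Longrightarrow> cmod (H (x, y)) \<le> C"
    using bounded_on_cball_box[OF assms compact_Icc compact_Icc] by blast
  show ?thesis
    by (rule set_Fubini_bounded[where C = C])
       (use C borel_measurable_continuous_onI[OF assms] in auto)
qed

lemma circle_sphere_swap:
  fixes H :: "real \<times> (complex^'n) \<Rightarrow> complex"
  assumes "continuous_on UNIV H"
  shows "circle_mean (\<lambda>t. sphere_mean (\<lambda>w. H (t, w))) = sphere_mean (\<lambda>w. circle_mean (\<lambda>t. H (t, w)))"
proof -
  obtain C where C: "\<And>x y. x \<in> {0..1} \<Longrightarrow> y \<in> cball 0 1 \<Longrightarrow> cmod (H (x, y)) \<le> C"
    using bounded_on_cball_box[OF assms compact_Icc compact_cball] by blast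
  have "(\<lambda>p. H (fst p, sgn (snd p))) \<in> borel_measurable borel"
  proof (rule measurable_compose[OF _ borel_measurable_continuous_onI[OF assms]])
    show "(\<lambda>p. (fst p, sgn (snd p :: complex^'n))) \<in> borel_measurable (borel :: (real \<times> (complex^'n)) measure)"
      unfolding borel_prod[symmetric]
      using borel_measurable_sgn_vec by measurable
  qed
  from set_Fubini_bounded[OF _ _ _ _ this, of "{0..1}" "cball 0 1" C] C norm_sgn_le
  show ?thesis
    by auto
qed

lemma sphere_mean_isometry:
  fixes T :: "complex^'n \<Rightarrow> complex^'n"
  assumes lin: "linear T" and iso: "\<And>w. norm (T w) = norm w" and f: "continuous_on UNIV f"
  shows "sphere_mean (\<lambda>w. f (T w)) = sphere_mean f"
proof -
  have sgnT: "sgn (T w) = T (sgn w)" for w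
    by (simp add: sgn_div_norm iso linear_scale[OF lin])
  have "(LINT w|lborel. indicator (cball 0 1) (T w) *\<^sub>R f (sgn (T w)))
      = (LINT w|lborel. indicator (cball 0 1) w *\<^sub>R f (sgn w))"
    using measurable_compose[OF borel_measurable_sgn_vec borel_measurable_continuous_onI[OF f]]
    by (intro integral_lborel_isometry[OF lin iso, where f = "\<lambda>w. indicator (cball 0 1) w *\<^sub>R f (sgn w)"])
       (intro borel_measurable_scaleR borel_measurable_indicator, simp_all)
  then show ?thesis
    by (simp add: set_lebesgue_integral_def sgnT indicator_def iso)
qed

lemma sphere_mean_rotate:
  assumes "continuous_on UNIV f"
  shows "sphere_mean (\<lambda>w. f (cis t *s w)) = sphere_mean f"
proof (rule sphere_mean_isometry[OF _ _ assms])
  show "linear ((*s) (cis t) :: complex^'n \<Rightarrow> complex^'n)"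
    by (rule linear_smult)
qed (simp add: norm_smult)

lemma set_integrable_sphere:
  fixes f :: "complex^'n \<Rightarrow> complex"
  assumes "continuous_on UNIV f"
  shows "set_integrable lborel (cball 0 1) (\<lambda>w. f (sgn w))"
proof -
  have "bounded (f ` cball 0 1)"
    using assms by (intro compact_imp_bounded compact_continuous_image) (auto intro: continuous_on_subset)
  then obtain C where C: "\<And>w. norm w \<le> 1 \<Longrightarrow> cmod (f w) \<le> C"
    by (metis bounded_iff image_eqI mem_cball_0)
  show ?thesis
    using C measurable_compose[OF borel_measurable_sgn_vec borel_measurable_continuous_onI[OF assms]] norm_sgn_le
    by (intro set_integrable_bounded[where C = C]) auto
qed

lemma circle_mean_const: "circle_mean (\<lambda>_. c) = c"
  by (simp add: set_lebesgue_integral_def)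

text \<open>Rotating the component of \<open>w\<close> orthogonal to \<open>\<eta>\<close> and applying the mean value property
  removes it from the holomorphic factor.\<close>

lemma sphere_mean_holomorphic_factor:
  fixes G :: "complex^'n \<Rightarrow> complex"
  assumes A: "continuous_on UNIV A" and G: "continuous_on UNIV G" and hol: "line_holomorphic G"
    and \<eta>: "norm \<eta> = 1"
  shows "sphere_mean (\<lambda>w. A (herm w \<eta>) * G w) = sphere_mean (\<lambda>w. A (herm w \<eta>) * G (herm w \<eta> *s \<eta>))"
proof -
  define T where "T \<theta> w = herm w \<eta> *s \<eta> + cis (2 * pi * \<theta>) *s (w - herm w \<eta> *s \<eta>)" for \<theta> w
  have \<eta>\<eta>: "herm \<eta> \<eta> = 1" by (simp add: herm_self \<eta>)
  have hT: "herm (T \<theta> w) \<eta> = herm w \<eta>" for \<theta> w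
    by (simp add: T_def herm_simps \<eta>\<eta>)
  have lin: "linear (T \<theta>)" for \<theta>
    by (rule linearI) (simp_all add: T_def scaleR_eq_smult herm_simps vec_eq_iff algebra_simps)
  have iso: "norm (T \<theta> w) = norm w" for \<theta> w
  proof -
    have o1: "herm (herm w \<eta> *s \<eta>) (c *s (w - herm w \<eta> *s \<eta>)) = 0" for c
      by (simp add: herm_simps \<eta>\<eta> cnj_herm)
    have "(norm (T \<theta> w))\<^sup>2 = (norm (herm w \<eta> *s \<eta>))\<^sup>2 + (norm (w - herm w \<eta> *s \<eta>))\<^sup>2"
      unfolding T_def norm_add_orthogonal[OF o1] by (simp only: norm_smult norm_cis mult_1)
    also have "\<dots> = (norm (herm w \<eta> *s \<eta> + (w - herm w \<eta> *s \<eta>)))\<^sup>2"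
      using norm_add_orthogonal[OF o1[of 1]] by simp
    finally show ?thesis by (simp add: power2_eq_iff_nonneg)
  qed
  have cT: "continuous_on UNIV (\<lambda>p. T (fst p) (snd p))"
    unfolding T_def by (intro continuous_intros)
  have cont: "continuous_on UNIV (\<lambda>p. A (herm (snd p) \<eta>) * G (T (fst p) (snd p)))"
    by (intro continuous_intros continuous_on_compose2[OF A] continuous_on_compose2[OF G cT]) auto
  have c1: "continuous_on UNIV (\<lambda>w. A (herm w \<eta>) * G w)"
    by (intro continuous_intros continuous_on_compose2[OF A] G) auto
  have inner: "circle_mean (\<lambda>\<theta>. A (herm w \<eta>) * G (T \<theta> w)) = A (herm w \<eta>) * G (herm w \<eta> *s \<eta>)" for w
  proof -
    have "(\<lambda>\<zeta>. G (herm w \<eta> *s \<eta> + \<zeta> *s (w - herm w \<eta> *s \<eta>))) holomorphic_on UNIV"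
      using hol unfolding line_holomorphic_def by blast
    from circle_mean_value[OF this] show ?thesis
      by (simp only: T_def set_integral_mult_right vector_smult_lzero add_0_right)
  qed
  have "sphere_mean (\<lambda>w. A (herm w \<eta>) * G w)
      = circle_mean (\<lambda>\<theta>. sphere_mean (\<lambda>w. A (herm w \<eta>) * G (T \<theta> w)))"
    using sphere_mean_isometry[OF lin iso c1] by (simp add: hT circle_mean_const)
  also have "\<dots> = sphere_mean (\<lambda>w. circle_mean (\<lambda>\<theta>. A (herm w \<eta>) * G (T \<theta> w)))"
    using circle_sphere_swap[OF cont] by simp
  also have "\<dots> = sphere_mean (\<lambda>w. A (herm w \<eta>) * G (herm w \<eta> *s \<eta>))"
    by (simp only: inner)
  finally show ?thesis .
qed

definition sphere_moment :: "complex^'n \<Rightarrow> nat \<Rightarrow> complex" where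
  "sphere_moment \<eta> i = sphere_mean (\<lambda>w. herm w \<eta> ^ i * cnj (herm w \<eta>) ^ i)"

text \<open>The sphere is invariant under scalar phases. Averaging over the phase pairs each power
  of \<open>herm w \<eta>\<close> from the binomial with the equal power of its conjugate from the
  exponential series.\<close>

lemma sphere_mean_exp_binomial:
  fixes \<eta> :: "complex^'n"
  shows "sphere_mean (\<lambda>w. exp (- a * cnj (herm w \<eta>)) * (1 + b * herm w \<eta>) ^ m)
    = (\<Sum>i\<le>m. of_nat (m choose i) * (- (a * b)) ^ i / fact i * sphere_moment \<eta> i)"
proof -
  define f where "f w = exp (- a * cnj (herm w \<eta>)) * (1 + b * herm w \<eta>) ^ m" for w
  have f: "continuous_on UNIV f"
    unfolding f_def by (intro continuous_intros)
  have "sphere_mean f = circle_mean (\<lambda>\<theta>. sphere_mean (\<lambda>w. f (cis (2 * pi * \<theta>) *s w)))"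
    by (simp only: sphere_mean_rotate[OF f] circle_mean_const)
  also have "\<dots> = sphere_mean (\<lambda>w. circle_mean (\<lambda>\<theta>. f (cis (2 * pi * \<theta>) *s w)))"
  proof -
    have "continuous_on UNIV (\<lambda>p. f (cis (2 * pi * fst p) *s snd p))"
      by (intro continuous_on_compose2[OF f] continuous_intros) auto
    from circle_sphere_swap[OF this] show ?thesis by simp
  qed
  also have "\<dots> = sphere_mean (\<lambda>w. \<Sum>i\<le>m. of_nat (m choose i) * (- (a * b)) ^ i / fact i * (herm w \<eta> ^ i * cnj (herm w \<eta>) ^ i))"
  proof -
    have "circle_mean (\<lambda>\<theta>. f (cis (2 * pi * \<theta>) *s w))
        = (\<Sum>i\<le>m. of_nat (m choose i) * (- (a * b)) ^ i / fact i * (herm w \<eta> ^ i * cnj (herm w \<eta>) ^ i))" for w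
    proof -
      have "circle_mean (\<lambda>\<theta>. f (cis (2 * pi * \<theta>) *s w))
          = circle_mean (\<lambda>\<theta>. cis (2 * pi * real 0 * \<theta>) * (exp ((- a * cnj (herm w \<eta>)) * cis (- (2 * pi * \<theta>)))
              * (1 + (b * herm w \<eta>) * cis (2 * pi * \<theta>)) ^ m))"
        by (simp add: f_def herm_simps cis_cnj mult_ac)
      also have "\<dots> = (\<Sum>i\<le>m. of_nat (m choose i) * (- (a * b)) ^ i / fact i * (herm w \<eta> ^ i * cnj (herm w \<eta>) ^ i))"
        unfolding circle_mean_binomial_exp
        by (intro sum.cong refl) (simp add: power_mult_distrib power_minus[of "_ * _"] mult_ac)
      finally show ?thesis .
    qed
    then show ?thesis by simp
  qed
  also have "\<dots> = (\<Sum>i\<le>m. of_nat (m choose i) * (- (a * b)) ^ i / fact i * sphere_moment \<eta> i)"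
  proof -
    have "set_integrable lborel (cball 0 1) (\<lambda>w. c * (herm (sgn w) \<eta> ^ i * cnj (herm (sgn w) \<eta>) ^ i))" for i c
    proof -
      have ct: "continuous_on UNIV (\<lambda>w. c * (herm w \<eta> ^ i * cnj (herm w \<eta>) ^ i))"
        by (intro continuous_intros)
      show ?thesis
        by (rule set_integrable_sphere[OF ct])
    qed
    then show ?thesis
      unfolding sphere_moment_def set_integral_mult_right[symmetric]
      unfolding set_lebesgue_integral_def scaleR_sum_right set_integrable_def
      by (rule Bochner_Integration.integral_sum)
  qed
  finally show ?thesis by (simp add: f_def)
qed

lemma sphere_moment_nonzero:
  assumes "norm \<eta> = 1"
  shows "sphere_moment \<eta> i \<noteq> 0"
proof
  assume 0: "sphere_moment \<eta> i = 0"
  define g where "g w = (cmod (herm w \<eta>))\<^sup>2 ^ i" for w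
  have g: "continuous_on UNIV g"
    unfolding g_def by (intro continuous_intros)
  have gm: "(\<lambda>w. g (sgn w)) \<in> borel_measurable borel"
    using measurable_compose[OF borel_measurable_sgn_vec borel_measurable_continuous_onI[OF g]] .
  have eq: "herm w \<eta> ^ i * cnj (herm w \<eta>) ^ i = of_real (g w)" for w
    by (simp add: g_def of_real_cmod_square power_mult_distrib)
  have "sphere_moment \<eta> i = of_real (LINT w|lborel. indicator (cball 0 1) w *\<^sub>R g (sgn w))"
    unfolding sphere_moment_def eq set_lebesgue_integral_def integral_complex_of_real[symmetric]
    by (simp add: scaleR_conv_of_real)
  then have int0: "(LINT w|lborel. indicator (cball 0 1) w *\<^sub>R g (sgn w)) = 0"
    using 0 by simp
  have intg: "integrable lborel (\<lambda>w. indicator (cball 0 1) w *\<^sub>R g (sgn w))"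
  proof -
    have "set_integrable lborel (cball 0 1) (\<lambda>w. complex_of_real (g (sgn w)))"
      by (intro set_integrable_sphere continuous_intros continuous_on_compose2[OF g]) auto
    then have "integrable lborel (\<lambda>w. complex_of_real (indicator (cball 0 1) w *\<^sub>R g (sgn w)))"
      by (simp add: set_integrable_def scaleR_conv_of_real)
    then show ?thesis by (simp only: complex_of_real_integrable_eq)
  qed
  have "AE w in lborel. indicator (cball 0 1) w *\<^sub>R g (sgn w) = 0"
    using int0 by (subst integral_nonneg_eq_0_iff_AE[OF intg, symmetric]) (auto simp: g_def)
  moreover define U where "U = ball 0 1 \<inter> {w. herm w \<eta> \<noteq> 0}"
  ultimately have ae: "AE w in lborel. w \<notin> U"
    by (auto elim!: eventually_mono simp: U_def g_def sgn_div_norm herm_simps)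
  have "open U"
    unfolding U_def by (intro open_Int open_ball open_Collect_neq continuous_intros)
  from open_AE_notin_empty[OF this ae] have "(1/2) *\<^sub>R \<eta> \<notin> U" by blast
  then show False
    using assms by (simp add: U_def herm_simps herm_self)
qed

section \<open>Nonvanishing of the scalar factors\<close>

text \<open>Factoring out (-p)^p / (m + p)! leaves an integer N, which is odd: for i < m - 1 the
  quotient (m + p)! / (p + i)! contains two consecutive factors, for i = m - 1 the term contains m
  (m + p), even since p is odd, and for i = m it is (-p)^m. Up to a nonzero factor the sum is the
  generalized Laguerre polynomial L_m^(p) at p, which does vanish for m = p = 2.\<close>

lemma odd_binomial_exp_sum_nonzero:
  assumes "odd p"
  shows "(\<Sum>i\<le>m. of_nat (m choose i) * ((- of_nat p) ^ (p + i) / fact (p + i))) \<noteq> (0::complex)"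
proof
  assume 0: "(\<Sum>i\<le>m. of_nat (m choose i) * ((- of_nat p) ^ (p + i) / fact (p + i))) = (0::complex)"
  have p: "p > 0" using assms by (rule odd_pos)
  define q where "q i = (fact (m + p) div fact (p + i) :: int)" for i
  have q: "complex_of_int (q i) = fact (m + p) / fact (p + i)" if "i \<le> m" for i
  proof -
    have "(fact (p + i) :: int) dvd fact (m + p)"
      using that by (intro fact_dvd) simp
    then have "q i * fact (p + i) = fact (m + p)"
      by (simp add: q_def)
    then have "of_int (q i) * fact (p + i) = (fact (m + p) :: complex)"
      by (metis of_int_fact of_int_mult)
    then show ?thesis by (simp add: field_simps)
  qed
  define N where "N = (\<Sum>i\<le>m. int (m choose i) * (- int p) ^ i * q i)"
  have "complex_of_int N = (\<Sum>i\<le>m. of_nat (m choose i) * (- of_nat p) ^ i * (fact (m + p) / fact (p + i)))"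
    unfolding N_def of_int_sum by (intro sum.cong refl) (simp add: q)
  also have "\<dots> * (- of_nat p) ^ p = fact (m + p) * (\<Sum>i\<le>m. of_nat (m choose i) * ((- of_nat p) ^ (p + i) / fact (p + i)))"
    unfolding sum_distrib_left sum_distrib_right by (intro sum.cong refl) (simp add: power_add mult_ac)
  finally have "complex_of_int N * (- of_nat p) ^ p = 0"
    using 0 by simp
  then have "N = 0" using p by simp
  moreover have "odd N"
  proof (cases m)
    case 0
    then show ?thesis by (simp add: N_def q_def)
  next
    case (Suc l)
    have "even (\<Sum>i<l. int (m choose i) * (- int p) ^ i * q i)"
    proof (rule dvd_sum)
      fix i assume "i \<in> {..<l}"
      then have i: "i < l" by simp
      \<comment> \<open>The truncated difference p + l - 1 is m + p - 2, since p > 0 and m = l + 1;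
        the two top factors of (m + p)! are kept apart.\<close>
      have "(fact (p + i) :: int) dvd fact (p + l - 1)"
        using i by (intro fact_dvd) simp
      then obtain r where r: "fact (p + l - 1) = fact (p + i) * (r::int)" by (elim dvdE)
      have "m + p = Suc (Suc (p + l - 1))" using Suc p by simp
      then have "(fact (m + p) :: int) = of_nat (Suc (Suc (p + l - 1))) * (of_nat (Suc (p + l - 1)) * fact (p + l - 1))"
        by (simp only: fact_Suc)
      then have "(fact (m + p) :: int) = fact (p + i) * ((of_nat (Suc (Suc (p + l - 1))) * of_nat (Suc (p + l - 1))) * r)"
        by (simp only: r mult_ac)
      then have "q i = (of_nat (Suc (Suc (p + l - 1))) * of_nat (Suc (p + l - 1))) * r"
        by (simp add: q_def)
      moreover have "even (int (Suc (Suc (p + l - 1))) * int (Suc (p + l - 1)))"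
        by auto
      ultimately show "even (int (m choose i) * (- int p) ^ i * q i)"
        by simp
    qed
    moreover have "even (int (m choose l) * (- int p) ^ l * q l)"
    proof -
      have "q l = int (m + p)"
        by (simp add: q_def Suc add.commute[of p])
      moreover have "int (m choose l) = int m"
        using Suc by simp
      moreover have "even (int m * int (m + p))"
        using assms by auto
      ultimately show ?thesis by auto
    qed
    moreover have "odd (int (m choose m) * (- int p) ^ m * q m)"
      using assms by (simp add: q_def add.commute[of p])
    moreover have "N = (\<Sum>i<l. int (m choose i) * (- int p) ^ i * q i) + int (m choose l) * (- int p) ^ l * q l
        + int (m choose m) * (- int p) ^ m * q m"
      unfolding N_def using Suc by (simp add: lessThan_Suc_atMost[symmetric])
    ultimately show ?thesis by simp
  qed
  ultimately show False by simp
qed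

section \<open>Power series and the scalars of the transverse case\<close>

lemma power_series_zero_on_interval:
  fixes a :: "nat \<Rightarrow> real"
  assumes "\<And>y. \<bar>y\<bar> < 1 \<Longrightarrow> (\<lambda>n. a n * y ^ n) sums 0"
  shows "a n = 0"
proof (cases "n = 0")
  case True
  have "(\<lambda>n. a n * 0 ^ n) sums a 0"
    using powser_sums_zero[of a] by simp
  then show ?thesis
    using assms[of 0] sums_unique2 True by force
next
  case False
  show ?thesis
  proof (rule ccontr)
    assume "a n \<noteq> 0"
    then obtain s where s: "0 < s" "\<And>z. z \<in> cball 0 s - {0} \<Longrightarrow> (\<lambda>_::real. 0::real) z \<noteq> 0"
      using powser_0_nonzero[of 1 0 a "\<lambda>_. 0" n] assms False by auto
    from s(2)[of s] s(1) show False by simp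
  qed
qed

text \<open>The coefficients of \<open>exp (c s)\<close> times a polynomial of degree \<open>d\<close> are \<open>c ^ n / n!\<close> times a
  polynomial in \<open>n\<close> of degree \<open>d\<close>.\<close>

lemma exp_poly_coefficient_nonzero:
  fixes p :: "complex poly"
  assumes c: "c \<noteq> 0" and p: "p \<noteq> 0" and A: "infinite A"
  shows "\<exists>n\<in>A. (\<Sum>i\<le>n. coeff p i * (c ^ (n - i) / fact (n - i))) \<noteq> 0"
proof (rule ccontr)
  assume "\<not> ?thesis"
  then have 0: "(\<Sum>i\<le>n. coeff p i * (c ^ (n - i) / fact (n - i))) = 0" if "n \<in> A" for n
    using that by blast
  define d where "d = degree p"
  \<comment> \<open>Falling factorials: the value of \<open>Q i\<close> at n is n! / (n -
    i)!.\<close>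
  define Q where "Q i = (\<Prod>l<i. [:- of_nat l, 1:] :: complex poly)" for i
  have Q: "degree (Q i) = i \<and> lead_coeff (Q i) = 1" for i
    unfolding Q_def
  proof (induction i)
    case (Suc i)
    then have "(\<Prod>l<i. [:- of_nat l, 1:] :: complex poly) \<noteq> 0"
      by (metis leading_coeff_0_iff zero_neq_one)
    then have "degree ((\<Prod>l<i. [:- of_nat l, 1:]) * [:- of_nat i, 1:] :: complex poly) = Suc i"
      using Suc by (subst degree_mult_eq) auto
    moreover have "lead_coeff ((\<Prod>l<i. [:- of_nat l, 1:]) * [:- of_nat i, 1:] :: complex poly) = 1"
      using conjunct2[OF Suc] by (simp only: lead_coeff_mult) simp
    ultimately show ?case
      by (simp only: prod.lessThan_Suc)
  qed simp
  have polyQ: "poly (Q i) (of_nat n) = fact n / fact (n - i)" if "i \<le> n" for i n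
    using that
  proof (induction i)
    case (Suc i)
    then have 1: "(fact (n - i) :: complex) = of_nat (n - i) * fact (n - Suc i)"
      by (metis Suc_diff_Suc Suc_le_lessD fact_Suc)
    have 2: "poly (Q (Suc i)) (of_nat n) = poly (Q i) (of_nat n) * (of_nat n - of_nat i)"
      by (simp add: Q_def poly_prod) (simp add: algebra_simps)
    have 3: "of_nat n - of_nat i = (of_nat (n - i) :: complex)"
      using Suc by (simp add: of_nat_diff)
    have 4: "poly (Q i) (of_nat n) = fact n / fact (n - i)"
      using Suc by simp
    have 5: "x / (a * y) * a = x / y" if "a \<noteq> 0" for a x y :: complex
      using that by simp
    have 6: "(of_nat (n - i) :: complex) \<noteq> 0"
      using Suc by simp
    show ?case
      unfolding 2 3 4 1 by (rule 5[OF 6])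
  qed (simp add: Q_def)
  \<comment> \<open>What remains of the n-th coefficient, as a polynomial in n, after c^n / n! is
    factored out. Only i = d contributes to degree d, hence q is not zero.\<close>
  define q where "q = (\<Sum>i\<le>d. smult (coeff p i / c ^ i) (Q i))"
  have "coeff q d = (\<Sum>i\<le>d. coeff p i / c ^ i * coeff (Q i) d)"
    by (simp add: q_def coeff_sum)
  also have "\<dots> = (\<Sum>i\<in>{d}. coeff p i / c ^ i * coeff (Q i) d)"
    by (rule sum.mono_neutral_right) (use Q in \<open>auto simp: coeff_eq_0\<close>)
  also have "\<dots> = coeff p d / c ^ d"
    using conjunct2[OF Q[of d]] unfolding conjunct1[OF Q[of d]] by simp
  finally have "q \<noteq> 0"
    using c p by (auto simp: d_def)
  have root: "poly q (of_nat n) = 0" if n: "n \<in> A" "d \<le> n" for n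
  proof -
    have "(\<Sum>i\<le>n. coeff p i * (c ^ (n - i) / fact (n - i))) = (\<Sum>i\<le>d. coeff p i * (c ^ (n - i) / fact (n - i)))"
      by (rule sum.mono_neutral_right) (use n in \<open>auto simp: d_def coeff_eq_0\<close>)
    also have "\<dots> = (\<Sum>i\<le>d. c ^ n / fact n * (coeff p i / c ^ i * poly (Q i) (of_nat n)))"
      by (intro sum.cong refl) (use n c in \<open>simp add: polyQ power_diff\<close>)
    also have "\<dots> = c ^ n / fact n * poly q (of_nat n)"
      by (simp add: q_def poly_sum sum_distrib_left)
    finally show ?thesis
      using 0[OF n(1)] c by simp
  qed
  have "of_nat ` (A - {..<d}) \<subseteq> {x. poly q x = 0}"
    using root by auto
  moreover have "infinite (A - {..<d})"
    using A by simp
  then have "infinite (of_nat ` (A - {..<d}) :: complex set)"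
    using finite_imageD inj_of_nat inj_on_subset by blast
  ultimately show False
    using poly_roots_finite[OF \<open>q \<noteq> 0\<close>] finite_subset by blast
qed

text \<open>For a unit vector w this will be \<open>herm w (W t w)\<close>; the minus sign is the
  conjugate linearity of \<open>herm\<close> in its second argument.\<close>

definition ellipse :: "real \<Rightarrow> real \<Rightarrow> complex" where
  "ellipse \<kappa> t = of_real (cos (2 * pi * t)) - \<i> * of_real (\<kappa> * sin (2 * pi * t))"

lemma continuous_on_cos_sin [continuous_intros]:
  fixes f :: "'a::topological_space \<Rightarrow> real"
  assumes "continuous_on A f"
  shows "continuous_on A (\<lambda>x. cos (f x))" "continuous_on A (\<lambda>x. sin (f x))"
proof -
  have cs: "continuous_on UNIV (cos :: real \<Rightarrow> real)" "continuous_on UNIV (sin :: real \<Rightarrow> real)"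
    by (auto intro: continuous_at_imp_continuous_on)
  show "continuous_on A (\<lambda>x. cos (f x))" "continuous_on A (\<lambda>x. sin (f x))"
    using assms by (auto intro: continuous_on_compose2[OF cs(1)] continuous_on_compose2[OF cs(2)])
qed

lemma continuous_on_ellipse [continuous_intros]:
  "continuous_on A f \<Longrightarrow> continuous_on A (\<lambda>x. ellipse \<kappa> (f x))"
  unfolding ellipse_def by (intro continuous_intros)

lemma ellipse_cis:
  "ellipse \<kappa> t = of_real ((1 + \<kappa>) / 2) * cis (- (2 * pi * t)) + of_real ((1 - \<kappa>) / 2) * cis (2 * pi * t)"
  by (simp add: ellipse_def complex_eq_iff field_simps)

lemma norm_ellipse_le:
  assumes "\<bar>\<kappa>\<bar> < 1"
  shows "cmod (ellipse \<kappa> t) \<le> 1"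
proof -
  have "cmod (ellipse \<kappa> t) \<le> \<bar>(1 + \<kappa>) / 2\<bar> + \<bar>(1 - \<kappa>) / 2\<bar>"
    unfolding ellipse_cis by (rule norm_triangle_le) (simp only: norm_mult norm_of_real norm_cis mult_1_right order_refl)
  also have "\<dots> = 1" using assms by (simp add: abs_less_iff field_simps)
  finally show ?thesis .
qed

text \<open>The n-th power of the ellipse has frequencies from -n to n with the parity of n. As n
  has the parity of k and n \<ge> |k|, exactly one term has frequency -k, and its coefficient is
  positive because both weights (1 + \<kappa>) / 2 and (1 - \<kappa>) / 2 are.\<close>

lemma circle_mean_ellipse_power_nonzero:
  assumes \<kappa>: "\<bar>\<kappa>\<bar> < 1"
  shows "circle_mean (\<lambda>t. cis (2 * pi * of_int k * t) * ellipse \<kappa> t ^ (nat \<bar>k\<bar> + 2 * r)) \<noteq> 0"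
proof -
  define n where "n = nat \<bar>k\<bar> + 2 * r"
  define a where "a = (1 + \<kappa>) / 2"
  define b where "b = (1 - \<kappa>) / 2"
  define j0 where "j0 = nat k + r"
  have ab: "a > 0" "b > 0" using \<kappa> by (auto simp: a_def b_def)
  have j0: "int n + k = 2 * int j0" "j0 \<le> n" by (auto simp: n_def j0_def)
  have "circle_mean (\<lambda>t. cis (2 * pi * of_int k * t) * ellipse \<kappa> t ^ n)
      = circle_mean (\<lambda>t. \<Sum>j\<le>n. of_real (real (n choose j) * a ^ j * b ^ (n - j)) * cis (2 * pi * of_int (k + int n - 2 * int j) * t))"
  proof (rule arg_cong[where f = circle_mean], rule ext)
    fix t
    have cp: "cis (2 * pi * of_int k * t) * (cis (- (2 * pi * t)) ^ j * cis (2 * pi * t) ^ (n - j))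
        = cis (2 * pi * of_int (k + int n - 2 * int j) * t)" if "j \<le> n" for j
      using that by (simp only: Complex.DeMoivre cis_mult) (simp add: of_nat_diff algebra_simps)
    show "cis (2 * pi * of_int k * t) * ellipse \<kappa> t ^ n
      = (\<Sum>j\<le>n. of_real (real (n choose j) * a ^ j * b ^ (n - j)) * cis (2 * pi * of_int (k + int n - 2 * int j) * t))"
      unfolding ellipse_cis binomial_ring sum_distrib_left
    proof (intro sum.cong refl)
      fix j assume "j \<in> {..n}"
      then show "cis (2 * pi * of_int k * t) * (of_nat (n choose j) * (of_real ((1 + \<kappa>) / 2) * cis (- (2 * pi * t))) ^ j
          * (of_real ((1 - \<kappa>) / 2) * cis (2 * pi * t)) ^ (n - j))
        = of_real (real (n choose j) * a ^ j * b ^ (n - j)) * cis (2 * pi * of_int (k + int n - 2 * int j) * t)"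
        by (subst cp[symmetric])
           (simp_all only: atMost_iff power_mult_distrib a_def b_def of_real_mult of_real_power of_real_of_nat_eq mult_ac)
    qed
  qed
  also have "\<dots> = (\<Sum>j\<le>n. circle_mean (\<lambda>t. of_real (real (n choose j) * a ^ j * b ^ (n - j)) * cis (2 * pi * of_int (k + int n - 2 * int j) * t)))"
    unfolding set_lebesgue_integral_def scaleR_sum_right
    by (rule Bochner_Integration.integral_sum)
       (intro set_integrable_continuous_01[unfolded set_integrable_def] continuous_intros | simp)+
  also have "\<dots> = (\<Sum>j\<le>n. of_real (real (n choose j) * a ^ j * b ^ (n - j)) * (if k + int n - 2 * int j = 0 then 1 else 0))"
    by (simp only: set_integral_mult_right circle_mean_cis_int)
  also have "\<dots> = (\<Sum>j\<in>{j0}. of_real (real (n choose j) * a ^ j * b ^ (n - j)))"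
    by (rule sum.mono_neutral_cong_right) (use j0 in auto)
  also have "\<dots> \<noteq> 0"
    using ab j0 by simp
  finally show ?thesis by (simp add: n_def)
qed

text \<open>As a power series in y the mean has the coefficients \<open>h n * I n\<close>, where
  \<open>h\<close> comes from exp (K s) p(s) and \<open>I n\<close> is the twisted mean of the n-th
  power of the ellipse. If all products vanish, \<open>h\<close> vanishes at every n = |k| + 2 r,
  where \<open>I\<close> does not; for a nonzero polynomial p that cannot happen on an infinite
  set.\<close>

lemma ellipse_exp_poly_zero_imp:
  fixes p :: "complex poly"
  assumes \<kappa>: "\<bar>\<kappa>\<bar> < 1" and K: "K \<noteq> 0"
    and zero: "\<And>y. \<bar>y\<bar> < 1 \<Longrightarrow>
      circle_mean (\<lambda>t. cis (2 * pi * of_int k * t) * (exp (K * (of_real y * ellipse \<kappa> t)) * poly p (of_real y * ellipse \<kappa> t))) = 0"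
  shows "p = 0"
proof (rule ccontr)
  assume p: "p \<noteq> 0"
  define h where "h n = (\<Sum>i\<le>n. coeff p i * (K ^ (n - i) / fact (n - i)))" for n
  define I where "I n = circle_mean (\<lambda>t. cis (2 * pi * of_int k * t) * ellipse \<kappa> t ^ n)" for n
  have hs: "(\<lambda>n. h n * s ^ n) sums (exp (K * s) * poly p s)" for s
  proof -
    have fin: "coeff p i * s ^ i = 0" if "i \<notin> {..degree p}" for i
      using that by (simp add: coeff_eq_0)
    have e: "(\<lambda>n. (K * s) ^ n / fact n) sums exp (K * s)"
      using exp_converges[of "K * s"] by (simp add: scaleR_conv_of_real field_simps)
    have "(\<lambda>k. \<Sum>i\<le>k. (coeff p i * s ^ i) * ((K * s) ^ (k - i) / fact (k - i))) sums
        ((\<Sum>i. coeff p i * s ^ i) * (\<Sum>n. (K * s) ^ n / fact n))"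
    proof (rule Cauchy_product_sums)
      show "summable (\<lambda>i. norm (coeff p i * s ^ i))"
        by (rule summable_finite[of "{..degree p}"]) (use fin in auto)
      show "summable (\<lambda>n. norm ((K * s) ^ n / fact n))"
        using summable_norm_exp[of "K * s"] by (simp add: norm_divide norm_mult norm_power scaleR_conv_of_real field_simps)
    qed
    moreover have "(\<Sum>i. coeff p i * s ^ i) = poly p s"
      by (subst suminf_finite[of "{..degree p}"]) (use fin in \<open>auto simp: poly_altdef\<close>)
    moreover have "(\<Sum>i\<le>n. (coeff p i * s ^ i) * ((K * s) ^ (n - i) / fact (n - i))) = h n * s ^ n" for n
      unfolding h_def sum_distrib_right
      by (intro sum.cong refl) (simp add: power_mult_distrib power_add[symmetric] mult_ac)
    ultimately show ?thesis
      using sums_unique[OF e] by (simp add: mult.commute)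
  qed
  have "(\<lambda>n. h n * I n * of_real y ^ n) sums 0" if y: "\<bar>y\<bar> < 1" for y
  proof -
    define f where "f n t = indicator {0..1} t *\<^sub>R (cis (2 * pi * of_int k * t) * (h n * (of_real y * ellipse \<kappa> t) ^ n))" for n t
    have cf: "integrable lborel (f n)" for n
      unfolding f_def
      by (intro set_integrable_continuous_01[unfolded set_integrable_def] continuous_intros)
    \<comment> \<open>The series of \<open>h\<close> converges at 1, hence absolutely at |y| < 1.
      With the modulus of the ellipse at most 1 this dominates the termwise integration.\<close>
    have summ: "summable (\<lambda>n. norm (h n * of_real y ^ n))"
      by (rule powser_insidea[OF sums_summable[OF hs[of 1]]]) (use y in simp)
    have bd: "norm (f n t) \<le> indicator {0..1} t * norm (h n * of_real y ^ n)" for n t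
    proof -
      have "cmod (ellipse \<kappa> t) ^ n \<le> 1"
        using norm_ellipse_le[OF \<kappa>] by (simp add: power_le_one)
      then have "cmod (h n) * (\<bar>y\<bar> ^ n * cmod (ellipse \<kappa> t) ^ n) \<le> cmod (h n) * (\<bar>y\<bar> ^ n * 1)"
        by (intro mult_left_mono) auto
      then show ?thesis
        by (simp add: f_def norm_mult norm_power power_mult_distrib indicator_def)
    qed
    have "(\<lambda>n. integral\<^sup>L lborel (f n)) sums (\<integral>t. (\<Sum>n. f n t) \<partial>lborel)"
    proof (rule sums_integral[OF cf])
      show "AE t in lborel. summable (\<lambda>n. norm (f n t))"
      proof (rule AE_I2)
        fix t
        show "summable (\<lambda>n. norm (f n t))"
          by (rule summable_comparison_test[OF _ summable_mult[OF summ, of "indicator {0..1} t"]]) (use bd in auto)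
      qed
      show "summable (\<lambda>n. \<integral>t. norm (f n t) \<partial>lborel)"
      proof (rule summable_comparison_test[OF _ summ])
        have "(\<integral>t. norm (f n t) \<partial>lborel) \<le> (\<integral>t. indicator {0..1::real} t * norm (h n * of_real y ^ n) \<partial>lborel)" for n
        proof (rule integral_mono_AE)
          show "integrable lborel (\<lambda>t. norm (f n t))"
            using cf by (rule integrable_norm)
          show "integrable lborel (\<lambda>t. indicator {0..1::real} t * norm (h n * of_real y ^ n))"
            by (intro integrable_mult_left) simp
        qed (simp add: bd)
        then show "\<exists>N. \<forall>n\<ge>N. norm (\<integral>t. norm (f n t) \<partial>lborel) \<le> norm (h n * of_real y ^ n)"
          by simp
      qed
    qed
    moreover have "integral\<^sup>L lborel (f n) = h n * I n * of_real y ^ n" for n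
    proof -
      have "integral\<^sup>L lborel (f n) = circle_mean (\<lambda>t. (h n * of_real y ^ n) * (cis (2 * pi * of_int k * t) * ellipse \<kappa> t ^ n))"
        unfolding f_def set_lebesgue_integral_def by (simp add: power_mult_distrib mult_ac)
      then show ?thesis
        by (simp only: set_integral_mult_right I_def) simp
    qed
    moreover have "(\<integral>t. (\<Sum>n. f n t) \<partial>lborel) = 0"
    proof -
      have "(\<Sum>n. f n t) = indicator {0..1} t *\<^sub>R
          (cis (2 * pi * of_int k * t) * (exp (K * (of_real y * ellipse \<kappa> t)) * poly p (of_real y * ellipse \<kappa> t)))" for t
        unfolding f_def
        by (rule sums_unique[symmetric, OF sums_scaleR_right[OF sums_mult[OF hs]]])
      then show ?thesis
        using zero[OF y] by (simp add: set_lebesgue_integral_def)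
    qed
    ultimately show ?thesis by simp
  qed
  note S = this
  have "h n * I n = 0" for n
  proof -
    have "(\<lambda>n. Re (h n * I n) * y ^ n) sums 0" "(\<lambda>n. Im (h n * I n) * y ^ n) sums 0" if "\<bar>y\<bar> < 1" for y
    proof -
      have eq: "h n * I n * of_real y ^ n = (y ^ n) *\<^sub>R (h n * I n)" for n
        by (simp only: scaleR_conv_of_real of_real_power mult.commute)
      show "(\<lambda>n. Re (h n * I n) * y ^ n) sums 0"
        using sums_Re[OF S[OF that]] unfolding eq scaleR_complex.sel zero_complex.sel by (simp only: mult.commute)
      show "(\<lambda>n. Im (h n * I n) * y ^ n) sums 0"
        using sums_Im[OF S[OF that]] unfolding eq scaleR_complex.sel zero_complex.sel by (simp only: mult.commute)
    qed
    then show ?thesis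
      using power_series_zero_on_interval[of "\<lambda>n. Re (h n * I n)" n]
        power_series_zero_on_interval[of "\<lambda>n. Im (h n * I n)" n]
      by (simp only: complex_eq_iff zero_complex.sel)
  qed
  moreover have "infinite (range (\<lambda>r. nat \<bar>k\<bar> + 2 * r))"
    by (rule range_inj_infinite) (simp add: inj_on_def)
  from exp_poly_coefficient_nonzero[OF K p this]
  obtain r where "h (nat \<bar>k\<bar> + 2 * r) \<noteq> 0"
    unfolding h_def by blast
  moreover have "I (nat \<bar>k\<bar> + 2 * r) \<noteq> 0"
    unfolding I_def by (rule circle_mean_ellipse_power_nonzero[OF \<kappa>])
  ultimately show False
    by (metis mult_eq_0_iff)
qed

section \<open>Functions annihilated by twisted circle averages\<close>

text \<open>The exception at 0 is the point where \<open>sgn\<close> does not yield a unit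
  vector.\<close>

lemma set_integral_AE_zero:
  fixes f :: "'a::euclidean_space \<Rightarrow> complex"
  assumes "\<And>x. x \<noteq> 0 \<Longrightarrow> f x = 0"
  shows "(LINT x:A|lborel. f x) = 0"
proof -
  have "AE x in lborel. indicator A x *\<^sub>R f x = 0"
    using AE_lborel_singleton[of "0::'a"] by eventually_elim (simp add: assms)
  then show ?thesis
    unfolding set_lebesgue_integral_def by (rule integral_eq_zero_AE)
qed

lemma exists_orthogonal_unit:
  fixes z :: "complex^'n"
  assumes "CARD('n) > 1"
  obtains w where "norm w = 1" "herm z w = 0"
proof -
  obtain i j :: 'n where ij: "i \<noteq> j"
    using assms by (metis UNIV_I card_le_Suc0_iff_eq finite not_less One_nat_def)
  \<comment> \<open>In two coordinates the vector (cnj z_j, - cnj z_i) is orthogonal to z. It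
    degenerates when z_i and z_j both vanish, and then a coordinate vector serves.\<close>
  define w :: "complex^'n" where
    "w = (if z $ i = 0 \<and> z $ j = 0 then axis i 1 else (\<chi> l. if l = i then cnj (z $ j) else if l = j then - cnj (z $ i) else 0))"
  have "herm z w = 0"
  proof (cases "z $ i = 0 \<and> z $ j = 0")
    case True
    then show ?thesis by (auto simp: herm_def w_def axis_def intro!: sum.neutral)
  next
    case False
    then have "herm z w = (\<Sum>l\<in>UNIV. if l = i then z $ i * z $ j else if l = j then - (z $ j * z $ i) else 0)"
      by (auto simp: herm_def w_def intro!: sum.cong)
    also have "\<dots> = (\<Sum>l\<in>{i, j}. if l = i then z $ i * z $ j else if l = j then - (z $ j * z $ i) else 0)"
      by (rule sum.mono_neutral_right) auto
    also have "\<dots> = 0" using ij by simp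
    finally show ?thesis .
  qed
  moreover have "w \<noteq> 0"
    using ij by (auto simp: w_def vec_eq_iff axis_def)
  ultimately show ?thesis
    by (intro that[of "sgn w"]) (simp_all add: norm_sgn sgn_div_norm herm_simps)
qed

text \<open>Only these data of the Lie algebra enter the vanishing argument: i \<kappa> + S' is
  J_\<lambda> / |\<lambda>| in the complex coordinates of J_\<mu>, split into complex linear and
  antilinear part. As \<open>slice\<close> holds for all z and all unit w, the base point may be
  chosen to depend on w.\<close>

locale circle_slices =
  fixes \<psi> :: "complex^'n \<Rightarrow> complex" and S' :: "complex^'n \<Rightarrow> complex^'n"
    and K \<kappa> :: real and k :: int
  assumes cont: "continuous_on UNIV \<psi>" and hol: "line_holomorphic \<psi>"
    and K_pos: "K > 0" and Kk: "K * \<kappa> = of_int k"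
    and S'_add: "S' (x + y) = S' x + S' y" and S'_smult: "S' (c *s x) = cnj c *s S' x"
    and S'_orth: "herm x (S' x) = 0"
    and S'_square: "S' (S' x) = - (of_real (1 - \<kappa>\<^sup>2) *s x)"
    and slice: "norm w = 1 \<Longrightarrow>
      circle_mean (\<lambda>t. cis (2 * pi * of_int k * t) *
        (exp (- (of_real (sqrt K) * herm z (cos (2 * pi * t) *\<^sub>R w + sin (2 * pi * t) *\<^sub>R ((\<i> * of_real \<kappa>) *s w + S' w)))) *
         \<psi> (z + sqrt K *\<^sub>R (cos (2 * pi * t) *\<^sub>R w + sin (2 * pi * t) *\<^sub>R ((\<i> * of_real \<kappa>) *s w + S' w))))) = 0"
begin

definition S :: "complex^'n \<Rightarrow> complex^'n" where "S w = (\<i> * of_real \<kappa>) *s w + S' w"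

text \<open>Since S squares to -1, this is exp (2 pi t S), a one-parameter group of rotations of
  real 2n-space.\<close>

definition W :: "real \<Rightarrow> complex^'n \<Rightarrow> complex^'n" where
  "W t w = cos (2 * pi * t) *\<^sub>R w + sin (2 * pi * t) *\<^sub>R S w"

lemma S'_norm: "(norm (S' x))\<^sup>2 = (1 - \<kappa>\<^sup>2) * (norm x)\<^sup>2"
proof -
  \<comment> \<open>Polarization: \<open>S'_orth\<close> is used at x + S' x.\<close>
  have "herm (x + S' x) (S' (x + S' x)) = herm x (S' x) + herm x (S' (S' x)) + herm (S' x) (S' x) + herm (S' x) (S' (S' x))"
    by (simp add: S'_add herm_simps)
  then have "herm (S' x) (S' x) = - herm x (S' (S' x))"
    by (simp only: S'_orth) (simp add: eq_neg_iff_add_eq_0 add.commute)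
  also have "\<dots> = of_real (1 - \<kappa>\<^sup>2) * herm x x"
    by (simp only: S'_square herm_minus_right herm_smult_right complex_cnj_complex_of_real minus_minus)
  finally have "complex_of_real ((norm (S' x))\<^sup>2) = of_real ((1 - \<kappa>\<^sup>2) * (norm x)\<^sup>2)"
    by (simp only: herm_self of_real_mult)
  then show ?thesis by (simp only: of_real_eq_iff)
qed

lemma abs_kappa_le: "\<bar>\<kappa>\<bar> \<le> 1"
proof -
  define x :: "complex^'n" where "x = axis undefined 1"
  have "norm x = 1" by (simp add: x_def)
  then have "0 \<le> 1 - \<kappa>\<^sup>2"
    using S'_norm[of x] by (metis mult.right_neutral one_power2 zero_le_power2)
  then show ?thesis by (simp add: abs_le_square_iff[of \<kappa> 1, simplified])
qed

lemma S'_scaleR: "S' (r *\<^sub>R x) = r *\<^sub>R S' x"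
  by (simp only: scaleR_eq_smult S'_smult complex_cnj_complex_of_real)

lemma S_linear: "linear S"
  by (rule linearI) (simp_all add: S_def S'_add S'_scaleR smult_add_right, simp add: vec_eq_iff algebra_simps)

lemma S_square: "S (S x) = - x"
proof -
  have "S (S x) = (\<i> * of_real \<kappa>) *s ((\<i> * of_real \<kappa>) *s x) + (\<i> * of_real \<kappa>) *s S' x
      + (cnj (\<i> * of_real \<kappa>) *s S' x + - (of_real (1 - \<kappa>\<^sup>2) *s x))"
    by (simp only: S_def S'_add S'_smult S'_square smult_add_right)
  also have "\<dots> = - x"
    by (simp add: vec_eq_iff algebra_simps power2_eq_square)
  finally show ?thesis .
qed

lemma inner_S: "x \<bullet> S x = 0"
  unfolding Re_herm[symmetric] S_def herm_add_right herm_smult_right S'_orth herm_self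
  by simp

lemma norm_S: "norm (S x) = norm x"
proof -
  have "(norm (S x))\<^sup>2 = (norm ((\<i> * of_real \<kappa>) *s x))\<^sup>2 + (norm (S' x))\<^sup>2"
    unfolding S_def by (rule norm_add_orthogonal) (simp add: herm_simps S'_orth)
  also have "\<dots> = (norm x)\<^sup>2"
    by (simp add: norm_smult S'_norm norm_mult power_mult_distrib algebra_simps)
  finally show ?thesis by (simp add: power2_eq_iff_nonneg)
qed

lemma continuous_on_S' [continuous_intros]: "continuous_on A f \<Longrightarrow> continuous_on A (\<lambda>x. S' (f x))"
proof -
  have "linear S'"
    by (rule linearI) (simp_all add: S'_add S'_scaleR)
  then have "continuous_on UNIV S'"
    by (simp add: linear_continuous_on linear_conv_bounded_linear)
  then show "continuous_on A f \<Longrightarrow> continuous_on A (\<lambda>x. S' (f x))"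
    by (rule continuous_on_compose2) auto
qed

lemma continuous_on_W [continuous_intros]:
  "continuous_on A f \<Longrightarrow> continuous_on A g \<Longrightarrow> continuous_on A (\<lambda>x. W (f x) (g x))"
  unfolding W_def S_def by (intro continuous_intros)

lemma slice': "norm w = 1 \<Longrightarrow>
    circle_mean (\<lambda>t. cis (2 * pi * of_int k * t) * (exp (- (of_real (sqrt K) * herm z (W t w))) * \<psi> (z + sqrt K *\<^sub>R W t w))) = 0"
  using slice[of w z] unfolding W_def S_def .

subsection \<open>The parallel case\<close>

text \<open>For |\<kappa>| = 1 the antilinear part has norm zero and W t is multiplication by cis (2
  pi \<kappa> t). For \<kappa> = -1 the time t is reversed, which also turns k = \<kappa> |k| into
  |k|.\<close>

lemma parallel_slice:
  assumes \<kappa>: "\<bar>\<kappa>\<bar> = 1" and w: "norm w = 1"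
  shows "circle_mean (\<lambda>t. cis (2 * pi * real (nat \<bar>k\<bar>) * t) *
    (exp (- (of_real (sqrt K) * cis (- (2 * pi * t)) * herm z w)) * \<psi> (z + (of_real (sqrt K) * cis (2 * pi * t)) *s w))) = 0"
proof -
  have "\<kappa>\<^sup>2 = 1" using \<kappa> by (simp add: abs_square_eq_1)
  then have S0: "S' x = 0" for x
    using S'_norm[of x] by simp
  have W: "W t w = cis (2 * pi * (\<kappa> * t)) *s w" for t
  proof -
    have "\<kappa> = 1 \<or> \<kappa> = -1" using \<kappa> by auto
    then have "cis (2 * pi * (\<kappa> * t)) = of_real (cos (2 * pi * t)) + of_real (sin (2 * pi * t)) * (\<i> * of_real \<kappa>)"
      by (auto simp: complex_eq_iff)
    then show ?thesis
      by (simp add: W_def S_def S0 vec_eq_iff) (simp add: scaleR_conv_of_real algebra_simps)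
  qed
  have kK: "of_int k = \<kappa> * real (nat \<bar>k\<bar>)"
  proof -
    have "\<kappa> = 1 \<or> \<kappa> = -1" using \<kappa> by auto
    then show ?thesis using Kk K_pos by auto
  qed
  define g where "g t = cis (2 * pi * real (nat \<bar>k\<bar>) * t) *
    (exp (- (of_real (sqrt K) * cis (- (2 * pi * t)) * herm z w)) * \<psi> (z + (of_real (sqrt K) * cis (2 * pi * t)) *s w))" for t
  have g: "circle_mean (\<lambda>t. g (\<kappa> * t)) = 0"
  proof -
    have "cis (2 * pi * of_int k * t) * (exp (- (of_real (sqrt K) * herm z (W t w))) * \<psi> (z + sqrt K *\<^sub>R W t w)) = g (\<kappa> * t)" for t
    proof -
      have 1: "2 * pi * of_int k * t = 2 * pi * real (nat \<bar>k\<bar>) * (\<kappa> * t)"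
        unfolding kK by (simp only: mult_ac)
      have 2: "herm z (W t w) = cis (- (2 * pi * (\<kappa> * t))) * herm z w"
        by (simp only: W herm_smult_right cis_cnj)
      have 3: "sqrt K *\<^sub>R W t w = (of_real (sqrt K) * cis (2 * pi * (\<kappa> * t))) *s w"
        by (simp only: W scaleR_eq_smult vector_smult_assoc)
      show ?thesis unfolding g_def 1 2 3 by (simp only: mult.assoc)
    qed
    then show ?thesis using slice'[OF w, of z] by simp
  qed
  show ?thesis
  proof (cases "\<kappa> = 1")
    case True
    then show ?thesis using g by (simp add: g_def)
  next
    case False
    then have \<kappa>1: "\<kappa> = -1" using \<kappa> by auto
    \<comment> \<open>By periodicity, reversing t may be done by the reflection of [0, 1].\<close>
    have shift: "g (1 - t) = g (- t)" for t
    proof -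
      have "cis (2 * pi * real (nat \<bar>k\<bar>) * (1 - t)) = cis (2 * pi * real (nat \<bar>k\<bar>)) * cis (2 * pi * real (nat \<bar>k\<bar>) * (- t))"
        by (simp add: cis_mult algebra_simps)
      moreover have "cis (2 * pi * real (nat \<bar>k\<bar>)) = 1"
        by (simp add: cis_multiple_2pi)
      moreover have "cis (2 * pi * (1 - t)) = cis (2 * pi * (- t))" "cis (- (2 * pi * (1 - t))) = cis (- (2 * pi * (- t)))"
        by (simp_all add: complex_eq_iff algebra_simps cos_diff sin_diff)
      ultimately show ?thesis unfolding g_def by simp
    qed
    have "circle_mean g = (LINT t|lborel. indicator {0..1} (1 + (- 1) * t) *\<^sub>R g (1 + (- 1) * t))"
      unfolding set_lebesgue_integral_def
      by (subst lborel_integral_real_affine[of "-1" _ 1]) simp_all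
    also have "\<dots> = circle_mean (\<lambda>t. g (1 - t))"
      unfolding set_lebesgue_integral_def
      by (intro Bochner_Integration.integral_cong) (auto simp: indicator_def)
    also have "\<dots> = 0" using g \<kappa>1 by (simp add: shift)
    finally show ?thesis by (simp add: g_def)
  qed
qed

text \<open>The base point z + d e^(i\<tau>) w and the direction e^(i\<tau>) w turn together. Their
  pairing therefore stays d, and \<tau> enters only as a phase on the coordinate d + \<surd>K cis (2
  pi t) in the complex line through z. Averaging over \<tau> extracts the m-th Taylor coefficient on
  that line; d is a free parameter.\<close>

lemma parallel_coefficient:
  assumes \<kappa>: "\<bar>\<kappa>\<bar> = 1" and w: "norm w = 1" and z: "herm z w = 0"
  shows "circle_mean (\<lambda>\<tau>. cis (- (2 * pi * real m * \<tau>)) * \<psi> (z + cis (2 * pi * \<tau>) *s w)) *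
    (\<Sum>i\<le>m. of_nat (m choose i) * of_real (sqrt K) ^ i * d ^ (m - i) *
      ((- (of_real (sqrt K) * d)) ^ (nat \<bar>k\<bar> + i) / fact (nat \<bar>k\<bar> + i))) = 0"
proof -
  let ?p = "nat \<bar>k\<bar>" and ?s = "complex_of_real (sqrt K)"
  define \<phi> where "\<phi> \<zeta> = \<psi> (z + \<zeta> *s w)" for \<zeta>
  have \<phi>: "\<phi> holomorphic_on UNIV"
    using hol unfolding \<phi>_def line_holomorphic_def by blast
  then have c\<phi>: "continuous_on UNIV \<phi>"
    by (rule holomorphic_on_imp_continuous_on)
  define H where "H p = cis (- (2 * pi * real m * fst p)) * (cis (2 * pi * real ?p * snd p) *
    (exp (- (?s * d) * cis (- (2 * pi * snd p))) * \<phi> (cis (2 * pi * fst p) * (d + ?s * cis (2 * pi * snd p)))))" for p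
  have cH: "continuous_on UNIV H"
    unfolding H_def by (intro continuous_intros continuous_on_compose2[OF c\<phi>]) auto
  have "circle_mean (\<lambda>t. H (\<tau>, t)) = 0" for \<tau>
  proof -
    have w': "norm (cis (2 * pi * \<tau>) *s w) = 1" by (simp add: norm_smult w)
    have hw: "herm (z + (d * cis (2 * pi * \<tau>)) *s w) (cis (2 * pi * \<tau>) *s w) = d"
      by (simp add: herm_simps z herm_self w cis_cnj cis_mult)
    have pt: "z + (d * cis (2 * pi * \<tau>)) *s w + (?s * cis (2 * pi * t)) *s (cis (2 * pi * \<tau>) *s w)
        = z + (cis (2 * pi * \<tau>) * (d + ?s * cis (2 * pi * t))) *s w" for t
      by (simp add: vec_eq_iff algebra_simps)
    have "circle_mean (\<lambda>t. cis (2 * pi * real ?p * t) *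
      (exp (- (?s * cis (- (2 * pi * t)) * d)) * \<psi> (z + (cis (2 * pi * \<tau>) * (d + ?s * cis (2 * pi * t))) *s w))) = 0"
      using parallel_slice[OF \<kappa> w', of "z + (d * cis (2 * pi * \<tau>)) *s w"]
      by (simp only: hw pt)
    then have "circle_mean (\<lambda>t. cis (2 * pi * real ?p * t) *
      (exp (- (?s * d) * cis (- (2 * pi * t))) * \<phi> (cis (2 * pi * \<tau>) * (d + ?s * cis (2 * pi * t))))) = 0"
      by (simp add: \<phi>_def mult_ac)
    then show ?thesis
      unfolding H_def fst_conv snd_conv set_integral_mult_right by simp
  qed
  then have "0 = circle_mean (\<lambda>\<tau>. circle_mean (\<lambda>t. H (\<tau>, t)))"
    by (simp add: circle_mean_const)
  also have "\<dots> = circle_mean (\<lambda>t. circle_mean (\<lambda>\<tau>. H (\<tau>, t)))"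
    by (rule circle_circle_swap[OF cH])
  also have "\<dots> = circle_mean (\<lambda>t. circle_mean (\<lambda>\<tau>. cis (- (2 * pi * real m * \<tau>)) * \<phi> (cis (2 * pi * \<tau>))) *
     (cis (2 * pi * real ?p * t) * (exp (- (?s * d) * cis (- (2 * pi * t))) * (d + ?s * cis (2 * pi * t)) ^ m)))"
  proof (rule arg_cong[where f = circle_mean], rule ext)
    fix t
    define e where "e = cis (2 * pi * real ?p * t)"
    define x where "x = exp (- (?s * d) * cis (- (2 * pi * t)))"
    define v where "v = d + ?s * cis (2 * pi * t)"
    have "circle_mean (\<lambda>\<tau>. H (\<tau>, t)) = circle_mean (\<lambda>\<tau>. (e * x) *
       (cis (- (2 * pi * real m * \<tau>)) * \<phi> (cis (2 * pi * \<tau>) * v)))"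
      unfolding H_def fst_conv snd_conv e_def x_def v_def by (simp only: mult_ac)
    also have "\<dots> = circle_mean (\<lambda>\<tau>. cis (- (2 * pi * real m * \<tau>)) * \<phi> (cis (2 * pi * \<tau>))) * (e * (x * v ^ m))"
      by (simp only: set_integral_mult_right circle_mean_coefficient_scaled[OF \<phi>]) (simp only: mult_ac)
    finally show "circle_mean (\<lambda>\<tau>. H (\<tau>, t)) = circle_mean (\<lambda>\<tau>. cis (- (2 * pi * real m * \<tau>)) * \<phi> (cis (2 * pi * \<tau>))) *
     (cis (2 * pi * real ?p * t) * (exp (- (?s * d) * cis (- (2 * pi * t))) * (d + ?s * cis (2 * pi * t)) ^ m))"
      by (simp only: e_def x_def v_def)
  qed
  finally show ?thesis
    by (simp only: set_integral_mult_right circle_mean_binomial_exp \<phi>_def)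
qed

lemma parallel_zero:
  assumes \<kappa>: "\<bar>\<kappa>\<bar> = 1" and "CARD('n) > 1 \<or> odd k"
  shows "\<psi> z = 0"
proof (cases "CARD('n) > 1")
  case True
  obtain w where w: "norm w = 1" "herm z w = 0"
    using exists_orthogonal_unit[OF True] by blast
  have "(\<lambda>\<zeta>. \<psi> (z + \<zeta> *s w)) holomorphic_on UNIV"
    using hol unfolding line_holomorphic_def by blast
  from circle_mean_value[OF this]
  have "circle_mean (\<lambda>\<tau>. cis (- (2 * pi * real 0 * \<tau>)) * \<psi> (z + cis (2 * pi * \<tau>) *s w)) = \<psi> z"
    by simp
  \<comment> \<open>With m = 0 and d = 1 the sum is the single nonzero term (-\<surd>K)^|k| /
    |k|!.\<close>
  then show ?thesis
    using parallel_coefficient[OF \<kappa> w, of 0 1] K_pos by simp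
next
  case False
  then have odd: "odd k" using assms by blast
  let ?p = "nat \<bar>k\<bar>"
  have p: "odd ?p" using odd by (simp add: even_nat_iff)
  have Kp: "K = real ?p"
    using Kk K_pos \<kappa> by (metis abs_mult abs_of_pos mult.right_neutral nat_abs_int_diff of_int_abs of_nat_nat abs_ge_zero)
  define w :: "complex^'n" where "w = axis undefined 1"
  have w: "norm w = 1" by (simp add: w_def)
  have "CARD('n) = Suc 0" using False zero_less_card_finite[where 'a = 'n] by linarith
  then have all: "i = undefined" for i :: 'n
    by (metis UNIV_I card_1_singletonE One_nat_def singletonD)
  have zw: "z = (z $ undefined) *s w"
    unfolding vec_eq_iff
  proof
    fix i :: 'n
    have "i = undefined" by (rule all)
    then show "z $ i = (z $ undefined *s w) $ i" by (simp add: w_def)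
  qed
  define \<phi> where "\<phi> \<zeta> = \<psi> (0 + \<zeta> *s w)" for \<zeta>
  have \<phi>: "\<phi> holomorphic_on UNIV"
    using hol unfolding \<phi>_def line_holomorphic_def by blast
  have "\<phi> \<zeta> = 0" for \<zeta>
  proof (rule entire_zero_if_circle_means_zero[OF \<phi>])
    fix m
    \<comment> \<open>Here the base point is 0 and d = \<surd>K, so that \<surd>K d = K = |k| is the
      odd integer of the parity argument.\<close>
    define s where "s = complex_of_real (sqrt K)"
    have ss: "s * s = of_nat ?p"
    proof -
      have "s * s = of_real K"
        using K_pos by (simp add: s_def flip: of_real_mult)
      then show ?thesis by (simp only: Kp of_real_of_nat_eq)
    qed
    have "(\<Sum>i\<le>m. of_nat (m choose i) * s ^ i * s ^ (m - i) * ((- (s * s)) ^ (?p + i) / fact (?p + i)))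
        = s ^ m * (\<Sum>i\<le>m. of_nat (m choose i) * ((- of_nat ?p) ^ (?p + i) / fact (?p + i)))"
      unfolding ss sum_distrib_left
    proof (intro sum.cong refl)
      fix i assume "i \<in> {..m}"
      then have "s ^ m = s ^ i * s ^ (m - i)" by (simp flip: power_add)
      then show "of_nat (m choose i) * s ^ i * s ^ (m - i) * ((- of_nat ?p) ^ (?p + i) / fact (?p + i))
        = s ^ m * (of_nat (m choose i) * ((- of_nat ?p) ^ (?p + i) / fact (?p + i)))"
        by (simp only: mult_ac)
    qed
    moreover have "s ^ m \<noteq> 0" using K_pos by (simp add: s_def)
    moreover have "circle_mean (\<lambda>t. cis (- (2 * pi * real m * t)) * \<phi> (cis (2 * pi * t))) *
        (\<Sum>i\<le>m. of_nat (m choose i) * s ^ i * s ^ (m - i) * ((- (s * s)) ^ (?p + i) / fact (?p + i))) = 0"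
      unfolding \<phi>_def s_def by (rule parallel_coefficient[OF \<kappa> w herm_zero_left])
    ultimately show "circle_mean (\<lambda>t. cis (- (2 * pi * real m * t)) * \<phi> (cis (2 * pi * t))) = 0"
      using odd_binomial_exp_sum_nonzero[OF p, of m] by (simp only: mult_eq_0_iff) blast
  qed
  then show ?thesis using zw by (metis \<phi>_def add_0)
qed

end

context circle_slices
begin

subsection \<open>The transverse case\<close>

lemma W_add: "W t (x + y) = W t x + W t y"
  by (simp add: W_def linear_add[OF S_linear] algebra_simps)

lemma W_scaleR: "W t (r *\<^sub>R x) = r *\<^sub>R W t x"
  by (simp add: W_def linear_scale[OF S_linear] algebra_simps)

lemma W_diff: "W t (x - y) = W t x - W t y"
  using W_add[of t x "(-1) *\<^sub>R y"] W_scaleR[of t "-1" y] by simp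

lemma W_W_minus: "W t (W (- t) x) = x"
proof -
  define c where "c = cos (2 * pi * t)"
  define s where "s = sin (2 * pi * t)"
  have W1: "W t v = c *\<^sub>R v + s *\<^sub>R S v" and W2: "W (- t) v = c *\<^sub>R v - s *\<^sub>R S v" for v
    by (simp_all add: W_def c_def s_def)
  have "W t (W (- t) x) = (c * c + s * s) *\<^sub>R x"
    unfolding W2 unfolding W1
    by (simp add: linear_diff[OF S_linear] linear_scale[OF S_linear] S_square algebra_simps)
  also have "c * c + s * s = 1"
    unfolding c_def s_def by (rule sin_cos_squared_add3)
  finally show ?thesis by simp
qed

lemma W_add_W_minus: "W t x + W (- t) x = (2 * cos (2 * pi * t)) *\<^sub>R x"
  by (simp add: W_def algebra_simps flip: scaleR_add_left)

text \<open>On the real plane spanned by x and S x the map S acts like i, so W t - y acts like the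
  number cis (2 pi t) - y, whose squared modulus is the factor.\<close>

lemma norm_W_diff: "(norm (W t x - y *\<^sub>R x))\<^sup>2 = (1 - 2 * y * cos (2 * pi * t) + y\<^sup>2) * (norm x)\<^sup>2"
proof -
  have "(norm (W t x - y *\<^sub>R x))\<^sup>2
      = ((cos (2 * pi * t) - y)\<^sup>2 + (sin (2 * pi * t))\<^sup>2) * (x \<bullet> x)"
  proof -
    have "W t x - y *\<^sub>R x = (cos (2 * pi * t) - y) *\<^sub>R x + sin (2 * pi * t) *\<^sub>R S x"
      by (simp add: W_def algebra_simps)
    moreover have "S x \<bullet> S x = x \<bullet> x"
      using norm_S[of x] by (simp add: norm_eq)
    moreover have "(norm (a *\<^sub>R x + b *\<^sub>R S x))\<^sup>2 = (a\<^sup>2 + b\<^sup>2) * (x \<bullet> x)" if "S x \<bullet> S x = x \<bullet> x" for a b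
      using that
      by (simp add: power2_norm_eq_inner inner_add_left inner_add_right inner_S inner_commute[of "S x" x])
         (simp add: power2_eq_square algebra_simps)
    ultimately show ?thesis by simp
  qed
  also have "(cos (2 * pi * t) - y)\<^sup>2 + (sin (2 * pi * t))\<^sup>2 = 1 - 2 * y * cos (2 * pi * t) + y\<^sup>2"
    using sin_cos_squared_add[of "2 * pi * t"] by (simp add: power2_diff)
  finally show ?thesis by (simp add: power2_norm_eq_inner)
qed

lemma herm_W: "herm \<eta> (W t w) = ellipse \<kappa> t * herm \<eta> w + of_real (sin (2 * pi * t)) * herm \<eta> (S' w)"
  by (simp add: W_def S_def ellipse_def herm_simps algebra_simps)

lemma herm_W_self: "norm w = 1 \<Longrightarrow> herm w (W t w) = ellipse \<kappa> t"
  by (simp add: herm_W herm_self S'_orth)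

text \<open>For real \<open>\<bar>y\<bar> < 1\<close> the map \<open>W t - y\<close> is \<open>\<rho>\<close> times an isometry whose inverse is
  \<open>(W (- t) - y) / \<rho>\<close>, so it can be removed from the spherical mean.\<close>

lemma transverse_sphere_mean:
  assumes \<eta>: "norm \<eta> = 1" and y: "\<bar>y\<bar> < 1"
  shows "\<exists>\<rho>>0. \<forall>\<tau>. sphere_mean (\<lambda>w. exp (- (of_real (sqrt K) * (cis (2 * pi * \<tau>) * herm \<eta> (W t w)))) *
        \<psi> (cis (2 * pi * \<tau>) *s \<eta> + sqrt K *\<^sub>R (W t w - y *\<^sub>R w)))
    = sphere_mean (\<lambda>w. exp (- (of_real (sqrt K / \<rho>) * (1 - of_real y * ellipse \<kappa> t)) * cnj (herm w \<eta>)) *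
        \<psi> (0 + (cis (2 * pi * \<tau>) * (1 + of_real (sqrt K * \<rho>) * herm w \<eta>)) *s \<eta>))"
proof -
  define \<rho> where "\<rho> = sqrt (1 - 2 * y * cos (2 * pi * t) + y\<^sup>2)"
  have \<rho>2_pos: "1 - 2 * y * cos (2 * pi * t) + y\<^sup>2 > 0"
  proof -
    have "y * cos (2 * pi * t) \<le> \<bar>y\<bar> * 1"
      by (metis abs_cos_le_one abs_ge_self abs_ge_zero abs_mult mult_left_mono order_trans)
    moreover have "0 < (1 - \<bar>y\<bar>)\<^sup>2" using y by simp
    ultimately show ?thesis by (simp add: power2_diff)
  qed
  then have \<rho>: "\<rho> > 0" and \<rho>2: "\<rho>\<^sup>2 = 1 - 2 * y * cos (2 * pi * t) + y\<^sup>2"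
    by (simp_all add: \<rho>_def)
  define T where "T w = (1 / \<rho>) *\<^sub>R (W (- t) w - y *\<^sub>R w)" for w
  have lin: "linear T"
    by (rule linearI) (simp_all add: T_def W_add W_scaleR algebra_simps)
  have iso: "norm (T w) = norm w" for w
  proof -
    have "(norm (T w))\<^sup>2 = (1 / \<rho>)\<^sup>2 * (\<rho>\<^sup>2 * (norm w)\<^sup>2)"
      unfolding \<rho>2 using norm_W_diff[of "- t" w y] by (simp add: T_def power_divide)
    then have "(norm (T w))\<^sup>2 = (norm w)\<^sup>2" using \<rho> by (simp add: power_divide)
    then show ?thesis by (simp add: power2_eq_iff_nonneg)
  qed
  have WT: "W t (T w) = (1 / \<rho>) *\<^sub>R (w - y *\<^sub>R W t w)" for w
    by (simp add: T_def W_scaleR W_diff W_W_minus)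
  have WyT: "W t (T w) - y *\<^sub>R T w = \<rho> *\<^sub>R w" for w
  proof -
    have "W t (T w) - y *\<^sub>R T w = (1 / \<rho>) *\<^sub>R (w - y *\<^sub>R (W t w + W (- t) w) + (y * y) *\<^sub>R w)"
      by (simp add: WT) (simp add: T_def algebra_simps)
    also have "\<dots> = (1 / \<rho> * \<rho>\<^sup>2) *\<^sub>R w"
      unfolding W_add_W_minus \<rho>2 by (simp add: algebra_simps power2_eq_square)
    also have "1 / \<rho> * \<rho>\<^sup>2 = \<rho>" using \<rho> by (simp add: power2_eq_square)
    finally show ?thesis .
  qed
  have "sphere_mean (\<lambda>w. exp (- (of_real (sqrt K) * (cis (2 * pi * \<tau>) * herm \<eta> (W t w)))) *
        \<psi> (cis (2 * pi * \<tau>) *s \<eta> + sqrt K *\<^sub>R (W t w - y *\<^sub>R w)))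
    = sphere_mean (\<lambda>w. exp (- (of_real (sqrt K / \<rho>) * (1 - of_real y * ellipse \<kappa> t)) * cnj (herm w \<eta>)) *
        \<psi> (0 + (cis (2 * pi * \<tau>) * (1 + of_real (sqrt K * \<rho>) * herm w \<eta>)) *s \<eta>))" (is "?L = ?R") for \<tau>
  proof -
    define e where "e = cis (2 * pi * \<tau>)"
    define A where "A \<zeta> = exp (- (of_real (sqrt K / \<rho>) * (1 - of_real y * ellipse \<kappa> t)) * (e * cnj \<zeta>))" for \<zeta>
    \<comment> \<open>S' is antilinear and \<open>herm\<close> is conjugate linear in its second
      argument, so \<open>herm \<eta> (S' w)\<close> is complex linear in w and belongs to the
      holomorphic factor. The part depending on \<open>cnj (herm w \<eta>)\<close> stays in
      \<open>A\<close>.\<close>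
    define G where "G w = exp (of_real (sqrt K / \<rho> * y * sin (2 * pi * t)) * e * herm \<eta> (S' w)) * \<psi> (e *s \<eta> + (sqrt K * \<rho>) *\<^sub>R w)" for w
    have f: "continuous_on UNIV (\<lambda>w. exp (- (of_real (sqrt K) * (e * herm \<eta> (W t w)))) *
        \<psi> (e *s \<eta> + sqrt K *\<^sub>R (W t w - y *\<^sub>R w)))"
      by (intro continuous_intros continuous_on_compose2[OF cont]) auto
    have "?L = sphere_mean (\<lambda>w. exp (- (of_real (sqrt K) * (e * herm \<eta> (W t (T w))))) *
        \<psi> (e *s \<eta> + sqrt K *\<^sub>R (W t (T w) - y *\<^sub>R T w)))"
      using sphere_mean_isometry[OF lin iso f] by (simp add: e_def)
    also have "\<dots> = sphere_mean (\<lambda>w. A (herm w \<eta>) * G w)"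
    proof -
      have "exp (- (of_real (sqrt K) * (e * herm \<eta> (W t (T w))))) * \<psi> (e *s \<eta> + sqrt K *\<^sub>R (W t (T w) - y *\<^sub>R T w))
          = A (herm w \<eta>) * G w" for w
      proof -
        have "- (of_real (sqrt K) * (e * herm \<eta> (W t (T w))))
            = - (of_real (sqrt K / \<rho>) * (1 - of_real y * ellipse \<kappa> t)) * (e * cnj (herm w \<eta>))
              + of_real (sqrt K / \<rho> * y * sin (2 * pi * t)) * e * herm \<eta> (S' w)"
          unfolding WT herm_scaleR_right herm_diff_right herm_W cnj_herm
          by (simp add: algebra_simps)
        then show ?thesis
          by (simp only: A_def G_def WyT exp_add scaleR_scaleR mult.assoc)
      qed
      then show ?thesis by simp
    qed
    also have "\<dots> = sphere_mean (\<lambda>w. A (herm w \<eta>) * G (herm w \<eta> *s \<eta>))"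
    proof (rule sphere_mean_holomorphic_factor[OF _ _ _ \<eta>])
      show "continuous_on UNIV A"
        unfolding A_def by (intro continuous_intros)
      show "continuous_on UNIV G"
        unfolding G_def by (intro continuous_intros continuous_on_compose2[OF cont]) auto
      show "line_holomorphic G"
        unfolding line_holomorphic_def
      proof (intro allI)
        fix a b
        have "(\<lambda>\<zeta>. \<psi> ((e *s \<eta> + (sqrt K * \<rho>) *\<^sub>R a) + \<zeta> *s ((sqrt K * \<rho>) *\<^sub>R b))) holomorphic_on UNIV"
          using hol unfolding line_holomorphic_def by blast
        moreover have "(e *s \<eta> + (sqrt K * \<rho>) *\<^sub>R a) + \<zeta> *s ((sqrt K * \<rho>) *\<^sub>R b) = e *s \<eta> + (sqrt K * \<rho>) *\<^sub>R (a + \<zeta> *s b)" for \<zeta>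
          by (simp add: scaleR_eq_smult vec_eq_iff algebra_simps)
        moreover have "herm \<eta> (S' (a + \<zeta> *s b)) = herm \<eta> (S' a) + \<zeta> * herm \<eta> (S' b)" for \<zeta>
          by (simp add: S'_add S'_smult herm_simps)
        ultimately show "(\<lambda>\<zeta>. G (a + \<zeta> *s b)) holomorphic_on UNIV"
          unfolding G_def by (auto intro!: holomorphic_intros)
      qed
    qed
    \<comment> \<open>Rotating w by e cancels the phase in \<open>A\<close> and moves it into the
      argument of \<psi>. The exponential in \<open>G\<close> becomes 1, since S' of any multiple of
      \<eta> is orthogonal to \<eta>.\<close>
    also have "\<dots> = sphere_mean (\<lambda>w. A (herm (e *s w) \<eta>) * G (herm (e *s w) \<eta> *s \<eta>))"
      unfolding e_def
    proof (rule sphere_mean_rotate[symmetric])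
      show "continuous_on UNIV (\<lambda>w. A (herm w \<eta>) * G (herm w \<eta> *s \<eta>))"
        unfolding A_def G_def by (intro continuous_intros continuous_on_compose2[OF cont]) auto
    qed
    also have "\<dots> = ?R"
    proof -
      have "e * cnj e = 1" by (simp add: e_def cis_cnj cis_mult)
      then have ee: "e * (cnj e * h) = h" for h
        by (simp add: mult.assoc[symmetric])
      have "A (herm (e *s w) \<eta>) * G (herm (e *s w) \<eta> *s \<eta>)
        = exp (- (of_real (sqrt K / \<rho>) * (1 - of_real y * ellipse \<kappa> t)) * cnj (herm w \<eta>)) *
          \<psi> (0 + (e * (1 + of_real (sqrt K * \<rho>) * herm w \<eta>)) *s \<eta>)" for w
      proof -
        have "herm \<eta> (S' (c *s \<eta>)) = 0" for c
          by (simp add: S'_smult herm_simps S'_orth)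
        moreover have "e *s \<eta> + (sqrt K * \<rho>) *\<^sub>R (herm (e *s w) \<eta> *s \<eta>) = 0 + (e * (1 + of_real (sqrt K * \<rho>) * herm w \<eta>)) *s \<eta>"
          by (simp add: vec_eq_iff herm_simps scaleR_eq_smult algebra_simps)
        ultimately show ?thesis
          unfolding A_def G_def by (simp add: herm_smult_left ee)
      qed
      then show ?thesis by (simp add: e_def)
    qed
    finally show ?thesis .
  qed
  with \<rho> show ?thesis by (intro exI[of _ \<rho>] conjI allI)
qed

text \<open>A triple integral over w, \<tau> and t is evaluated in two orders. With t innermost it
  consists of slices and vanishes. With w innermost the spherical mean leaves only the complex line
  through \<eta>, where \<tau> extracts the m-th Taylor coefficient and t yields the scalar.\<close>

lemma transverse_coefficient:
  assumes \<eta>: "norm \<eta> = 1" and y: "\<bar>y\<bar> < 1"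
  shows "circle_mean (\<lambda>\<tau>. cis (- (2 * pi * real m * \<tau>)) * \<psi> (0 + cis (2 * pi * \<tau>) *s \<eta>)) *
    circle_mean (\<lambda>t. cis (2 * pi * of_int k * t) * (exp (of_real K * (of_real y * ellipse \<kappa> t)) *
      (\<Sum>i\<le>m. of_nat (m choose i) * (- (of_real K * (1 - of_real y * ellipse \<kappa> t))) ^ i / fact i * sphere_moment \<eta> i))) = 0"
proof -
  define \<phi> where "\<phi> \<zeta> = \<psi> (0 + \<zeta> *s \<eta>)" for \<zeta>
  have \<phi>: "\<phi> holomorphic_on UNIV"
    using hol unfolding \<phi>_def line_holomorphic_def by blast
  then have c\<phi>: "continuous_on UNIV \<phi>"
    by (rule holomorphic_on_imp_continuous_on)
  define M where "M = circle_mean (\<lambda>\<tau>. cis (- (2 * pi * real m * \<tau>)) * \<phi> (cis (2 * pi * \<tau>)))"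
  define E where "E \<tau> t = cis (- (2 * pi * real m * \<tau>)) * (cis (2 * pi * of_int k * t) * exp (of_real K * (of_real y * ellipse \<kappa> t)))" for \<tau> t
  define Q where "Q w \<tau> t = exp (- (of_real (sqrt K) * (cis (2 * pi * \<tau>) * herm \<eta> (W t w)))) *
      \<psi> (cis (2 * pi * \<tau>) *s \<eta> + sqrt K *\<^sub>R (W t w - y *\<^sub>R w))" for w \<tau> t
  define F where "F p = (case p of (w, \<tau>, t) \<Rightarrow> E \<tau> t * Q w \<tau> t)" for p
  have cF: "continuous_on UNIV F"
    unfolding F_def E_def Q_def case_prod_unfold
    by (intro continuous_intros continuous_on_compose2[OF cont]) auto
  have "compact (F ` (cball 0 1 \<times> {0..1} \<times> {0..1}))"
    using cF by (intro compact_continuous_image compact_Times compact_cball compact_Icc) (auto intro: continuous_on_subset)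
  then obtain C where "\<forall>x\<in>F ` (cball 0 1 \<times> {0..1} \<times> {0..1}). cmod x \<le> C"
    using compact_imp_bounded bounded_iff by blast
  then have C: "\<And>w \<tau> t. w \<in> cball 0 1 \<Longrightarrow> \<tau> \<in> {0..1} \<Longrightarrow> t \<in> {0..1} \<Longrightarrow> cmod (F (w, \<tau>, t)) \<le> C"
    by auto
  have Fm: "(\<lambda>p. F (sgn (fst p), snd p)) \<in> borel_measurable borel"
  proof (rule measurable_compose[OF _ borel_measurable_continuous_onI[OF cF]])
    show "(\<lambda>p. (sgn (fst p :: complex^'n), snd p)) \<in> borel_measurable (borel :: ((complex^'n) \<times> real \<times> real) measure)"
      unfolding borel_prod[symmetric]
      using borel_measurable_sgn_vec by measurable
  qed
  have slice0: "circle_mean (\<lambda>t. F (w, \<tau>, t)) = 0" if w: "norm w = 1" for w \<tau>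
  proof -
    have eq: "F (w, \<tau>, t) = cis (- (2 * pi * real m * \<tau>)) * (cis (2 * pi * of_int k * t) *
        (exp (- (of_real (sqrt K) * herm (cis (2 * pi * \<tau>) *s \<eta> - (sqrt K * y) *\<^sub>R w) (W t w))) *
         \<psi> (cis (2 * pi * \<tau>) *s \<eta> - (sqrt K * y) *\<^sub>R w + sqrt K *\<^sub>R W t w)))" for t
    proof -
      have "sqrt K * sqrt K = K" using K_pos by simp
      then have sK: "complex_of_real (sqrt K) * (of_real (sqrt K) * x) = of_real K * x" for x
        by (metis mult.assoc of_real_mult)
      have sK': "complex_of_real (sqrt K) * of_real (sqrt K) = of_real K"
        using sK[of 1] by simp
      \<comment> \<open>The pairing of w with W t w is the ellipse, so the shift of the base point
        by -\<surd>K y w contributes exactly the factor exp (K y ellipse).\<close>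
      have "- (of_real (sqrt K) * herm (cis (2 * pi * \<tau>) *s \<eta> - (sqrt K * y) *\<^sub>R w) (W t w))
          = of_real K * (of_real y * ellipse \<kappa> t) + - (of_real (sqrt K) * (cis (2 * pi * \<tau>) * herm \<eta> (W t w)))"
        by (simp add: herm_diff_left herm_smult_left herm_scaleR_left herm_W_self[OF w] algebra_simps sK sK')
      moreover have "cis (2 * pi * \<tau>) *s \<eta> - (sqrt K * y) *\<^sub>R w + sqrt K *\<^sub>R W t w
          = cis (2 * pi * \<tau>) *s \<eta> + sqrt K *\<^sub>R (W t w - y *\<^sub>R w)"
        by (simp add: algebra_simps)
      ultimately show ?thesis
        by (simp only: F_def E_def Q_def prod.case exp_add mult.assoc)
    qed
    show ?thesis
      unfolding eq set_integral_mult_right using slice'[OF w] by simp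
  qed
  have 1: "(LINT w:cball 0 1|lborel. circle_mean (\<lambda>\<tau>. circle_mean (\<lambda>t. F (sgn w, \<tau>, t)))) = 0"
    by (rule set_integral_AE_zero) (simp add: slice0 norm_sgn circle_mean_const)
  have 2: "(LINT w:cball 0 1|lborel. circle_mean (\<lambda>\<tau>. circle_mean (\<lambda>t. F (sgn w, \<tau>, t))))
      = circle_mean (\<lambda>t. circle_mean (\<lambda>\<tau>. LINT w:cball 0 1|lborel. F (sgn w, \<tau>, t)))"
    by (rule set_Fubini_bounded3[where F = "\<lambda>p. F (sgn (fst p), snd p)" and C = C, unfolded fst_conv snd_conv])
       (use Fm C norm_sgn_le in auto)
  have 3: "circle_mean (\<lambda>\<tau>. LINT w:cball 0 1|lborel. F (sgn w, \<tau>, t))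
      = M * (cis (2 * pi * of_int k * t) * (exp (of_real K * (of_real y * ellipse \<kappa> t)) *
      (\<Sum>i\<le>m. of_nat (m choose i) * (- (of_real K * (1 - of_real y * ellipse \<kappa> t))) ^ i / fact i * sphere_moment \<eta> i)))" for t
  proof -
    have "\<exists>\<rho>>0. \<forall>\<tau>. sphere_mean (\<lambda>w. Q w \<tau> t)
      = sphere_mean (\<lambda>w. exp (- (of_real (sqrt K / \<rho>) * (1 - of_real y * ellipse \<kappa> t)) * cnj (herm w \<eta>)) *
        \<phi> (cis (2 * pi * \<tau>) * (1 + of_real (sqrt K * \<rho>) * herm w \<eta>)))"
      unfolding Q_def \<phi>_def by (rule transverse_sphere_mean[OF \<eta> y])
    then obtain \<rho> where \<rho>: "\<rho> > 0" and Q: "\<And>\<tau>. sphere_mean (\<lambda>w. Q w \<tau> t)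
      = sphere_mean (\<lambda>w. exp (- (of_real (sqrt K / \<rho>) * (1 - of_real y * ellipse \<kappa> t)) * cnj (herm w \<eta>)) *
        \<phi> (cis (2 * pi * \<tau>) * (1 + of_real (sqrt K * \<rho>) * herm w \<eta>)))"
      by (elim exE conjE) (rule that, auto)
    define a where "a = of_real (sqrt K / \<rho>) * (1 - of_real y * ellipse \<kappa> t)"
    define b where "b = complex_of_real (sqrt K * \<rho>)"
    define c where "c = cis (2 * pi * of_int k * t) * exp (of_real K * (of_real y * ellipse \<kappa> t))"
    \<comment> \<open>The stretching factor \<rho> depends on y and t in its own way, but it cancels
      in this product. Apart from the twist, the scalar depends on y and t only through y times the
      ellipse, which is what makes it a power series with computable coefficients.\<close>
    have ab: "a * b = of_real K * (1 - of_real y * ellipse \<kappa> t)"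
    proof -
      have "sqrt K / \<rho> * (sqrt K * \<rho>) = K" using \<rho> K_pos by simp
      then have "complex_of_real (sqrt K / \<rho>) * of_real (sqrt K * \<rho>) = of_real K"
        by (metis of_real_mult)
      then show ?thesis
        by (simp only: a_def b_def mult_ac) (simp only: mult.assoc[symmetric])
    qed
    have "circle_mean (\<lambda>\<tau>. LINT w:cball 0 1|lborel. F (sgn w, \<tau>, t))
        = circle_mean (\<lambda>\<tau>. c * (cis (- (2 * pi * real m * \<tau>)) * sphere_mean (\<lambda>w. Q w \<tau> t)))"
    proof -
      have "F (w, \<tau>, t) = (c * cis (- (2 * pi * real m * \<tau>))) * Q w \<tau> t" for w \<tau>
        by (simp only: F_def E_def c_def prod.case mult_ac)
      then show ?thesis
        by (simp only: set_integral_mult_right) (simp only: mult.assoc set_integral_mult_right)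
    qed
    also have "\<dots> = c * circle_mean (\<lambda>\<tau>. sphere_mean (\<lambda>w. cis (- (2 * pi * real m * \<tau>)) *
        (exp (- a * cnj (herm w \<eta>)) * \<phi> (cis (2 * pi * \<tau>) * (1 + b * herm w \<eta>)))))"
      by (simp only: set_integral_mult_right Q a_def b_def)
    also have "\<dots> = c * sphere_mean (\<lambda>w. circle_mean (\<lambda>\<tau>. cis (- (2 * pi * real m * \<tau>)) *
        (exp (- a * cnj (herm w \<eta>)) * \<phi> (cis (2 * pi * \<tau>) * (1 + b * herm w \<eta>)))))"
    proof -
      have "continuous_on UNIV (\<lambda>p. cis (- (2 * pi * real m * fst p)) *
        (exp (- a * cnj (herm (snd p) \<eta>)) * \<phi> (cis (2 * pi * fst p) * (1 + b * herm (snd p) \<eta>))))"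
        by (intro continuous_intros continuous_on_compose2[OF c\<phi>]) auto
      from circle_sphere_swap[OF this] show ?thesis by simp
    qed
    also have "\<dots> = c * sphere_mean (\<lambda>w. M * (exp (- a * cnj (herm w \<eta>)) * (1 + b * herm w \<eta>) ^ m))"
    proof -
      have "circle_mean (\<lambda>\<tau>. cis (- (2 * pi * real m * \<tau>)) *
        (exp (- a * cnj (herm w \<eta>)) * \<phi> (cis (2 * pi * \<tau>) * (1 + b * herm w \<eta>))))
        = M * (exp (- a * cnj (herm w \<eta>)) * (1 + b * herm w \<eta>) ^ m)" for w
      proof -
        define u where "u = exp (- a * cnj (herm w \<eta>))"
        define v where "v = 1 + b * herm w \<eta>"
        have "circle_mean (\<lambda>\<tau>. cis (- (2 * pi * real m * \<tau>)) * (u * \<phi> (cis (2 * pi * \<tau>) * v)))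
            = circle_mean (\<lambda>\<tau>. u * (cis (- (2 * pi * real m * \<tau>)) * \<phi> (cis (2 * pi * \<tau>) * v)))"
          by (simp only: mult.left_commute)
        also have "\<dots> = M * (u * v ^ m)"
          by (simp only: set_integral_mult_right circle_mean_coefficient_scaled[OF \<phi>] M_def) (simp only: mult_ac)
        finally show ?thesis by (simp only: u_def v_def)
      qed
      then show ?thesis by simp
    qed
    also have "\<dots> = M * (c * (\<Sum>i\<le>m. of_nat (m choose i) * (- (a * b)) ^ i / fact i * sphere_moment \<eta> i))"
      by (simp only: set_integral_mult_right sphere_mean_exp_binomial) (simp only: mult_ac)
    finally show ?thesis
      by (simp only: ab c_def mult.assoc)
  qed
  show ?thesis
    using 2 unfolding 1 3 set_integral_mult_right M_def \<phi>_def by (rule sym)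
qed

lemma transverse_zero:
  assumes \<kappa>: "\<bar>\<kappa>\<bar> < 1"
  shows "\<psi> z = 0"
proof -
  have line: "\<psi> (0 + \<zeta> *s \<eta>) = 0" if \<eta>: "norm \<eta> = 1" for \<zeta> \<eta>
  proof (rule entire_zero_if_circle_means_zero[where G = "\<lambda>\<zeta>. \<psi> (0 + \<zeta> *s \<eta>)"])
    show "(\<lambda>\<zeta>. \<psi> (0 + \<zeta> *s \<eta>)) holomorphic_on UNIV"
      using hol unfolding line_holomorphic_def by blast
    fix m
    \<comment> \<open>The scalar as a polynomial in 1 - x, with x standing for y times the ellipse.
      Its top coefficient is a multiple of the m-th sphere moment and so is nonzero.\<close>
    define q where "q = (\<Sum>i\<le>m. monom (of_nat (m choose i) * (- of_real K) ^ i / fact i * sphere_moment \<eta> i) i)"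
    have pq: "poly q x = (\<Sum>i\<le>m. of_nat (m choose i) * (- (of_real K * x)) ^ i / fact i * sphere_moment \<eta> i)" for x
      by (simp add: q_def poly_sum poly_monom) (intro sum.cong refl, simp add: power_mult_distrib[symmetric] mult_ac)
    have "coeff q m = (- of_real K) ^ m / fact m * sphere_moment \<eta> m"
      by (simp add: q_def coeff_sum)
    then have "coeff q m \<noteq> 0"
      using K_pos sphere_moment_nonzero[OF \<eta>, of m] by simp
    then have "q \<noteq> 0"
      by auto
    then have p: "pcompose q [:1, -1:] \<noteq> 0"
      using pcompose_eq_0[of q "[:1, -1:]"] by auto
    show "circle_mean (\<lambda>t. cis (- (2 * pi * real m * t)) * \<psi> (0 + cis (2 * pi * t) *s \<eta>)) = 0"
    proof (rule ccontr)
      assume nz: "circle_mean (\<lambda>t. cis (- (2 * pi * real m * t)) * \<psi> (0 + cis (2 * pi * t) *s \<eta>)) \<noteq> 0"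
      have "pcompose q [:1, -1:] = 0"
      proof (rule ellipse_exp_poly_zero_imp[OF \<kappa>])
        show "complex_of_real K \<noteq> 0" using K_pos by simp
        show "circle_mean (\<lambda>t. cis (2 * pi * of_int k * t) * (exp (of_real K * (of_real y * ellipse \<kappa> t)) *
            poly (pcompose q [:1, -1:]) (of_real y * ellipse \<kappa> t))) = 0" if "\<bar>y\<bar> < 1" for y
          using transverse_coefficient[OF \<eta> that, of m] nz
          by (simp add: poly_pcompose pq)
      qed
      with p show False by simp
    qed
  qed
  show ?thesis
  proof (cases "z = 0")
    case True
    then show ?thesis
      using line[of "axis undefined 1" 0] by simp
  next
    case False
    have "norm (sgn z) = 1" using False by (simp add: norm_sgn)
    from line[OF this, of "of_real (norm z)"]
    have "\<psi> (norm z *\<^sub>R sgn z) = 0"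
      by (simp only: scaleR_eq_smult add_0)
    then show ?thesis
      using False by (simp add: sgn_div_norm)
  qed
qed

theorem annihilated:
  assumes "CARD('n) > 1 \<or> odd k"
  shows "\<psi> z = 0"
  using parallel_zero[OF _ assms] transverse_zero abs_kappa_le by (cases "\<bar>\<kappa>\<bar> = 1") auto

end

section \<open>Weyl operators on Fock space\<close>

text \<open>With a = sqrt (h / 2) z and \<theta> = h t this is \<open>pi_heis h z t\<close>, since
  |a|^2 / 2 = h |z|^2 / 4; the parameter h is absorbed.\<close>

definition weyl :: "complex^'n \<Rightarrow> real \<Rightarrow> (complex^'n \<Rightarrow> complex) \<Rightarrow> complex^'n \<Rightarrow> complex" where
  "weyl a \<theta> F \<zeta> = exp (\<i> * of_real \<theta> - herm \<zeta> a - of_real ((norm a)\<^sup>2 / 2)) * F (\<zeta> + a)"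

lemma norm_add_herm: "(norm (\<zeta> + a))\<^sup>2 = (norm \<zeta>)\<^sup>2 + 2 * Re (herm \<zeta> a) + (norm (a :: complex^'n))\<^sup>2"
  by (simp add: power2_norm_eq_inner Re_herm inner_add_left inner_add_right inner_commute)

text \<open>Weighted with the Gaussian, the modulus is merely translated, because the exponent
  completes the square. Preservation of the norm and of the growth bound both rest on this.\<close>

lemma norm_weyl: "cmod (weyl a \<theta> F \<zeta>) * exp (- (norm \<zeta>)\<^sup>2 / 2) = cmod (F (\<zeta> + a)) * exp (- (norm (\<zeta> + a))\<^sup>2 / 2)"
proof -
  have "exp (- Re (herm \<zeta> a) - (norm a)\<^sup>2 / 2) * exp (- (norm \<zeta>)\<^sup>2 / 2) = exp (- (norm (\<zeta> + a))\<^sup>2 / 2)"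
    unfolding exp_add[symmetric] norm_add_herm by (rule arg_cong[where f = exp]) (simp add: field_simps)
  then show ?thesis
    by (simp add: weyl_def norm_mult mult_ac)
qed

lemma holomorphic_Cn_continuous:
  assumes "holomorphic_Cn F" shows "continuous_on UNIV F"
  using assms unfolding holomorphic_Cn_def
  by (meson continuous_at_imp_continuous_on has_derivative_continuous)

lemma holomorphic_Cn_line:
  fixes F :: "complex^'n \<Rightarrow> complex"
  assumes "holomorphic_Cn F" shows "line_holomorphic F"
  unfolding line_holomorphic_def holomorphic_on_def
proof (intro allI ballI)
  fix a b :: "complex^'n" and \<zeta> :: complex
  obtain D where D: "(F has_derivative D) (at (a + \<zeta> *s b))" "\<And>c w. D (c *s w) = c * D w"
    using assms unfolding holomorphic_Cn_def by blast
  have "((\<lambda>\<zeta>. a + \<zeta> *s b) has_derivative (\<lambda>h. h *s b)) (at \<zeta>)"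
  proof -
    have "bounded_linear (\<lambda>h. h *s b)"
      unfolding linear_conv_bounded_linear[symmetric]
      by (rule linearI) (simp_all add: vec_eq_iff algebra_simps)
    then show ?thesis
      by (auto intro!: derivative_eq_intros bounded_linear.has_derivative[of "\<lambda>h. h *s b"])
  qed
  from has_derivative_compose[OF this D(1)]
  have "((\<lambda>\<zeta>. F (a + \<zeta> *s b)) has_derivative (\<lambda>h. D (h *s b))) (at \<zeta>)" .
  then have "((\<lambda>\<zeta>. F (a + \<zeta> *s b)) has_field_derivative D b) (at \<zeta>)"
    unfolding has_field_derivative_def D(2) by (simp add: mult.commute[of _ "D b"])
  then show "(\<lambda>\<zeta>. F (a + \<zeta> *s b)) field_differentiable at \<zeta> within UNIV"
    by (auto simp: field_differentiable_def)
qed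

lemma holomorphic_Cn_weyl:
  fixes F :: "complex^'n \<Rightarrow> complex"
  assumes "holomorphic_Cn F" shows "holomorphic_Cn (weyl a \<theta> F)"
  unfolding holomorphic_Cn_def
proof
  fix z :: "complex^'n"
  obtain D where D: "(F has_derivative D) (at (z + a))" "\<And>c w. D (c *s w) = c * D w"
    using assms unfolding holomorphic_Cn_def by blast
  define E where "E \<zeta> = exp (\<i> * of_real \<theta> - herm \<zeta> a - of_real ((norm a)\<^sup>2 / 2))" for \<zeta>
  have "bounded_linear (\<lambda>\<zeta>. herm \<zeta> a)"
    unfolding linear_conv_bounded_linear[symmetric]
    by (rule linearI) (simp_all only: herm_add_left herm_scaleR_left scaleR_conv_of_real[where 'a = complex])
  then have "((\<lambda>\<zeta>. herm \<zeta> a) has_derivative (\<lambda>h. herm h a)) (at z)"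
    by (rule bounded_linear_imp_has_derivative)
  then have "((\<lambda>\<zeta>. \<i> * of_real \<theta> - herm \<zeta> a - of_real ((norm a)\<^sup>2 / 2)) has_derivative (\<lambda>h. - herm h a)) (at z)"
    by (auto intro!: derivative_eq_intros)
  from has_derivative_compose[OF this DERIV_exp[unfolded has_field_derivative_def]]
  have E: "(E has_derivative (\<lambda>h. - herm h a * E z)) (at z)"
    unfolding E_def by (simp add: mult_ac)
  have "((\<lambda>\<zeta>. F (\<zeta> + a)) has_derivative D) (at z)"
  proof (rule has_derivative_compose[of "\<lambda>x. x + a" "\<lambda>x. x" z UNIV F D, OF _ D(1)])
    show "((\<lambda>x. x + a) has_derivative (\<lambda>x. x)) (at z)"
      by (auto intro!: derivative_eq_intros)
  qed
  from has_derivative_mult[OF E this]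
  have "(weyl a \<theta> F has_derivative (\<lambda>h. E z * D h + - herm h a * E z * F (z + a))) (at z)"
    unfolding weyl_def E_def .
  moreover have "E z * D (c *s w) + - herm (c *s w) a * E z * F (z + a)
      = c * (E z * D w + - herm w a * E z * F (z + a))" for c w
    by (simp add: D(2) herm_simps algebra_simps)
  ultimately show "\<exists>D. (weyl a \<theta> F has_derivative D) (at z) \<and> (\<forall>c w. D (c *s w) = c * D w)"
    by blast
qed

lemma lborel_integrable_translate:
  fixes f :: "'a::euclidean_space \<Rightarrow> 'b::{banach, second_countable_topology}"
  assumes "f \<in> borel_measurable borel"
  shows "integrable lborel (\<lambda>x. f (x + a)) \<longleftrightarrow> integrable lborel f"
  using integrable_distr_eq[of "(+) a" lborel borel f] assms by (simp add: lborel_distr_plus add.commute)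

lemma lborel_integral_translate:
  fixes f :: "'a::euclidean_space \<Rightarrow> 'b::{banach, second_countable_topology}"
  assumes "f \<in> borel_measurable borel"
  shows "(LINT x|lborel. f (x + a)) = (LINT x|lborel. f x)"
  using integral_distr[of "(+) a" lborel borel f] assms by (simp add: lborel_distr_plus add.commute)

definition fock_density :: "(complex^'n \<Rightarrow> complex) \<Rightarrow> complex^'n \<Rightarrow> real" where
  "fock_density F \<zeta> = (cmod (F \<zeta>))\<^sup>2 * exp (- (norm \<zeta>)\<^sup>2)"

lemma fock_density_square: "fock_density F \<zeta> = (cmod (F \<zeta>) * exp (- (norm \<zeta>)\<^sup>2 / 2))\<^sup>2"
  by (simp add: fock_density_def power_mult_distrib flip: exp_of_nat_mult)

lemma fock_density_weyl: "fock_density (weyl a \<theta> F) \<zeta> = fock_density F (\<zeta> + a)"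
  by (simp only: fock_density_square norm_weyl)

lemma fock_spaceD:
  assumes "F \<in> fock_space"
  shows "holomorphic_Cn F" "continuous_on UNIV F" "integrable lborel (fock_density F)"
  using assms holomorphic_Cn_continuous by (auto simp: fock_space_def fock_density_def[abs_def])

lemma borel_measurable_fock_density:
  assumes "continuous_on UNIV F" shows "fock_density F \<in> borel_measurable borel"
  unfolding fock_density_def[abs_def]
  by (intro borel_measurable_continuous_onI continuous_intros assms)

lemma weyl_fock_space:
  assumes "F \<in> fock_space" shows "weyl a \<theta> F \<in> fock_space"
proof -
  have "integrable lborel (\<lambda>\<zeta>. fock_density F (\<zeta> + a))"
    using lborel_integrable_translate[OF borel_measurable_fock_density] fock_spaceD[OF assms] by blast
  then have "integrable lborel (fock_density (weyl a \<theta> F))"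
    by (simp add: fock_density_weyl[abs_def])
  then show ?thesis
    using holomorphic_Cn_weyl fock_spaceD(1)[OF assms]
    by (simp add: fock_space_def fock_density_def[abs_def])
qed

lemma integral_fock_density_weyl:
  assumes "F \<in> fock_space"
  shows "(LINT \<zeta>|lborel. fock_density (weyl a \<theta> F) \<zeta>) = (LINT \<zeta>|lborel. fock_density F \<zeta>)"
  unfolding fock_density_weyl
  using lborel_integral_translate[OF borel_measurable_fock_density] fock_spaceD[OF assms] by blast

section \<open>The Fock inner product and adjoints of Weyl operators\<close>

definition fock_integrand :: "(complex^'n \<Rightarrow> complex) \<Rightarrow> (complex^'n \<Rightarrow> complex) \<Rightarrow> complex^'n \<Rightarrow> complex" where
  "fock_integrand F H \<zeta> = F \<zeta> * cnj (H \<zeta>) * of_real (exp (- (norm \<zeta>)\<^sup>2))"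

lemma fock_inner_integrand: "fock_inner F H = of_real (1 / pi ^ CARD('n)) * (LINT \<zeta>|lborel. fock_integrand F H \<zeta>)"
  for F :: "complex^'n \<Rightarrow> complex"
  by (simp add: fock_inner_def fock_integrand_def)

lemma fock_integrand_bound: "cmod (fock_integrand F H \<zeta>) \<le> (fock_density F \<zeta> + fock_density H \<zeta>) / 2"
proof -
  define x where "x = cmod (F \<zeta>) * exp (- (norm \<zeta>)\<^sup>2 / 2)"
  define y where "y = cmod (H \<zeta>) * exp (- (norm \<zeta>)\<^sup>2 / 2)"
  have "cmod (fock_integrand F H \<zeta>) = x * y"
    by (simp add: fock_integrand_def x_def y_def norm_mult mult_exp_exp)
  moreover have "2 * (x * y) \<le> x\<^sup>2 + y\<^sup>2"
    using sum_squares_bound[of x y] by simp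
  ultimately show ?thesis
    by (simp add: fock_density_square x_def y_def)
qed

lemma continuous_on_fock_integrand [continuous_intros]:
  assumes "continuous_on UNIV F" "continuous_on UNIV H"
  shows "continuous_on UNIV (fock_integrand F H)"
  unfolding fock_integrand_def[abs_def] by (intro continuous_intros assms)

lemma integrable_fock_integrand:
  assumes F: "F \<in> fock_space" and H: "H \<in> fock_space"
  shows "integrable lborel (fock_integrand F H)"
proof (rule Bochner_Integration.integrable_bound)
  show "integrable lborel (\<lambda>\<zeta>. (fock_density F \<zeta> + fock_density H \<zeta>) / 2)"
    using fock_spaceD(3)[OF F] fock_spaceD(3)[OF H] by simp
  show "fock_integrand F H \<in> borel_measurable lborel"
    using continuous_on_fock_integrand[OF fock_spaceD(2)[OF F] fock_spaceD(2)[OF H]]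
    by (simp add: borel_measurable_continuous_onI)
  show "AE \<zeta> in lborel. norm (fock_integrand F H \<zeta>) \<le> norm ((fock_density F \<zeta> + fock_density H \<zeta>) / 2)"
    by (intro AE_I2) (simp only: real_norm_def, rule order_trans[OF fock_integrand_bound abs_ge_self])
qed

text \<open>The variable is translated by a; the exponents agree by the expansion of |\<zeta> +
  a|^2.\<close>

lemma fock_inner_weyl:
  assumes F: "F \<in> fock_space" and H: "H \<in> fock_space"
  shows "fock_inner (weyl a \<theta> H) F = fock_inner H (weyl (- a) (- \<theta>) F)"
proof -
  have eq: "fock_integrand (weyl a \<theta> H) F \<zeta> = fock_integrand H (weyl (- a) (- \<theta>) F) (\<zeta> + a)" for \<zeta>
  proof -
    have ha: "herm (\<zeta> + a) (- a) = - herm \<zeta> a - of_real ((norm a)\<^sup>2)"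
      by (simp add: herm_minus_right herm_add_left herm_self)
    have "complex_of_real ((norm (\<zeta> + a))\<^sup>2) = of_real ((norm \<zeta>)\<^sup>2) + herm \<zeta> a + cnj (herm \<zeta> a) + of_real ((norm a)\<^sup>2)"
      unfolding norm_add_herm by (simp add: complex_eq_iff)
    then have e: "\<i> * of_real \<theta> - herm \<zeta> a - of_real ((norm a)\<^sup>2 / 2) + - of_real ((norm \<zeta>)\<^sup>2)
        = cnj (\<i> * of_real (- \<theta>) - herm (\<zeta> + a) (- a) - of_real ((norm (- a))\<^sup>2 / 2)) + - of_real ((norm (\<zeta> + a))\<^sup>2)"
      unfolding ha by (simp add: field_simps)
    have "fock_integrand (weyl a \<theta> H) F \<zeta>
        = exp (\<i> * of_real \<theta> - herm \<zeta> a - of_real ((norm a)\<^sup>2 / 2) + - of_real ((norm \<zeta>)\<^sup>2)) * (H (\<zeta> + a) * cnj (F \<zeta>))"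
      by (simp only: fock_integrand_def weyl_def exp_add exp_of_real[symmetric] of_real_minus mult_ac)
    also have "\<dots> = fock_integrand H (weyl (- a) (- \<theta>) F) (\<zeta> + a)"
    proof -
      have "\<zeta> + a + - a = \<zeta>" by simp
      then have "cnj (weyl (- a) (- \<theta>) F (\<zeta> + a)) = exp (cnj (\<i> * of_real (- \<theta>) - herm (\<zeta> + a) (- a) - of_real ((norm (- a))\<^sup>2 / 2))) * cnj (F \<zeta>)"
        by (simp only: weyl_def complex_cnj_mult exp_cnj)
      then show ?thesis
        unfolding e exp_add
        by (simp only: fock_integrand_def exp_of_real[symmetric] of_real_minus mult_ac)
    qed
    finally show ?thesis .
  qed
  have "fock_integrand H (weyl (- a) (- \<theta>) F) \<in> borel_measurable borel"
    using fock_spaceD(2)[OF H] fock_spaceD(2)[OF weyl_fock_space[OF F]]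
    by (intro borel_measurable_continuous_onI continuous_intros)
  from lborel_integral_translate[OF this, of a] show ?thesis
    by (simp add: fock_inner_integrand eq)
qed

lemma fock_space_diff:
  assumes F: "F \<in> fock_space" and H: "H \<in> fock_space"
  shows "(\<lambda>\<zeta>. F \<zeta> - H \<zeta>) \<in> fock_space"
proof -
  have hol: "holomorphic_Cn (\<lambda>\<zeta>. F \<zeta> - H \<zeta>)"
    unfolding holomorphic_Cn_def
  proof
    fix z
    obtain D E where D: "(F has_derivative D) (at z)" "\<And>c w. D (c *s w) = c * D w"
      and E: "(H has_derivative E) (at z)" "\<And>c w. E (c *s w) = c * E w"
      using fock_spaceD(1)[OF F] fock_spaceD(1)[OF H] unfolding holomorphic_Cn_def by metis
    then show "\<exists>D. ((\<lambda>\<zeta>. F \<zeta> - H \<zeta>) has_derivative D) (at z) \<and> (\<forall>c w. D (c *s w) = c * D w)"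
      by (intro exI[of _ "\<lambda>h. D h - E h"]) (auto intro!: derivative_eq_intros simp: algebra_simps)
  qed
  have "integrable lborel (fock_density (\<lambda>\<zeta>. F \<zeta> - H \<zeta>))"
  proof (rule Bochner_Integration.integrable_bound)
    show "integrable lborel (\<lambda>\<zeta>. 2 * (fock_density F \<zeta> + fock_density H \<zeta>))"
      using fock_spaceD(3)[OF F] fock_spaceD(3)[OF H] by simp
    show "fock_density (\<lambda>\<zeta>. F \<zeta> - H \<zeta>) \<in> borel_measurable lborel"
      using borel_measurable_fock_density[OF holomorphic_Cn_continuous[OF hol]] by simp
    have "(cmod (x - y))\<^sup>2 \<le> 2 * ((cmod x)\<^sup>2 + (cmod y)\<^sup>2)" for x y
    proof -
      have "(cmod (x - y))\<^sup>2 \<le> (cmod x + cmod y)\<^sup>2"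
        by (intro power_mono norm_triangle_ineq4) simp
      also have "\<dots> \<le> 2 * ((cmod x)\<^sup>2 + (cmod y)\<^sup>2)"
        using sum_squares_bound[of "cmod x" "cmod y"] by (simp add: power2_sum)
      finally show ?thesis .
    qed
    then have "fock_density (\<lambda>\<zeta>. F \<zeta> - H \<zeta>) \<zeta> \<le> 2 * (fock_density F \<zeta> + fock_density H \<zeta>)" for \<zeta>
      using mult_right_mono[of "(cmod (F \<zeta> - H \<zeta>))\<^sup>2" "2 * ((cmod (F \<zeta>))\<^sup>2 + (cmod (H \<zeta>))\<^sup>2)" "exp (- (norm \<zeta>)\<^sup>2)"]
      by (simp add: fock_density_def algebra_simps)
    then show "AE \<zeta> in lborel. norm (fock_density (\<lambda>\<zeta>. F \<zeta> - H \<zeta>) \<zeta>) \<le> norm (2 * (fock_density F \<zeta> + fock_density H \<zeta>))"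
      by (intro AE_I2) (auto simp: fock_density_def intro: order_trans)
  qed
  then show ?thesis
    using hol by (simp add: fock_space_def fock_density_def[abs_def])
qed

lemma fock_inner_diff_right:
  assumes "F \<in> fock_space" "G \<in> fock_space" "H \<in> fock_space"
  shows "fock_inner F (\<lambda>\<zeta>. G \<zeta> - H \<zeta>) = fock_inner F G - fock_inner F H"
proof -
  have "fock_integrand F (\<lambda>\<zeta>. G \<zeta> - H \<zeta>) \<zeta> = fock_integrand F G \<zeta> - fock_integrand F H \<zeta>" for \<zeta>
    by (simp add: fock_integrand_def algebra_simps)
  then show ?thesis
    using Bochner_Integration.integral_diff[OF integrable_fock_integrand[OF assms(1,2)] integrable_fock_integrand[OF assms(1,3)]]
    by (simp only: fock_inner_integrand right_diff_distrib)
qed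

lemma fock_inner_self_zero:
  fixes F :: "complex^'n \<Rightarrow> complex"
  assumes F: "F \<in> fock_space" and 0: "fock_inner F F = 0"
  shows "F \<zeta> = 0"
proof -
  have "fock_integrand F F \<zeta> = of_real (fock_density F \<zeta>)" for \<zeta>
    by (simp add: fock_integrand_def fock_density_def of_real_cmod_square)
  then have "complex_of_real (LINT \<zeta>|lborel. fock_density F \<zeta>) = 0"
    using 0 by (simp add: fock_inner_integrand)
  then have "(LINT \<zeta>|lborel. fock_density F \<zeta>) = 0" by simp
  moreover have "AE \<zeta> in lborel. 0 \<le> fock_density F \<zeta>"
    by (simp add: fock_density_def)
  ultimately have "AE \<zeta> in lborel. fock_density F \<zeta> = 0"
    using integral_nonneg_eq_0_iff_AE[OF fock_spaceD(3)[OF F]] by blast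
  then have ae: "AE \<zeta> in lborel. \<zeta> \<notin> {\<zeta>. F \<zeta> \<noteq> 0}"
    by (auto simp: fock_density_def)
  have "open {\<zeta>. F \<zeta> \<noteq> 0}"
    using fock_spaceD(2)[OF F] by (intro open_Collect_neq continuous_intros)
  from open_AE_notin_empty[OF this ae] show ?thesis
    by blast
qed

text \<open>Testing against K - L itself gives the uniqueness that evaluates the definite
  description in \<open>fock_adjoint\<close>.\<close>

lemma fock_space_eqI:
  assumes K: "K \<in> fock_space" and L: "L \<in> fock_space"
    and eq: "\<And>H. H \<in> fock_space \<Longrightarrow> fock_inner H K = fock_inner H L"
  shows "K = L"
proof
  fix \<zeta>
  have "fock_inner (\<lambda>\<zeta>. K \<zeta> - L \<zeta>) (\<lambda>\<zeta>. K \<zeta> - L \<zeta>) = 0"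
    using fock_inner_diff_right[OF fock_space_diff[OF K L] K L] eq[OF fock_space_diff[OF K L]] by simp
  from fock_inner_self_zero[OF fock_space_diff[OF K L] this]
  show "K \<zeta> = L \<zeta>" by simp
qed

lemma fock_adjoint_weyl:
  assumes F: "F \<in> fock_space"
  shows "fock_adjoint (weyl a \<theta>) F = weyl (- a) (- \<theta>) F"
  unfolding fock_adjoint_def
proof (rule the_equality)
  show "weyl (- a) (- \<theta>) F \<in> fock_space \<and> (\<forall>H\<in>fock_space. fock_inner (weyl a \<theta> H) F = fock_inner H (weyl (- a) (- \<theta>) F))"
    using weyl_fock_space[OF F] fock_inner_weyl[OF F] by blast
  fix K assume "K \<in> fock_space \<and> (\<forall>H\<in>fock_space. fock_inner (weyl a \<theta> H) F = fock_inner H K)"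
  then show "K = weyl (- a) (- \<theta>) F"
    using weyl_fock_space[OF F] fock_inner_weyl[OF F] by (intro fock_space_eqI) auto
qed

text \<open>The ball is invariant under scalar phases, and on each complex line through 0 the mean
  over the phases is G 0.\<close>

lemma ball_mean_value:
  fixes G :: "complex^'n \<Rightarrow> complex"
  assumes G: "continuous_on UNIV G" and hol: "line_holomorphic G"
  shows "(LINT w:cball 0 1|lborel. G w) = of_real (measure lborel (cball (0 :: complex^'n) 1)) * G 0"
proof -
  have rot: "(LINT w:cball 0 1|lborel. G (cis (2 * pi * t) *s w)) = (LINT w:cball 0 1|lborel. G w)" for t
  proof -
    have iso: "norm (cis (2 * pi * t) *s w) = norm w" for w :: "complex^'n"
      by (simp add: norm_smult)
    have "(LINT w|lborel. indicator (cball 0 1) (cis (2 * pi * t) *s w) *\<^sub>R G (cis (2 * pi * t) *s w))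
        = (LINT w|lborel. indicator (cball 0 1) w *\<^sub>R G w)"
      using borel_measurable_continuous_onI[OF G]
      by (intro integral_lborel_isometry[OF linear_smult iso, where f = "\<lambda>w. indicator (cball 0 1) w *\<^sub>R G w"])
         (intro borel_measurable_scaleR borel_measurable_indicator, simp_all)
    then show ?thesis
      by (simp add: set_lebesgue_integral_def indicator_def iso)
  qed
  have cont: "continuous_on UNIV (\<lambda>p. G (cis (2 * pi * fst p) *s snd p))"
    by (intro continuous_intros continuous_on_compose2[OF G]) auto
  obtain C where C: "\<And>x y. x \<in> {0..1} \<Longrightarrow> y \<in> cball 0 1 \<Longrightarrow> cmod (G (cis (2 * pi * fst (x, y)) *s snd (x, y))) \<le> C"
    using bounded_on_cball_box[OF cont compact_Icc compact_cball] by blast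
  have "(LINT w:cball 0 1|lborel. G w) = circle_mean (\<lambda>t. LINT w:cball 0 1|lborel. G (cis (2 * pi * t) *s w))"
    by (simp only: rot circle_mean_const)
  also have "\<dots> = (LINT w:cball 0 1|lborel. circle_mean (\<lambda>t. G (cis (2 * pi * t) *s w)))"
    by (rule set_Fubini_bounded[where F = "\<lambda>p. G (cis (2 * pi * fst p) *s snd p)" and C = C, unfolded fst_conv snd_conv])
       (use C borel_measurable_continuous_onI[OF cont] in auto)
  also have "\<dots> = (LINT w:cball (0 :: complex^'n) 1|lborel. G 0)"
  proof -
    have "(\<lambda>\<zeta>. G (0 + \<zeta> *s w)) holomorphic_on UNIV" for w
      using hol unfolding line_holomorphic_def by blast
    then show ?thesis
      using circle_mean_value[of "\<lambda>\<zeta>. G (0 + \<zeta> *s _)"] by simp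
  qed
  also have "\<dots> = of_real (measure lborel (cball (0 :: complex^'n) 1)) * G 0"
    by (simp add: set_lebesgue_integral_def scaleR_conv_of_real)
  finally show ?thesis .
qed

text \<open>Elements of Fock space grow at most like \<open>exp (|\<zeta>|\<^sup>2 / 2)\<close>: at the origin this is the mean value
  property on the unit ball, and Weyl operators move every point to the origin.\<close>

lemma fock_space_growth:
  fixes F :: "complex^'n \<Rightarrow> complex"
  assumes F: "F \<in> fock_space"
  obtains C where "C \<ge> 0" "\<And>\<zeta>. cmod (F \<zeta>) \<le> C * exp ((norm \<zeta>)\<^sup>2 / 2)"
proof -
  define v where "v = measure lborel (cball (0 :: complex^'n) 1)"
  define N where "N = (LINT \<zeta>|lborel. fock_density F \<zeta>)"
  \<comment> \<open>On the unit ball |G| \<le> 1 + |G|^2, and |G|^2 is at most e times the density;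
    dividing by the volume v bounds |G 0|. As C involves F only through N, it serves all Weyl
    translates of F.\<close>
  define C where "C = (v + exp 1 * N) / v"
  have v: "v > 0" unfolding v_def by (rule content_cball_pos) simp
  have N: "N \<ge> 0" unfolding N_def by (intro integral_nonneg_AE) (simp add: fock_density_def)
  have at0: "cmod (G 0) \<le> C" if G: "G \<in> fock_space" and NG: "(LINT \<zeta>|lborel. fock_density G \<zeta>) = N" for G :: "complex^'n \<Rightarrow> complex"
  proof -
    note Gc = fock_spaceD(2)[OF G]
    have "v * cmod (G 0) = cmod (LINT w:cball 0 1|lborel. G w)"
      using ball_mean_value[OF Gc holomorphic_Cn_line[OF fock_spaceD(1)[OF G]]] v
      by (simp add: v_def norm_mult)
    also have "\<dots> \<le> (LINT w|lborel. indicator (cball 0 1) w + exp 1 * fock_density G w)"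
      unfolding set_lebesgue_integral_def
    proof (rule Bochner_Integration.integral_norm_bound_integral)
      show "integrable lborel (\<lambda>w. indicator (cball 0 1) w *\<^sub>R G w)"
        using borel_integrable_compact[of "cball 0 1" G] Gc
        by (simp add: continuous_on_subset indicator_scaleR_eq_if)
      show "integrable lborel (\<lambda>w. indicator (cball (0::complex^'n) 1) w + exp 1 * fock_density G w)"
        using fock_spaceD(3)[OF G] emeasure_lborel_cball_finite[of "0::complex^'n" 1]
        by (intro Bochner_Integration.integrable_add integrable_mult_right integrable_real_indicator) auto
      fix w :: "complex^'n"
      show "norm (indicator (cball 0 1) w *\<^sub>R G w) \<le> indicator (cball 0 1) w + exp 1 * fock_density G w"
      proof (cases "norm w \<le> 1")
        case True
        have "cmod (G w) \<le> 1 + (cmod (G w))\<^sup>2"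
          using sum_squares_bound[of "cmod (G w)" 1] zero_le_power2[of "cmod (G w)"]
          unfolding one_power2 mult_1_right by linarith
        also have "(cmod (G w))\<^sup>2 \<le> exp 1 * fock_density G w"
        proof -
          have "1 \<le> exp 1 * exp (- (norm w)\<^sup>2)"
            using True by (simp add: power_le_one flip: exp_add)
          then have "(cmod (G w))\<^sup>2 * 1 \<le> (cmod (G w))\<^sup>2 * (exp 1 * exp (- (norm w)\<^sup>2))"
            by (intro mult_left_mono) auto
          then show ?thesis by (simp add: fock_density_def mult_ac)
        qed
        finally show ?thesis using True by simp
      qed (simp add: fock_density_def)
    qed
    also have "\<dots> = v + exp 1 * N"
      using fock_spaceD(3)[OF G] emeasure_lborel_cball_finite[of "0::complex^'n" 1] NG
      by (subst Bochner_Integration.integral_add) (auto simp: v_def intro!: integrable_real_indicator)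
    finally show ?thesis
      using v by (simp add: C_def field_simps)
  qed
  show ?thesis
  proof (rule that)
    show "C \<ge> 0" using v N by (simp add: C_def)
    fix \<zeta> :: "complex^'n"
    have "cmod (weyl \<zeta> 0 F 0) \<le> C"
      using weyl_fock_space[OF F] integral_fock_density_weyl[OF F] by (intro at0) (auto simp: N_def)
    then have "cmod (F \<zeta>) * exp (- (norm \<zeta>)\<^sup>2 / 2) \<le> C"
      using norm_weyl[of \<zeta> 0 F 0] by simp
    then show "cmod (F \<zeta>) \<le> C * exp ((norm \<zeta>)\<^sup>2 / 2)"
      by (simp add: exp_minus field_simps)
  qed
qed

lemma weyl_growth:
  assumes "\<And>\<zeta>. cmod (F \<zeta>) \<le> C * exp ((norm \<zeta>)\<^sup>2 / 2)"
  shows "cmod (weyl a \<theta> F \<zeta>) \<le> C * exp ((norm \<zeta>)\<^sup>2 / 2)"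
proof -
  have "cmod (weyl a \<theta> F \<zeta>) * exp (- (norm \<zeta>)\<^sup>2 / 2) \<le> C"
    unfolding norm_weyl using assms[of "\<zeta> + a"] by (simp add: exp_minus field_simps)
  then show ?thesis by (simp add: exp_minus field_simps)
qed

section \<open>Superpositions of Weyl operators\<close>

text \<open>The majorant B does not depend on g. Cauchy's inequality on discs of radius 1 turns it
  into a common bound for the derivatives near w0, hence for the difference quotients, and dominated
  convergence differentiates under the integral.\<close>

lemma holomorphic_integral_parameter:
  fixes \<Phi> :: "'g::euclidean_space \<Rightarrow> complex \<Rightarrow> complex"
  assumes f: "integrable lborel f" and hol: "\<And>g. \<Phi> g holomorphic_on UNIV"
    and meas: "\<And>w. (\<lambda>g. \<Phi> g w) \<in> borel_measurable borel"
    and bd: "\<And>w g. cmod (\<Phi> g w) \<le> B w" and B: "continuous_on UNIV B"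
  shows "(\<lambda>w. LINT g|lborel. f g * \<Phi> g w) holomorphic_on UNIV"
  unfolding holomorphic_on_def
proof
  fix w0 :: complex
  have fm: "f \<in> borel_measurable lborel" using f by simp
  have int: "integrable lborel (\<lambda>g. f g * \<Phi> g w)" for w
  proof (rule Bochner_Integration.integrable_bound)
    show "integrable lborel (\<lambda>g. f g * of_real (B w))" using f by simp
    show "(\<lambda>g. f g * \<Phi> g w) \<in> borel_measurable lborel"
      using fm meas by simp
    show "AE g in lborel. norm (f g * \<Phi> g w) \<le> norm (f g * of_real (B w))"
      by (intro AE_I2) (auto simp: norm_mult intro!: mult_left_mono order_trans[OF bd abs_ge_self])
  qed
  have "bounded (B ` cball w0 2)"
    using B by (intro compact_imp_bounded compact_continuous_image) (auto intro: continuous_on_subset)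
  then obtain M where M: "\<And>w. w \<in> cball w0 2 \<Longrightarrow> norm (B w) \<le> M"
    by (metis bounded_iff image_eqI)
  have \<Phi>M: "cmod (\<Phi> g w) \<le> M" if "dist w0 w \<le> 2" for g w
    using bd[of g w] M[of w] that by simp
  have der: "(\<Phi> g has_field_derivative deriv (\<Phi> g) w) (at w)" for g w
    using hol[of g] by (intro holomorphic_derivI[of _ UNIV]) auto
  have derM: "cmod (deriv (\<Phi> g) w) \<le> M" if "dist w0 w \<le> 1" for g w
  proof -
    have "cmod ((deriv ^^ 1) (\<Phi> g) w) \<le> fact 1 * M / 1 ^ 1"
    proof (rule Cauchy_inequality)
      show "\<Phi> g holomorphic_on ball w 1" "continuous_on (cball w 1) (\<Phi> g)"
        using hol[of g] by (auto intro: holomorphic_on_subset holomorphic_on_imp_continuous_on)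
      fix x assume "norm (w - x) = 1"
      then show "norm (\<Phi> g x) \<le> M"
        using that dist_triangle[of w0 x w] by (intro \<Phi>M) (simp add: dist_norm)
    qed simp
    then show ?thesis by simp
  qed
  have lip: "cmod (\<Phi> g w - \<Phi> g w0) \<le> M * cmod (w - w0)" if "dist w0 w \<le> 1" for g w
    by (rule field_differentiable_bound[of "cball w0 1" "\<Phi> g" "deriv (\<Phi> g)"])
       (use der derM that in \<open>auto intro: DERIV_subset\<close>)
  have "((\<lambda>w. ((LINT g|lborel. f g * \<Phi> g w) - (LINT g|lborel. f g * \<Phi> g w0)) / (w - w0)) \<longlongrightarrow>
      (LINT g|lborel. f g * deriv (\<Phi> g) w0)) (at w0)"
    unfolding tendsto_at_iff_sequentially
  proof (intro allI impI)
    fix X :: "nat \<Rightarrow> complex"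
    assume X0: "\<forall>i. X i \<in> UNIV - {w0}" and X: "X \<longlonglongrightarrow> w0"
    then have "eventually (\<lambda>i. dist (X i) w0 < 1) sequentially"
      by (simp add: tendstoD)
    then obtain n0 where n0: "\<And>i. i \<ge> n0 \<Longrightarrow> dist w0 (X i) \<le> 1"
      unfolding eventually_sequentially by (metis dist_commute less_imp_le)
    define Y where "Y i = X (i + n0)" for i
    have Y0: "Y i \<noteq> w0" and Y1: "dist w0 (Y i) \<le> 1" for i
      using X0 n0[of "i + n0"] by (auto simp: Y_def)
    have Y: "Y \<longlonglongrightarrow> w0"
      using X unfolding Y_def by (rule LIMSEQ_ignore_initial_segment)
    have lim: "(\<lambda>i. f g * ((\<Phi> g (Y i) - \<Phi> g w0) / (Y i - w0))) \<longlonglongrightarrow> f g * deriv (\<Phi> g) w0" for g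
    proof -
      have "((\<lambda>w. (\<Phi> g w - \<Phi> g w0) / (w - w0)) \<longlongrightarrow> deriv (\<Phi> g) w0) (at w0)"
        using der[of g w0] by (simp add: has_field_derivative_iff)
      then have "((\<lambda>w. (\<Phi> g w - \<Phi> g w0) / (w - w0)) \<circ> Y) \<longlonglongrightarrow> deriv (\<Phi> g) w0"
        unfolding tendsto_at_iff_sequentially using Y Y0 by auto
      then show ?thesis
        by (intro tendsto_mult_left) (simp add: o_def)
    qed
    have m: "(\<lambda>g. f g * ((\<Phi> g (Y i) - \<Phi> g w0) / (Y i - w0))) \<in> borel_measurable lborel" for i
      using fm meas by simp
    have "(\<lambda>i. LINT g|lborel. f g * ((\<Phi> g (Y i) - \<Phi> g w0) / (Y i - w0))) \<longlonglongrightarrow> (LINT g|lborel. f g * deriv (\<Phi> g) w0)"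
    proof (rule integral_dominated_convergence[where w = "\<lambda>g. norm (f g) * M"])
      show "(\<lambda>g. f g * deriv (\<Phi> g) w0) \<in> borel_measurable lborel"
        by (rule borel_measurable_LIMSEQ_metric[OF m lim])
      show "integrable lborel (\<lambda>g. norm (f g) * M)"
        using f by simp
      show "AE g in lborel. norm (f g * ((\<Phi> g (Y i) - \<Phi> g w0) / (Y i - w0))) \<le> norm (f g) * M" for i
      proof (intro AE_I2)
        fix g
        have "cmod ((\<Phi> g (Y i) - \<Phi> g w0) / (Y i - w0)) \<le> M"
          using lip[OF Y1, of g i] Y0[of i] by (simp add: norm_divide divide_le_eq)
        then show "norm (f g * ((\<Phi> g (Y i) - \<Phi> g w0) / (Y i - w0))) \<le> norm (f g) * M"
          by (simp only: norm_mult) (intro mult_left_mono norm_ge_zero)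
      qed
    qed (use m lim in auto)
    moreover have "(LINT g|lborel. f g * ((\<Phi> g w - \<Phi> g w0) / (w - w0)))
        = ((LINT g|lborel. f g * \<Phi> g w) - (LINT g|lborel. f g * \<Phi> g w0)) / (w - w0)" for w
    proof -
      have "f g * ((\<Phi> g w - \<Phi> g w0) / (w - w0)) = (f g * \<Phi> g w - f g * \<Phi> g w0) / (w - w0)" for g
        by (simp add: right_diff_distrib)
      then show ?thesis
        by (simp only: integral_divide_zero Bochner_Integration.integral_diff[OF int int])
    qed
    ultimately have "(\<lambda>i. ((LINT g|lborel. f g * \<Phi> g (Y i)) - (LINT g|lborel. f g * \<Phi> g w0)) / (Y i - w0))
       \<longlonglongrightarrow> (LINT g|lborel. f g * deriv (\<Phi> g) w0)"
      by (simp only:)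
    then show "((\<lambda>w. ((LINT g|lborel. f g * \<Phi> g w) - (LINT g|lborel. f g * \<Phi> g w0)) / (w - w0)) \<circ> X)
       \<longlonglongrightarrow> (LINT g|lborel. f g * deriv (\<Phi> g) w0)"
      unfolding Y_def o_def by (rule LIMSEQ_offset)
  qed
  then have "((\<lambda>w. LINT g|lborel. f g * \<Phi> g w) has_field_derivative (LINT g|lborel. f g * deriv (\<Phi> g) w0)) (at w0)"
    by (simp add: has_field_derivative_iff)
  then show "(\<lambda>w. LINT g|lborel. f g * \<Phi> g w) field_differentiable at w0 within UNIV"
    by (auto simp: field_differentiable_def)
qed

text \<open>The growth bound for Weyl translates of F is uniform in g, so integrability of f alone
  makes the pointwise integral converge. In the application the Weyl operators are the inverses of
  \<pi>(g).\<close>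

locale weyl_superposition =
  fixes a :: "'g::euclidean_space \<Rightarrow> complex^'n" and \<theta> :: "'g \<Rightarrow> real" and f :: "'g \<Rightarrow> complex"
    and F :: "complex^'n \<Rightarrow> complex"
  assumes a_cont: "continuous_on UNIV a" and \<theta>_cont: "continuous_on UNIV \<theta>"
    and f_int: "integrable lborel f" and F_fock: "F \<in> fock_space"
begin

definition \<psi> :: "complex^'n \<Rightarrow> complex" where
  "\<psi> z = (LINT g|lborel. f g * weyl (a g) (\<theta> g) F z)"

lemma continuous_weyl: "continuous_on UNIV (\<lambda>p. weyl (a (fst p)) (\<theta> (fst p)) F (snd p))"
  unfolding weyl_def
  by (intro continuous_intros continuous_on_compose2[OF a_cont] continuous_on_compose2[OF \<theta>_cont]
      continuous_on_compose2[OF fock_spaceD(2)[OF F_fock]]) auto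

lemma weyl_measurable: "(\<lambda>g. weyl (a g) (\<theta> g) F z) \<in> borel_measurable borel"
proof (rule borel_measurable_continuous_onI)
  show "continuous_on UNIV (\<lambda>g. weyl (a g) (\<theta> g) F z)"
  proof -
    have "continuous_on UNIV (\<lambda>g. (g, z))"
      by (intro continuous_intros)
    from continuous_on_compose2[OF continuous_weyl this] show ?thesis
      by simp
  qed
qed

lemma \<psi>_continuous: "continuous_on UNIV \<psi>"
  unfolding continuous_on_sequentially
proof (intro allI ballI impI)
  fix X :: "nat \<Rightarrow> complex^'n" and z
  assume "(\<forall>n. X n \<in> UNIV) \<and> X \<longlonglongrightarrow> z"
  then have X: "X \<longlonglongrightarrow> z" by simp
  obtain C where C: "C \<ge> 0" "\<And>\<zeta>. cmod (F \<zeta>) \<le> C * exp ((norm \<zeta>)\<^sup>2 / 2)"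
    using fock_space_growth[OF F_fock] by blast
  obtain R where R: "\<And>n. norm (X n) \<le> R"
    using convergent_imp_Bseq[of X] X by (auto simp: convergent_def Bseq_def)
  define M where "M = C * exp (R\<^sup>2 / 2)"
  have bd: "cmod (weyl (a g) (\<theta> g) F (X n)) \<le> M" for g n
  proof -
    have "cmod (weyl (a g) (\<theta> g) F (X n)) \<le> C * exp ((norm (X n))\<^sup>2 / 2)"
      using C(2) by (rule weyl_growth)
    also have "\<dots> \<le> M"
      unfolding M_def using R[of n] C(1) by (intro mult_left_mono) (auto intro: power_mono)
    finally show ?thesis .
  qed
  have fm: "f \<in> borel_measurable lborel" using f_int by simp
  have "(\<lambda>n. LINT g|lborel. f g * weyl (a g) (\<theta> g) F (X n)) \<longlonglongrightarrow> (LINT g|lborel. f g * weyl (a g) (\<theta> g) F z)"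
  proof (rule integral_dominated_convergence[where w = "\<lambda>g. norm (f g) * M"])
    show "integrable lborel (\<lambda>g. norm (f g) * M)" using f_int by simp
    show "AE g in lborel. (\<lambda>n. f g * weyl (a g) (\<theta> g) F (X n)) \<longlonglongrightarrow> f g * weyl (a g) (\<theta> g) F z"
    proof (intro AE_I2 tendsto_mult_left)
      fix g
      have "continuous_on UNIV (weyl (a g) (\<theta> g) F)"
        using fock_spaceD(2)[OF weyl_fock_space[OF F_fock]] .
      then show "(\<lambda>n. weyl (a g) (\<theta> g) F (X n)) \<longlonglongrightarrow> weyl (a g) (\<theta> g) F z"
        using X by (auto simp: continuous_on_sequentially o_def)
    qed
    show "AE g in lborel. norm (f g * weyl (a g) (\<theta> g) F (X n)) \<le> norm (f g) * M" for n
      using bd by (intro AE_I2) (simp add: norm_mult mult_left_mono)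
  qed (use fm weyl_measurable in auto)
  then show "(\<psi> \<circ> X) \<longlonglongrightarrow> \<psi> z"
    by (simp add: \<psi>_def o_def)
qed

lemma \<psi>_line_holomorphic: "line_holomorphic \<psi>"
  unfolding line_holomorphic_def \<psi>_def
proof (intro allI)
  fix p q :: "complex^'n"
  obtain C where C: "C \<ge> 0" "\<And>\<zeta>. cmod (F \<zeta>) \<le> C * exp ((norm \<zeta>)\<^sup>2 / 2)"
    using fock_space_growth[OF F_fock] by blast
  show "(\<lambda>\<zeta>. LINT g|lborel. f g * weyl (a g) (\<theta> g) F (p + \<zeta> *s q)) holomorphic_on UNIV"
  proof (rule holomorphic_integral_parameter[OF f_int, where B = "\<lambda>\<zeta>. C * exp ((norm (p + \<zeta> *s q))\<^sup>2 / 2)"])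
    show "(\<lambda>\<zeta>. weyl (a g) (\<theta> g) F (p + \<zeta> *s q)) holomorphic_on UNIV" for g
      using holomorphic_Cn_line[OF fock_spaceD(1)[OF weyl_fock_space[OF F_fock]]]
      unfolding line_holomorphic_def by blast
    show "cmod (weyl (a g) (\<theta> g) F (p + \<zeta> *s q)) \<le> C * exp ((norm (p + \<zeta> *s q))\<^sup>2 / 2)" for \<zeta> g
      using C(2) by (rule weyl_growth)
    show "continuous_on UNIV (\<lambda>\<zeta>. C * exp ((norm (p + \<zeta> *s q))\<^sup>2 / 2))"
      by (intro continuous_intros) auto
  qed (rule weyl_measurable)
qed

text \<open>Fubini between the group and Fock space: Weyl operators preserve the Fock norm, so the
  integrals of absolute values are at most |f g| N. Pointwise vanishing thereby reaches the matrix
  coefficients of the weak integral.\<close>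

lemma fock_inner_superposition_zero:
  assumes \<psi>: "\<And>z. \<psi> z = 0" and H: "H \<in> fock_space"
  shows "(LINT g|lborel. f g * fock_inner (weyl (a g) (\<theta> g) F) H) = 0"
proof -
  define k where "k g \<zeta> = f g * fock_integrand (weyl (a g) (\<theta> g) F) H \<zeta>" for g \<zeta>
  have fm: "f \<in> borel_measurable borel" using f_int by simp
  have "(\<lambda>p. fock_integrand (weyl (a (fst p)) (\<theta> (fst p)) F) H (snd p)) \<in> borel_measurable borel"
    unfolding fock_integrand_def
    by (intro borel_measurable_continuous_onI continuous_intros continuous_weyl
        continuous_on_compose2[OF fock_spaceD(2)[OF H]]) auto
  then have "(\<lambda>p. fock_integrand (weyl (a (fst p)) (\<theta> (fst p)) F) H (snd p)) \<in> borel_measurable (lborel \<Otimes>\<^sub>M lborel)"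
    by (simp add: lborel_prod)
  moreover have "(\<lambda>p. f (fst p)) \<in> borel_measurable (lborel \<Otimes>\<^sub>M (lborel :: (complex^'n) measure))"
    using fm by measurable
  ultimately have km: "(\<lambda>(g, \<zeta>). k g \<zeta>) \<in> borel_measurable (lborel \<Otimes>\<^sub>M lborel)"
    unfolding k_def case_prod_unfold by (rule borel_measurable_times[rotated])
  define N where "N = ((LINT \<zeta>|lborel. fock_density F \<zeta>) + (LINT \<zeta>|lborel. fock_density H \<zeta>)) / 2"
  have ki: "integrable lborel (k g)" for g
    unfolding k_def using integrable_fock_integrand[OF weyl_fock_space[OF F_fock] H] by simp
  have kb: "(LINT \<zeta>|lborel. norm (k g \<zeta>)) \<le> norm (f g) * N" for g
  proof -
    have "(LINT \<zeta>|lborel. norm (fock_integrand (weyl (a g) (\<theta> g) F) H \<zeta>))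
        \<le> (LINT \<zeta>|lborel. (fock_density (weyl (a g) (\<theta> g) F) \<zeta> + fock_density H \<zeta>) / 2)"
    proof (rule integral_mono_AE)
      show "integrable lborel (\<lambda>\<zeta>. (fock_density (weyl (a g) (\<theta> g) F) \<zeta> + fock_density H \<zeta>) / 2)"
        using fock_spaceD(3)[OF weyl_fock_space[OF F_fock]] fock_spaceD(3)[OF H] by simp
      show "integrable lborel (\<lambda>\<zeta>. norm (fock_integrand (weyl (a g) (\<theta> g) F) H \<zeta>))"
        using integrable_fock_integrand[OF weyl_fock_space[OF F_fock] H] by (rule integrable_norm)
    qed (intro AE_I2 fock_integrand_bound)
    also have "\<dots> = N"
      using fock_spaceD(3)[OF weyl_fock_space[OF F_fock]] fock_spaceD(3)[OF H]
      by (simp add: N_def integral_fock_density_weyl[OF F_fock])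
    finally show ?thesis
      by (simp add: k_def norm_mult mult_left_mono)
  qed
  have "integrable (lborel \<Otimes>\<^sub>M lborel) (\<lambda>(g, \<zeta>). k g \<zeta>)"
  proof (rule lborel_pair.Fubini_integrable[OF km])
    have m: "(\<lambda>g. LINT \<zeta>|lborel. norm (k g \<zeta>)) \<in> borel_measurable lborel"
      using km by (intro lborel.borel_measurable_lebesgue_integral) (simp add: case_prod_unfold)
    have "integrable lborel (\<lambda>g. LINT \<zeta>|lborel. norm (k g \<zeta>))"
    proof (rule Bochner_Integration.integrable_bound[OF _ m])
      show "integrable lborel (\<lambda>g. norm (f g) * N)" using f_int by simp
      show "AE g in lborel. norm (LINT \<zeta>|lborel. norm (k g \<zeta>)) \<le> norm (norm (f g) * N)"
        using kb by (intro AE_I2) (auto intro: order_trans[OF _ abs_ge_self])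
    qed
    then show "integrable lborel (\<lambda>g. LINT \<zeta>|lborel. norm (case (g, \<zeta>) of (g, \<zeta>) \<Rightarrow> k g \<zeta>))" by simp
  qed (use ki in simp)
  from lborel_pair.Fubini_integral[OF this]
  have "(LINT g|lborel. LINT \<zeta>|lborel. k g \<zeta>) = (LINT \<zeta>|lborel. LINT g|lborel. k g \<zeta>)" by simp
  also have "\<dots> = (LINT \<zeta>|lborel. \<psi> \<zeta> * (cnj (H \<zeta>) * of_real (exp (- (norm \<zeta>)\<^sup>2))))"
  proof (rule Bochner_Integration.integral_cong[OF refl])
    fix \<zeta>
    have "(LINT g|lborel. k g \<zeta>) = (LINT g|lborel. f g * weyl (a g) (\<theta> g) F \<zeta> * (cnj (H \<zeta>) * of_real (exp (- (norm \<zeta>)\<^sup>2))))"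
      by (simp add: k_def fock_integrand_def mult_ac)
    then show "(LINT g|lborel. k g \<zeta>) = \<psi> \<zeta> * (cnj (H \<zeta>) * of_real (exp (- (norm \<zeta>)\<^sup>2)))"
      by (simp only: \<psi>_def integral_mult_left_zero)
  qed
  also have "\<dots> = 0" by (simp add: \<psi>)
  finally have "(LINT g|lborel. f g * (LINT \<zeta>|lborel. fock_integrand (weyl (a g) (\<theta> g) F) H \<zeta>)) = 0"
    by (simp add: k_def)
  moreover have "(LINT g|lborel. f g * fock_inner (weyl (a g) (\<theta> g) F) H)
      = (LINT g|lborel. of_real (1 / pi ^ CARD('n)) * (f g * (LINT \<zeta>|lborel. fock_integrand (weyl (a g) (\<theta> g) F) H \<zeta>)))"
    by (simp only: fock_inner_integrand mult.left_commute)
  ultimately show ?thesis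
    by (simp only: integral_mult_right_zero mult_zero_right)
qed

end

section \<open>Unfolding the X-ray transform\<close>

text \<open>E meets every orbit of translation by L once. Cut along the intervals [jL, (j + 1)L) and
  moved back to [0, L), its pieces cover that interval exactly once, and h does not notice the move.
  Boundedness of E keeps the sum over j finite.\<close>

lemma integral_periodic_unfold:
  fixes h :: "real \<Rightarrow> complex"
  assumes L: "L > 0" and h: "h \<in> borel_measurable borel" and hM: "\<And>s. cmod (h s) \<le> M"
    and per: "\<And>s j. h (s + of_int j * L) = h s"
    and E: "E \<in> sets borel" "E \<subseteq> {- (real N * L)..<real N * L}" and ex1: "\<And>s. \<exists>!j. s + of_int j * L \<in> E"
  shows "integrable lborel (\<lambda>s. indicator E s *\<^sub>R h s)"
    and "(LINT s|lborel. indicator E s *\<^sub>R h s) = (LINT s:{0..<L}|lborel. h s)"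
proof -
  have Eb: "bounded E"
    using E(2) by (rule bounded_subset[rotated]) (rule bounded_subset[OF bounded_closed_interval[of "- (real N * L)" "real N * L"]], auto)
  show hEi: "integrable lborel (\<lambda>s. indicator E s *\<^sub>R h s)"
    using set_integrable_bounded[OF Eb E(1) h hM] by (simp add: set_integrable_def)
  define I where "I = {- int N..<int N}"
  have fl: "s \<in> {of_int j * L..<of_int (j + 1) * L} \<longleftrightarrow> j = \<lfloor>s / L\<rfloor>" for s j
    using L by (auto simp: eq_commute[of j] floor_eq_iff field_simps)
  have mem: "j \<in> I" if "s + of_int j * L \<in> E" "s \<in> {0..<L}" for s j
  proof -
    have b: "- (real N * L) \<le> s + of_int j * L" "s + of_int j * L < real N * L"
      using that(1) E(2) by auto
    have s: "0 \<le> s" "s < L" using that(2) by auto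
    have "(- real N) * L < (of_int j + 1) * L"
      using b(1) s(2) by (simp only: distrib_right mult_1_left mult_minus_left)
    then have 1: "- real N < of_int j + 1"
      using L by (simp only: mult_less_cancel_right_pos)
    have "of_int j * L < real N * L"
      using b(2) s(1) by linarith
    then have 2: "of_int j < real N"
      using L by (simp only: mult_less_cancel_right_pos)
    from 1 2 have "- int N < j + 1" "j < int N"
      by linarith+
    then show ?thesis by (simp add: I_def)
  qed
  have split: "indicator E s *\<^sub>R h s = (\<Sum>j\<in>I. indicator {of_int j * L..<of_int (j + 1) * L} s *\<^sub>R (indicator E s *\<^sub>R h s))" for s
  proof (cases "s \<in> E")
    case True
    define j0 where "j0 = \<lfloor>s / L\<rfloor>"
    have s0: "s \<in> {of_int j0 * L..<of_int (j0 + 1) * L}" by (simp only: fl j0_def)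
    have "j0 \<in> I"
      by (rule mem[of "s - of_int j0 * L"]) (use True s0 in \<open>auto simp: algebra_simps\<close>)
    then have "(\<Sum>j\<in>I. indicator {of_int j * L..<of_int (j + 1) * L} s *\<^sub>R (indicator E s *\<^sub>R h s))
        = (\<Sum>j\<in>{j0}. indicator {of_int j * L..<of_int (j + 1) * L} s *\<^sub>R (indicator E s *\<^sub>R h s))"
      by (intro sum.mono_neutral_right) (auto simp: I_def indicator_def fl j0_def simp del: atLeastLessThan_iff of_int_add)
    then show ?thesis using s0 by simp
  qed simp
  have hE: "(\<lambda>s. indicator E s *\<^sub>R h s) \<in> borel_measurable borel"
    using h E(1) by measurable
  have "(LINT s|lborel. indicator E s *\<^sub>R h s)
      = (\<Sum>j\<in>I. LINT s|lborel. indicator {of_int j * L..<of_int (j + 1) * L} s *\<^sub>R (indicator E s *\<^sub>R h s))"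
    by (subst split, rule Bochner_Integration.integral_sum)
       (rule integrable_mult_indicator[OF _ hEi], simp)
  also have "\<dots> = (\<Sum>j\<in>I. LINT s|lborel. indicator {0..<L} s *\<^sub>R (indicator E (s + of_int j * L) *\<^sub>R h s))"
  proof (intro sum.cong refl)
    fix j
    have "(LINT s|lborel. indicator {of_int j * L..<of_int (j + 1) * L} s *\<^sub>R (indicator E s *\<^sub>R h s))
        = (LINT s|lborel. indicator {of_int j * L..<of_int (j + 1) * L} (s + of_int j * L) *\<^sub>R (indicator E (s + of_int j * L) *\<^sub>R h (s + of_int j * L)))"
      by (rule lborel_integral_translate[symmetric], rule borel_measurable_scaleR[OF borel_measurable_indicator hE], simp)
    also have "\<dots> = (LINT s|lborel. indicator {0..<L} s *\<^sub>R (indicator E (s + of_int j * L) *\<^sub>R h s))"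
    proof -
      have "indicator {of_int j * L..<of_int (j + 1) * L} (s + of_int j * L) = (indicator {0..<L} s :: real)" for s
        by (auto simp: indicator_def algebra_simps)
      then show ?thesis by (simp only: per)
    qed
    finally show "(LINT s|lborel. indicator {of_int j * L..<of_int (j + 1) * L} s *\<^sub>R (indicator E s *\<^sub>R h s))
        = (LINT s|lborel. indicator {0..<L} s *\<^sub>R (indicator E (s + of_int j * L) *\<^sub>R h s))"
      .
  qed
  also have "\<dots> = (LINT s|lborel. (\<Sum>j\<in>I. indicator {0..<L} s *\<^sub>R (indicator E (s + of_int j * L) *\<^sub>R h s)))"
  proof (rule Bochner_Integration.integral_sum[symmetric])
    fix j
    have "(\<lambda>s. s + of_int j * L) \<in> borel_measurable borel"
      by (intro borel_measurable_continuous_onI continuous_intros)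
    from borel_measurable_scaleR[OF measurable_compose[OF this borel_measurable_indicator[OF E(1)]] h]
    have "(\<lambda>s. indicator E (s + of_int j * L) *\<^sub>R h s) \<in> borel_measurable borel" .
    then have "set_integrable lborel {0..<L} (\<lambda>s. indicator E (s + of_int j * L) *\<^sub>R h s)"
      using hM by (intro set_integrable_bounded[where C = M])
        (auto simp: indicator_def intro: order_trans[OF norm_ge_zero] bounded_subset[OF bounded_closed_interval[of 0 L]])
    then show "integrable lborel (\<lambda>s. indicator {0..<L} s *\<^sub>R (indicator E (s + of_int j * L) *\<^sub>R h s))"
      by (simp add: set_integrable_def)
  qed
  also have "\<dots> = (LINT s:{0..<L}|lborel. h s)"
    unfolding set_lebesgue_integral_def
  proof (intro Bochner_Integration.integral_cong refl)
    fix s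
    show "(\<Sum>j\<in>I. indicator {0..<L} s *\<^sub>R (indicator E (s + of_int j * L) *\<^sub>R h s)) = indicator {0..<L} s *\<^sub>R h s"
    proof (cases "s \<in> {0..<L}")
      case True
      obtain j0 where j0: "s + of_int j0 * L \<in> E" "\<And>j. s + of_int j * L \<in> E \<Longrightarrow> j = j0"
        using ex1[of s] by blast
      have "(\<Sum>j\<in>I. indicator {0..<L} s *\<^sub>R (indicator E (s + of_int j * L) *\<^sub>R h s))
          = (\<Sum>j\<in>{j0}. indicator {0..<L} s *\<^sub>R (indicator E (s + of_int j * L) *\<^sub>R h s))"
        using mem[OF j0(1) True] j0(2) by (intro sum.mono_neutral_right) (auto simp: I_def indicator_def)
      then show ?thesis using j0(1) by simp
    qed simp
  qed
  finally show "(LINT s|lborel. indicator E s *\<^sub>R h s) = (LINT s:{0..<L}|lborel. h s)" .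
qed

section \<open>Right translations and integration along the curve\<close>

lemma nn_integral_lborel_prod:
  assumes "F \<in> borel_measurable borel"
  shows "(\<integral>\<^sup>+p. F p \<partial>(lborel :: ('a::euclidean_space \<times> 'b::euclidean_space) measure)) = (\<integral>\<^sup>+x. \<integral>\<^sup>+y. F (x, y) \<partial>lborel \<partial>lborel)"
proof -
  have "F \<in> borel_measurable (lborel \<Otimes>\<^sub>M lborel)"
    using assms by (simp add: lborel_prod)
  from lborel.nn_integral_fst[OF this] show ?thesis
    by (simp add: lborel_prod)
qed

text \<open>Right translation by a fixed group element has this shape: the bracket adds to the
  centre a function of the first component.\<close>

lemma nn_integral_lborel_shear:
  fixes F :: "'a::euclidean_space \<times> 'b::euclidean_space \<Rightarrow> ennreal"
  assumes F: "F \<in> borel_measurable borel" and c: "continuous_on UNIV c"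
  shows "(\<integral>\<^sup>+p. F (fst p + a, snd p + c (fst p)) \<partial>lborel) = (\<integral>\<^sup>+p. F p \<partial>lborel)"
proof -
  have cm: "continuous_on UNIV (\<lambda>p. (fst p + a, snd p + c (fst p)))"
    by (intro continuous_intros continuous_on_compose2[OF c]) auto
  have Fm: "(\<lambda>y. F (x, y)) \<in> borel_measurable borel" for x
    using F by (rule measurable_compose[rotated]) (simp add: borel_prod[symmetric])
  have "(\<integral>\<^sup>+p. F (fst p + a, snd p + c (fst p)) \<partial>lborel) = (\<integral>\<^sup>+x. \<integral>\<^sup>+y. F (x + a, y + c x) \<partial>lborel \<partial>lborel)"
    using nn_integral_lborel_prod[OF measurable_compose[OF borel_measurable_continuous_onI[OF cm] F]] by simp
  also have "\<dots> = (\<integral>\<^sup>+x. \<integral>\<^sup>+y. F (a + x, y) \<partial>lborel \<partial>lborel)"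
  proof (rule nn_integral_cong)
    fix x
    show "(\<integral>\<^sup>+y. F (x + a, y + c x) \<partial>lborel) = (\<integral>\<^sup>+y. F (a + x, y) \<partial>lborel)"
      using nn_integral_lborel_translate[OF Fm[of "a + x"], of "c x"]
      by (simp only: add.commute[of x a] add.commute[of _ "c x"])
  qed
  also have "\<dots> = (\<integral>\<^sup>+x. \<integral>\<^sup>+y. F (x, y) \<partial>lborel \<partial>lborel)"
  proof (rule nn_integral_lborel_translate)
    have "F \<in> borel_measurable (borel \<Otimes>\<^sub>M lborel)"
      using F by (simp add: borel_prod[symmetric] cong: measurable_cong_sets)
    then show "(\<lambda>x. \<integral>\<^sup>+y. F (x, y) \<partial>lborel) \<in> borel_measurable borel"
      by (rule lborel.borel_measurable_nn_integral_fst)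
  qed
  also have "\<dots> = (\<integral>\<^sup>+p. F p \<partial>lborel)"
    by (rule nn_integral_lborel_prod[OF F, symmetric])
  finally show ?thesis .
qed

text \<open>A curve \<gamma>(s) = (X s, U s) in the two-step group with bracket B. The fibre
  conditions say that for each g the times s with g \<gamma>(s)^-1 in D form a bounded fundamental
  domain for translation by L, and \<open>periodic\<close> says that P along this curve has period
  L.\<close>

locale group_slice =
  fixes B :: "'v::euclidean_space \<Rightarrow> 'v \<Rightarrow> 'z::euclidean_space"
    and X :: "real \<Rightarrow> 'v" and U :: "real \<Rightarrow> 'z" and P f :: "'v \<times> 'z \<Rightarrow> complex"
    and D :: "('v \<times> 'z) set" and L C :: real
  assumes B: "bounded_bilinear B" and B_self: "B x x = 0"
    and X: "continuous_on UNIV X" and U: "continuous_on UNIV U"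
    and P: "continuous_on UNIV P" and P_bound: "cmod (P g) \<le> C"
    and f: "integrable lborel f" and D: "D \<in> sets borel" and L: "L > 0"
    and zero: "AE g in lborel. g \<in> D \<longrightarrow>
      (LINT s|lborel. f (fst g + X s, snd g + U s + (1/2) *\<^sub>R B (fst g) (X s))) = 0"
    and bounded_fibre: "\<exists>N. \<forall>s. (fst g - X s, snd g - U s - (1/2) *\<^sub>R B (fst g) (X s)) \<in> D \<longrightarrow>
      - (real N * L) \<le> s \<and> s < real N * L"
    and unique_fibre: "\<exists>!j. (fst g - X (s + of_int j * L),
      snd g - U (s + of_int j * L) - (1/2) *\<^sub>R B (fst g) (X (s + of_int j * L))) \<in> D"
    and periodic: "P (fst g - X (s + of_int j * L), snd g - U (s + of_int j * L) - (1/2) *\<^sub>R B (fst g) (X (s + of_int j * L)))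
      = P (fst g - X s, snd g - U s - (1/2) *\<^sub>R B (fst g) (X s))"
begin

definition m :: "'v \<times> 'z \<Rightarrow> real \<Rightarrow> 'v \<times> 'z" where
  "m g s = (fst g + X s, snd g + U s + (1/2) *\<^sub>R B (fst g) (X s))"

definition m' :: "'v \<times> 'z \<Rightarrow> real \<Rightarrow> 'v \<times> 'z" where
  "m' g s = (fst g - X s, snd g - U s - (1/2) *\<^sub>R B (fst g) (X s))"

lemma m'_m: "m' (m g s) s = g"
  by (simp add: m_def m'_def bounded_bilinear.add_left[OF B] B_self)

lemma continuous_m': "continuous_on UNIV (\<lambda>p. m' (fst p) (snd p))"
  unfolding m'_def
  by (intro continuous_intros continuous_on_compose2[OF X] continuous_on_compose2[OF U]
      bounded_bilinear.continuous_on[OF B]) auto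

lemma continuous_m: "continuous_on UNIV (\<lambda>p. m (fst p) (snd p))"
  unfolding m_def
  by (intro continuous_intros continuous_on_compose2[OF X] continuous_on_compose2[OF U]
      bounded_bilinear.continuous_on[OF B]) auto

text \<open>For each fixed s the first component is a right translation, under which Lebesgue
  measure is invariant.\<close>

lemma distr_m: "distr lborel borel (\<lambda>p. (m (fst p) (snd p), snd p)) = (lborel :: (('v \<times> 'z) \<times> real) measure)"
proof (rule measure_eqI)
  let ?T = "\<lambda>p :: ('v \<times> 'z) \<times> real. (m (fst p) (snd p), snd p)"
  have T: "?T \<in> borel_measurable borel"
    by (intro borel_measurable_continuous_onI continuous_intros continuous_m)
  fix A assume "A \<in> sets (distr lborel borel ?T)"
  then have A: "A \<in> sets borel" by simp
  have iA: "(indicator A :: _ \<Rightarrow> ennreal) \<in> borel_measurable (lborel \<Otimes>\<^sub>M lborel)"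
    using A by (simp add: lborel_prod)
  have iTA: "(\<lambda>p. indicator A (?T p) :: ennreal) \<in> borel_measurable (lborel \<Otimes>\<^sub>M lborel)"
    using measurable_compose[OF T borel_measurable_indicator[OF A]] by (simp add: lborel_prod)
  have "emeasure (distr lborel borel ?T) A = (\<integral>\<^sup>+p. indicator A p \<partial>distr lborel borel ?T)"
    using A by simp
  also have "\<dots> = (\<integral>\<^sup>+p. indicator A (?T p) \<partial>lborel)"
    using T A by (intro nn_integral_distr) auto
  also have "\<dots> = (\<integral>\<^sup>+s. \<integral>\<^sup>+g. indicator A (m g s, s) \<partial>lborel \<partial>lborel)"
    using lborel_pair.nn_integral_snd[OF iTA] by (simp add: lborel_prod)
  also have "\<dots> = (\<integral>\<^sup>+s. \<integral>\<^sup>+g. indicator A (g, s) \<partial>lborel \<partial>lborel)"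
  proof (rule nn_integral_cong)
    fix s
    have Am: "(\<lambda>g. indicator A (g, s) :: ennreal) \<in> borel_measurable borel"
      using borel_measurable_indicator[OF A] by (rule measurable_compose[rotated]) (simp add: borel_prod[symmetric])
    have "continuous_on UNIV (\<lambda>x. U s + (1/2) *\<^sub>R B x (X s))"
      by (intro continuous_intros bounded_bilinear.continuous_on[OF B])
    from nn_integral_lborel_shear[OF Am this, of "X s"]
    show "(\<integral>\<^sup>+g. indicator A (m g s, s) \<partial>lborel) = (\<integral>\<^sup>+g. indicator A (g, s) \<partial>lborel :: ennreal)"
      by (simp add: m_def add.assoc)
  qed
  also have "\<dots> = (\<integral>\<^sup>+p. indicator A p \<partial>lborel)"
    using lborel_pair.nn_integral_snd[OF iA] by (simp add: lborel_prod)
  also have "\<dots> = emeasure lborel A" using A by simp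
  finally show "emeasure (distr lborel borel ?T) A = emeasure lborel A" .
qed simp

text \<open>The integral of f(g) P(g \<gamma>(s)^-1) over all pairs with g \<gamma>(s)^-1 in D is
  computed twice. Taking s first and unfolding the fibre gives the stated integral, up to Fubini.
  Replacing g by g \<gamma>(s) gives the integral over D of P times the integral of f along the
  translated curve, which is zero.\<close>

lemma slice_vanishes: "(LINT s:{0..<L}|lborel. LINT g|lborel. f g * P (m' g s)) = 0"
proof -
  have fm: "f \<in> borel_measurable borel" using f by simp
  have Pm: "(\<lambda>p. P (m' (fst p) (snd p))) \<in> borel_measurable borel"
    by (intro borel_measurable_continuous_onI continuous_on_compose2[OF P continuous_m']) auto
  define E where "E g = {s. m' g s \<in> D}" for g
  have m's: "continuous_on UNIV (m' g)" for g
  proof -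
    have "continuous_on UNIV (\<lambda>s. (g, s))"
      by (intro continuous_intros)
    from continuous_on_compose2[OF continuous_m' this] show ?thesis
      by simp
  qed
  have E: "E g \<in> sets borel" for g
  proof -
    have "m' g -` D \<inter> space borel \<in> sets borel"
      using borel_measurable_continuous_onI[OF m's] D by (rule measurable_sets)
    then show ?thesis by (simp add: E_def vimage_def)
  qed
  have unfold: "integrable lborel (\<lambda>s. indicator (E g) s *\<^sub>R h s) \<and>
      (LINT s|lborel. indicator (E g) s *\<^sub>R h s) = (LINT s:{0..<L}|lborel. h s)"
    if h: "h \<in> borel_measurable borel" "\<And>s. cmod (h s) \<le> M" "\<And>s j. h (s + of_int j * L) = h s" for g h M
  proof -
    obtain N where N: "\<And>s. m' g s \<in> D \<Longrightarrow> - (real N * L) \<le> s \<and> s < real N * L"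
      using bounded_fibre[of g] unfolding m'_def by blast
    have sub: "E g \<subseteq> {- (real N * L)..<real N * L}"
      using N by (auto simp: E_def)
    have ex1: "\<exists>!j. s + of_int j * L \<in> E g" for s
      using unique_fibre[of g s] by (simp add: E_def m'_def)
    show ?thesis
      using integral_periodic_unfold[OF L h E sub ex1] by blast
  qed
  have Pper: "P (m' g (s + of_int j * L)) = P (m' g s)" for g s j
    using periodic by (simp add: m'_def)
  have Ps: "(\<lambda>s. P (m' g s)) \<in> borel_measurable borel" for g
    by (intro borel_measurable_continuous_onI continuous_on_compose2[OF P m's]) auto
  \<comment> \<open>Unfolding the constant 1 shows that every fibre has measure L. This gives the
    absolute integrability needed for \<Phi>.\<close>
  have measE: "(LINT s|lborel. indicator (E g) s) = L" "integrable lborel (\<lambda>s. indicator (E g) s :: real)" for g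
  proof -
    have u: "integrable lborel (\<lambda>s. indicator (E g) s *\<^sub>R (1::complex)) \<and>
      (LINT s|lborel. indicator (E g) s *\<^sub>R (1::complex)) = (LINT s:{0..<L}|lborel. 1)"
      by (rule unfold[where M = 1]) auto
    have "integrable lborel (\<lambda>s. complex_of_real (indicator (E g) s))"
      using u by (simp add: scaleR_conv_of_real)
    then show i: "integrable lborel (\<lambda>s. indicator (E g) s :: real)"
      by (simp only: complex_of_real_integrable_eq)
    have "(LINT s|lborel. complex_of_real (indicator (E g) s)) = of_real L"
      using u L by (simp add: scaleR_conv_of_real set_lebesgue_integral_def)
    then have "complex_of_real (LINT s|lborel. indicator (E g) s) = of_real L"
      by (simp only: integral_complex_of_real)
    then show "(LINT s|lborel. indicator (E g) s) = L" by (simp only: of_real_eq_iff)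
  qed
  define \<Phi> where "\<Phi> p = indicator D (m' (fst p) (snd p)) *\<^sub>R (f (fst p) * P (m' (fst p) (snd p)))" for p
  have indE: "indicator D (m' g s) = (indicator (E g) s :: real)" for g s
    by (simp add: E_def indicator_def)
  have f1: "(\<lambda>p. f (fst p)) \<in> borel_measurable (borel :: (('v \<times> 'z) \<times> real) measure)"
    by (rule measurable_compose[OF _ fm]) (intro borel_measurable_continuous_onI continuous_intros)
  have \<Phi>m: "\<Phi> \<in> borel_measurable borel"
    unfolding \<Phi>_def
    by (intro borel_measurable_scaleR borel_measurable_times f1 Pm
        measurable_compose[OF borel_measurable_continuous_onI[OF continuous_m'] borel_measurable_indicator[OF D]])
  have \<Phi>s: "integrable lborel (\<lambda>s. \<Phi> (g, s))" "(LINT s|lborel. \<Phi> (g, s)) = f g * (LINT s:{0..<L}|lborel. P (m' g s))" for g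
  proof -
    have u: "integrable lborel (\<lambda>s. indicator (E g) s *\<^sub>R P (m' g s)) \<and>
      (LINT s|lborel. indicator (E g) s *\<^sub>R P (m' g s)) = (LINT s:{0..<L}|lborel. P (m' g s))"
      using Ps P_bound Pper by (intro unfold[where M = C]) auto
    have eq: "\<Phi> (g, s) = f g * (indicator (E g) s *\<^sub>R P (m' g s))" for s
      by (simp add: \<Phi>_def indE)
    show "integrable lborel (\<lambda>s. \<Phi> (g, s))"
      unfolding eq by (rule integrable_mult_right) (simp only: u)
    show "(LINT s|lborel. \<Phi> (g, s)) = f g * (LINT s:{0..<L}|lborel. P (m' g s))"
      unfolding eq integral_mult_right_zero by (simp only: u)
  qed
  have \<Phi>n: "(LINT s|lborel. norm (\<Phi> (g, s))) \<le> norm (f g) * C * L" for g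
  proof -
    have "(LINT s|lborel. norm (\<Phi> (g, s))) \<le> (LINT s|lborel. norm (f g) * C * indicator (E g) s)"
    proof (rule integral_mono_AE)
      show "AE s in lborel. norm (\<Phi> (g, s)) \<le> norm (f g) * C * indicator (E g) s"
      proof (rule AE_I2)
        fix s
        have "norm (\<Phi> (g, s)) = indicator (E g) s * (norm (f g) * cmod (P (m' g s)))"
          by (simp add: \<Phi>_def indE norm_mult)
        also have "\<dots> \<le> indicator (E g) s * (norm (f g) * C)"
          by (intro mult_left_mono[OF mult_left_mono[OF P_bound norm_ge_zero]]) simp
        finally show "norm (\<Phi> (g, s)) \<le> norm (f g) * C * indicator (E g) s"
          by (simp only: mult.commute)
      qed
    qed (use \<Phi>s measE in auto)
    then show ?thesis using measE(1)[of g] by simp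
  qed
  have "integrable (lborel \<Otimes>\<^sub>M lborel) \<Phi>"
  proof (rule lborel_pair.Fubini_integrable)
    show km: "\<Phi> \<in> borel_measurable (lborel \<Otimes>\<^sub>M lborel)"
      using \<Phi>m by (simp add: lborel_prod)
    have mm: "(\<lambda>g. LINT s|lborel. norm (\<Phi> (g, s))) \<in> borel_measurable lborel"
      using km by (intro lborel.borel_measurable_lebesgue_integral) (simp add: case_prod_unfold)
    show "integrable lborel (\<lambda>g. LINT s|lborel. norm (\<Phi> (g, s)))"
    proof (rule Bochner_Integration.integrable_bound[OF _ mm])
      show "integrable lborel (\<lambda>g. norm (f g) * C * L)" using f by simp
      show "AE g in lborel. norm (LINT s|lborel. norm (\<Phi> (g, s))) \<le> norm (norm (f g) * C * L)"
        using \<Phi>n by (intro AE_I2) (auto intro: order_trans[OF _ abs_ge_self])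
    qed
  qed (use \<Phi>s in simp)
  then have \<Phi>i: "integrable lborel \<Phi>" by (simp add: lborel_prod)
  define \<Psi> where "\<Psi> p = \<Phi> (m (fst p) (snd p), snd p)" for p
  have T: "(\<lambda>p :: ('v \<times> 'z) \<times> real. (m (fst p) (snd p), snd p)) \<in> measurable lborel borel"
    by (simp, intro borel_measurable_continuous_onI continuous_intros continuous_m)
  have \<Psi>i: "integrable lborel \<Psi>"
    unfolding \<Psi>_def using integrable_distr[OF T] \<Phi>i by (simp add: distr_m)
  have \<Psi>\<Phi>: "(LINT p|lborel. \<Psi> p) = (LINT p|lborel. \<Phi> p)"
    unfolding \<Psi>_def using integral_distr[OF T \<Phi>m] by (simp add: distr_m)
  have \<Psi>0: "(LINT p|lborel. \<Psi> p) = 0"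
  proof -
    have "(LINT p|lborel. \<Psi> p) = (LINT g|lborel. LINT s|lborel. \<Psi> (g, s))"
      using lborel_pair.integral_fst'[of \<Psi>] \<Psi>i by (simp add: lborel_prod)
    also have "\<dots> = 0"
    proof (rule integral_eq_zero_AE)
      show "AE g in lborel. (LINT s|lborel. \<Psi> (g, s)) = 0"
        using zero
      proof eventually_elim
        case (elim g)
        have "\<Psi> (g, s) = (indicator D g *\<^sub>R P g) * f (m g s)" for s
          by (simp add: \<Psi>_def \<Phi>_def m'_m)
        then have "(LINT s|lborel. \<Psi> (g, s)) = (indicator D g *\<^sub>R P g) * (LINT s|lborel. f (m g s))"
          by (simp only: integral_mult_right_zero)
        then show ?case
          using elim by (auto simp: indicator_def m_def)
      qed
    qed
    finally show ?thesis .
  qed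
  have "0 = (LINT g|lborel. LINT s|lborel. \<Phi> (g, s))"
    using lborel_pair.integral_fst'[of \<Phi>] \<Phi>i \<Psi>0 \<Psi>\<Phi> by (simp add: lborel_prod)
  also have "\<dots> = (LINT g|lborel. LINT s|lborel. indicator {0..<L} s *\<^sub>R (f g * P (m' g s)))"
    unfolding \<Phi>s set_lebesgue_integral_def by (simp flip: integral_mult_right_zero)
  also have "\<dots> = (LINT s|lborel. LINT g|lborel. indicator {0..<L} s *\<^sub>R (f g * P (m' g s)))"
  proof (rule lborel_pair.Fubini_integral[symmetric])
    have "snd \<in> borel_measurable (borel :: (('v \<times> 'z) \<times> real) measure)"
      by (intro borel_measurable_continuous_onI continuous_intros)
    moreover have "(indicator {0..<L} :: real \<Rightarrow> real) \<in> borel_measurable borel"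
      by (rule borel_measurable_indicator) simp
    ultimately have i2: "(\<lambda>p. indicator {0..<L} (snd p) :: real) \<in> borel_measurable (borel :: (('v \<times> 'z) \<times> real) measure)"
      by (rule measurable_compose)
    let ?k = "\<lambda>(g, s). indicator {0..<L} s *\<^sub>R (f g * P (m' g s))"
    show "integrable (lborel \<Otimes>\<^sub>M lborel) ?k"
    proof (rule Bochner_Integration.integrable_bound)
      show "integrable (lborel \<Otimes>\<^sub>M lborel) (\<lambda>(g, s). (norm (f g) * C) * indicator {0..<L} s)"
      proof (rule lborel_pair.Fubini_integrable)
        have "(\<lambda>p. (norm (f (fst p)) * C) * indicator {0..<L} (snd p)) \<in> borel_measurable borel"
          by (rule borel_measurable_times[OF borel_measurable_times[OF measurable_compose[OF f1 borel_measurable_norm] borel_measurable_const] i2])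
        then show "(\<lambda>(g, s). (norm (f g) * C) * indicator {0..<L} s) \<in> borel_measurable (lborel \<Otimes>\<^sub>M lborel)"
          by (simp add: lborel_prod case_prod_unfold)
        have "(LINT s|lborel. norm ((norm (f g) * C) * indicator {0..<L} s)) = norm (f g) * (\<bar>C\<bar> * L)" for g
          using L by (simp add: abs_mult)
        then show "integrable lborel (\<lambda>g. LINT s|lborel. norm (case (g, s) of (g, s) \<Rightarrow> (norm (f g) * C) * indicator {0..<L} s))"
          using f by simp
        show "AE g in lborel. integrable lborel (\<lambda>s. case (g, s) of (g, s) \<Rightarrow> (norm (f g) * C) * indicator {0..<L} s)"
          using L by (auto intro!: integrable_real_indicator)
      qed
      have "(\<lambda>p. indicator {0..<L} (snd p) *\<^sub>R (f (fst p) * P (m' (fst p) (snd p)))) \<in> borel_measurable borel"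
        by (rule borel_measurable_scaleR[OF i2 borel_measurable_times[OF f1 Pm]])
      then show "?k \<in> borel_measurable (lborel \<Otimes>\<^sub>M lborel)"
        by (simp add: lborel_prod case_prod_unfold)
      show "AE p in lborel \<Otimes>\<^sub>M lborel. norm (?k p) \<le> norm (case p of (g, s) \<Rightarrow> (norm (f g) * C) * indicator {0..<L} s)"
      proof (intro AE_I2, clarify)
        fix g s
        have "norm (f g) * cmod (P (m' g s)) \<le> norm (norm (f g) * C)"
          by (rule order_trans[OF mult_left_mono[OF P_bound] ]) auto
        then show "norm (indicator {0..<L} s *\<^sub>R (f g * P (m' g s))) \<le> norm ((norm (f g) * C) * indicator {0..<L} s)"
          by (auto simp: indicator_def norm_mult)
      qed
    qed
  qed
  also have "\<dots> = (LINT s:{0..<L}|lborel. LINT g|lborel. f g * P (m' g s))"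
    by (simp add: set_lebesgue_integral_def)
  finally show ?thesis by simp
qed

end

section \<open>Geometry of H-type algebras\<close>

text \<open>Even powers of U are 1 or -1, odd ones U or -U, so the exponential series splits into
  cosine and sine.\<close>

lemma op_exp_rotation:
  fixes U :: "'a::real_normed_vector \<Rightarrow> 'a"
  assumes lin: "linear U" and sq: "\<And>v. U (U v) = - v"
  shows "op_exp (\<lambda>v. x *\<^sub>R U v) a = cos x *\<^sub>R a + sin x *\<^sub>R U a"
proof -
  have "((\<lambda>v. x *\<^sub>R U v) ^^ n) a /\<^sub>R fact n = (cos_coeff n *\<^sub>R x ^ n) *\<^sub>R a + (sin_coeff n *\<^sub>R x ^ n) *\<^sub>R U a" for n
  proof (induction n)
    case (Suc n)
    have "((\<lambda>v. x *\<^sub>R U v) ^^ Suc n) a /\<^sub>R fact (Suc n)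
        = (x / real (Suc n)) *\<^sub>R U (((\<lambda>v. x *\<^sub>R U v) ^^ n) a /\<^sub>R fact n)"
      by (simp add: linear_scale[OF lin] divide_inverse mult_ac)
    also have "\<dots> = (cos_coeff (Suc n) *\<^sub>R x ^ Suc n) *\<^sub>R a + (sin_coeff (Suc n) *\<^sub>R x ^ Suc n) *\<^sub>R U a"
      unfolding Suc
      by (simp add: linear_add[OF lin] linear_scale[OF lin] sq cos_coeff_Suc sin_coeff_Suc algebra_simps)
    finally show ?case .
  qed (simp add: cos_coeff_def sin_coeff_def)
  moreover have "(\<lambda>n. (cos_coeff n *\<^sub>R x ^ n) *\<^sub>R a + (sin_coeff n *\<^sub>R x ^ n) *\<^sub>R U a) sums (cos x *\<^sub>R a + sin x *\<^sub>R U a)"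
    by (intro sums_add sums_scaleR_left cos_converges sin_converges)
  ultimately show ?thesis
    unfolding op_exp_def by (simp add: sums_unique[symmetric])
qed

text \<open>The group law in Weyl form: the phase - Im (herm b a) is what half the bracket becomes
  in coordinates.\<close>

lemma weyl_weyl:
  "weyl b \<beta> (weyl a \<alpha> F) \<zeta> = weyl (a + b) (\<alpha> + \<beta> - Im (herm b a)) F \<zeta>"
proof -
  have e: "complex_of_real ((norm (a + b))\<^sup>2 / 2) = of_real ((norm a)\<^sup>2 / 2) + of_real ((norm b)\<^sup>2 / 2) + of_real (Re (herm b a))"
    unfolding add.commute[of a b] norm_add_herm by (simp add: field_simps)
  have "(\<i> * of_real \<beta> - herm \<zeta> b - of_real ((norm b)\<^sup>2 / 2)) + (\<i> * of_real \<alpha> - herm (\<zeta> + b) a - of_real ((norm a)\<^sup>2 / 2))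
      = \<i> * of_real (\<alpha> + \<beta> - Im (herm b a)) - herm \<zeta> (a + b) - of_real ((norm (a + b))\<^sup>2 / 2)"
    unfolding e herm_add_left herm_add_right by (simp add: complex_eq_iff)
  then show ?thesis
    unfolding weyl_def by (simp only: mult.assoc[symmetric] exp_add[symmetric] add_ac)
qed

lemma Gamma_fund_borel: "Gamma_fund lam \<in> sets borel"
proof -
  have "Gamma_fund lam = {g. 0 \<le> snd g \<bullet> sgn lam} \<inter> {g. snd g \<bullet> sgn lam < pi / (norm lam)\<^sup>2}"
    by (auto simp: Gamma_fund_def)
  also have "\<dots> \<in> sets borel"
    by (intro sets.Int borel_closed borel_open closed_Collect_le open_Collect_less continuous_intros)
  finally show ?thesis .
qed

context h_type_algebra
begin

lemma bracket_bounded_bilinear: "bounded_bilinear (center_bracket br)"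
proof -
  have l: "linear (\<lambda>x. br x y)" and r: "linear (br x)" for x y
    using bilinear unfolding bilinear_def by blast+
  have "bilinear (center_bracket br)"
    unfolding bilinear_def
  proof (intro conjI allI linearI)
    fix x y z :: 'v and c :: real
    show "center_bracket br x (y + z) = center_bracket br x y + center_bracket br x z"
      using linear_add[OF r[of "(x, 0)"], of "(y, 0)" "(z, 0)"] by (simp add: center_bracket_def)
    show "center_bracket br x (c *\<^sub>R y) = c *\<^sub>R center_bracket br x y"
      using linear_scale[OF r[of "(x, 0)"], of c "(y, 0)"] by (simp add: center_bracket_def)
    show "center_bracket br (y + z) x = center_bracket br y x + center_bracket br z x"
      using linear_add[OF l[of "(x, 0)"], of "(y, 0)" "(z, 0)"] by (simp add: center_bracket_def)
    show "center_bracket br (c *\<^sub>R y) x = c *\<^sub>R center_bracket br y x"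
      using linear_scale[OF l[of "(x, 0)"], of c "(y, 0)"] by (simp add: center_bracket_def)
  qed
  then show ?thesis by (simp add: bilinear_conv_bounded_bilinear)
qed

lemma bracket_self: "center_bracket br x x = 0"
  by (simp add: center_bracket_def alternating)

lemma bracket_commute: "center_bracket br x y = - center_bracket br y x"
proof -
  interpret bounded_bilinear "center_bracket br" by (rule bracket_bounded_bilinear)
  have "0 = center_bracket br (x + y) (x + y)"
    by (simp only: bracket_self)
  also have "\<dots> = center_bracket br x x + center_bracket br x y + (center_bracket br y x + center_bracket br y y)"
    by (simp only: add_left add_right add_ac)
  finally have "center_bracket br x y + center_bracket br y x = 0"
    by (simp only: bracket_self add_0_left add_0_right)
  then show ?thesis by (simp only: eq_neg_iff_add_eq_0)
qed

lemmas J_inner = J_map_inner[OF bilinear]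

lemma J_eqI: "(\<And>W. x \<bullet> W = y \<bullet> W) \<Longrightarrow> x = (y :: 'v)"
  by (metis vector_eq_rdot)

lemma J_linear: "linear (J_map br \<mu>)"
proof -
  interpret bounded_bilinear "center_bracket br" by (rule bracket_bounded_bilinear)
  show ?thesis
    by (rule linearI; rule J_eqI)
       (simp_all add: J_inner inner_add_left inner_add_right add_left scaleR_left)
qed

lemma J_add: "J_map br (\<mu> + \<nu>) V = J_map br \<mu> V + J_map br \<nu> V"
  by (rule J_eqI) (simp add: J_inner inner_add_left)

lemma J_skew: "J_map br \<mu> V \<bullet> W = - (V \<bullet> J_map br \<mu> W)"
  using bracket_commute[of V W] by (simp add: J_inner inner_commute[of V])

text \<open>The Clifford relation, by polarization of J_\<mu>^2 = - |\<mu>|^2.\<close>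

lemma J_anticommute: "J_map br \<mu> (J_map br \<nu> V) + J_map br \<nu> (J_map br \<mu> V) = - ((2 * (\<mu> \<bullet> \<nu>)) *\<^sub>R V)"
proof -
  have "J_map br (\<mu> + \<nu>) (J_map br (\<mu> + \<nu>) V) = J_map br \<mu> (J_map br \<mu> V) + J_map br \<mu> (J_map br \<nu> V)
      + J_map br \<nu> (J_map br \<mu> V) + J_map br \<nu> (J_map br \<nu> V)"
    by (simp add: J_add linear_add[OF J_linear])
  then have "J_map br \<mu> (J_map br \<nu> V) + J_map br \<nu> (J_map br \<mu> V)
      = (norm \<mu>)\<^sup>2 *\<^sub>R V + (norm \<nu>)\<^sup>2 *\<^sub>R V - (norm (\<mu> + \<nu>))\<^sup>2 *\<^sub>R V"
    unfolding J_map_square by (simp add: algebra_simps)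
  also have "\<dots> = - ((2 * (\<mu> \<bullet> \<nu>)) *\<^sub>R V)"
    by (simp add: power2_norm_eq_inner inner_add_left inner_add_right inner_commute algebra_simps flip: scaleR_add_left scaleR_diff_left)
  finally show ?thesis .
qed

lemma norm_J: "norm (J_map br \<mu> V) = norm \<mu> * norm V"
proof -
  have "(norm (J_map br \<mu> V))\<^sup>2 = (norm \<mu> * norm V)\<^sup>2"
    using J_skew[of \<mu> V "J_map br \<mu> V"]
    by (simp add: power2_norm_eq_inner J_map_square power_mult_distrib)
  then show ?thesis by (simp add: power2_eq_iff_nonneg)
qed

text \<open>Writing the direction as J_\<lambda> a removes the inverse; J_\<lambda> / |\<lambda>|
  squares to -1, so the exponential is a rotation.\<close>

lemma geodesic_J:
  assumes lam: "lam \<noteq> 0"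
  shows "geodesic br (J_map br lam a) lam s =
    (cos (norm lam * s) *\<^sub>R a + sin (norm lam * s) *\<^sub>R ((1 / norm lam) *\<^sub>R J_map br lam a), (s / (2 * norm lam)) *\<^sub>R sgn lam)"
proof -
  have "inj (J_map br lam)"
  proof (rule injI)
    fix x y assume "J_map br lam x = J_map br lam y"
    then have "J_map br lam (J_map br lam x) = J_map br lam (J_map br lam y)" by simp
    then show "x = y" using lam by (simp add: J_map_square)
  qed
  then have inv: "inv (J_map br lam) (J_map br lam a) = a" by simp
  define U where "U v = (1 / norm lam) *\<^sub>R J_map br lam v" for v
  have lin: "linear U"
    unfolding U_def by (rule linearI) (simp_all add: linear_add[OF J_linear] linear_scale[OF J_linear] algebra_simps)
  have sq: "U (U v) = - v" for v
    using lam by (simp add: U_def linear_scale[OF J_linear] J_map_square power2_eq_square)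
  have "(\<lambda>v. s *\<^sub>R J_map br lam v) = (\<lambda>v. (norm lam * s) *\<^sub>R U v)"
    using lam by (simp add: U_def)
  then show ?thesis
    using op_exp_rotation[OF lin sq, of "norm lam * s" a]
    by (simp add: geodesic_def inv U_def)
qed

text \<open>The exceptional set pulls back along the projection of the fundamental domain, and each
  g lies in its own coset.\<close>

lemma xray_zero_AE:
  assumes "xray_zero br \<nu> lam f"
  shows "AE g in lborel. g \<in> Gamma_fund lam \<longrightarrow> xray br \<nu> lam f g = 0"
proof -
  let ?S = "{A. A \<subseteq> range (Gamma_coset br lam) \<and> Gamma_coset br lam -` A \<in> sets borel}"
  let ?M = "restrict_space lborel (Gamma_fund lam :: ('v \<times> 'z) set)"
  have "Gamma_coset br lam \<in> measurable ?M (sigma (range (Gamma_coset br lam)) ?S)"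
  proof (rule measurable_measure_of)
    show "?S \<subseteq> Pow (range (Gamma_coset br lam))" by blast
    show "Gamma_coset br lam \<in> space ?M \<rightarrow> range (Gamma_coset br lam)" by blast
    fix A assume "A \<in> ?S"
    then have "Gamma_coset br lam -` A \<inter> space lborel \<in> sets lborel" by simp
    then show "Gamma_coset br lam -` A \<inter> space ?M \<in> sets ?M"
      by (auto simp: sets_restrict_space space_restrict_space image_iff Int_commute)
  qed
  moreover have "AE c in distr ?M (sigma (range (Gamma_coset br lam)) ?S) (Gamma_coset br lam). \<forall>g\<in>c. xray br \<nu> lam f g = 0"
    using assms unfolding xray_zero_def quotient_haar_def .
  ultimately have "AE g in ?M. \<forall>g'\<in>Gamma_coset br lam g. xray br \<nu> lam f g' = 0"
    by (rule AE_distrD)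
  moreover have "g \<in> Gamma_coset br lam g" for g
  proof -
    have "(0, 0) \<in> Gamma_lat lam"
      by (auto simp: Gamma_lat_def intro: rev_image_eqI[of 0])
    moreover have "gmult br g (0, 0) = g"
      using bounded_bilinear.zero_right[OF bracket_bounded_bilinear] by (simp add: gmult_def)
    ultimately show ?thesis unfolding Gamma_coset_def by (metis image_eqI)
  qed
  ultimately have "AE g in ?M. xray br \<nu> lam f g = 0"
    by (auto elim!: eventually_mono)
  moreover have "Gamma_fund lam \<in> sets (lborel :: ('v \<times> 'z) measure)"
    using Gamma_fund_borel by simp
  ultimately show ?thesis
    by (subst (asm) AE_restrict_space_iff) auto
qed

end

section \<open>The Fourier transform of a function with vanishing X-ray transform\<close>

lemma exists_unique_shift:
  fixes y \<delta> :: real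
  assumes "\<delta> > 0"
  shows "\<exists>!j::int. 0 \<le> y - of_int j * \<delta> \<and> y - of_int j * \<delta> < \<delta>"
proof -
  have "0 \<le> y - of_int j * \<delta> \<and> y - of_int j * \<delta> < \<delta> \<longleftrightarrow> j = \<lfloor>y / \<delta>\<rfloor>" for j
    using assms by (auto simp: eq_commute[of j] floor_eq_iff field_simps)
  then show ?thesis by simp
qed

lemma smult_scaleR: "z *s (r *\<^sub>R x) = r *\<^sub>R (z *s (x :: complex^'n))"
  by (simp add: vec_eq_iff)

lemma weyl_add_2pi: "weyl a (\<theta> + 2 * pi * of_int n) F z = weyl a \<theta> F z"
proof -
  have "exp (\<i> * of_real (\<theta> + 2 * pi * of_int n) - x) = exp (\<i> * of_real \<theta> - x)" for x
    using exp_eq[of "\<i> * of_real (\<theta> + 2 * pi * of_int n) - x" "\<i> * of_real \<theta> - x"]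
    by (auto simp: algebra_simps)
  then show ?thesis unfolding weyl_def diff_diff_eq by (simp only:)
qed

lemma set_integral_Ico_eq_Icc:
  fixes h :: "real \<Rightarrow> complex"
  shows "(LINT t:{a..<b}|lborel. h t) = (LINT t:{a..b}|lborel. h t)"
proof -
  show ?thesis
    unfolding set_lebesgue_integral_def
    by (rule integral_discrete_difference[of "{b}"]) (auto simp: indicator_def)
qed

lemma integral_rescale_01:
  fixes h :: "real \<Rightarrow> complex"
  assumes "L > 0"
  shows "(LINT s:{0..<L}|lborel. h s) = of_real L * circle_mean (\<lambda>t. h (L * t))"
proof -
  have "(LINT s:{0..<L}|lborel. h s) = \<bar>L\<bar> *\<^sub>R (LINT t|lborel. indicator {0..<L} (0 + L * t) *\<^sub>R h (0 + L * t))"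
    unfolding set_lebesgue_integral_def using assms by (intro lborel_integral_real_affine) simp
  also have "(LINT t|lborel. indicator {0..<L} (0 + L * t) *\<^sub>R h (0 + L * t)) = (LINT t:{0..<1}|lborel. h (L * t))"
    unfolding set_lebesgue_integral_def
    using assms by (intro Bochner_Integration.integral_cong) (auto simp: indicator_def zero_le_mult_iff)
  also have "\<dots> = circle_mean (\<lambda>t. h (L * t))"
    by (rule set_integral_Ico_eq_Icc)
  finally show ?thesis
    using assms by (simp add: scaleR_conv_of_real)
qed

locale h_type_frame = h_type_algebra br
  for br :: "'v::euclidean_space \<times> 'z::euclidean_space \<Rightarrow> 'v \<times> 'z \<Rightarrow> 'v \<times> 'z" +
  fixes R :: "'z \<Rightarrow> complex^'n \<Rightarrow> 'v" and lam \<mu> :: 'z and k :: int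
  assumes frame: "frame_choice br R" and lam: "lam \<noteq> 0" and \<mu>: "\<mu> \<noteq> 0"
    and pairing: "\<mu> \<bullet> lam = 2 * norm lam ^ 3 * of_int k"
begin

section \<open>Complex coordinates adapted to \<mu>\<close>

definition T :: "'v \<Rightarrow> complex^'n" where "T = adjoint (R \<mu>)"

lemma R_linear: "linear (R \<mu>)" and R_bij: "bij (R \<mu>)" and R_inner: "R \<mu> z \<bullet> R \<mu> w = z \<bullet> w"
  and J_frame: "J_map br \<mu> V = norm \<mu> *\<^sub>R R \<mu> (\<i> *s T V)"
proof -
  have *: "linear (R \<mu>) \<and> bij (R \<mu>) \<and> (\<forall>z w. R \<mu> z \<bullet> R \<mu> w = z \<bullet> w) \<and>
      (\<forall>V. J_map br \<mu> V = norm \<mu> *\<^sub>R R \<mu> (\<i> *s adjoint (R \<mu>) V))"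
    using frame unfolding frame_choice_def by (elim conjE allE[of _ \<mu>] impE[OF _ \<mu>]) (intro conjI)
  from * show "linear (R \<mu>)" by (elim conjE)
  from * show "bij (R \<mu>)" by (elim conjE)
  from * show "R \<mu> z \<bullet> R \<mu> w = z \<bullet> w" by (elim conjE allE)
  from * show "J_map br \<mu> V = norm \<mu> *\<^sub>R R \<mu> (\<i> *s T V)" unfolding T_def by (elim conjE allE)
qed

lemma T_adjoint: "z \<bullet> T V = R \<mu> z \<bullet> V"
  unfolding T_def by (rule adjoint_works[OF R_linear])

lemma norm_R: "norm (R \<mu> z) = norm z"
  by (simp add: norm_eq_sqrt_inner R_inner)

lemma T_R: "T (R \<mu> z) = z"
proof -
  have "x \<bullet> T (R \<mu> z) = x \<bullet> z" for x
    by (simp only: T_adjoint R_inner)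
  then show ?thesis
    using vector_eq_ldot by blast
qed

lemma R_T: "R \<mu> (T V) = V"
proof -
  obtain z where "V = R \<mu> z" using bij_is_surj[OF R_bij] by (rule surjE)
  then show ?thesis by (simp only: T_R)
qed

lemma T_linear: "linear T"
  unfolding T_def by (rule adjoint_linear[OF R_linear])

lemma T_inner: "T V \<bullet> T W = V \<bullet> W"
  by (simp add: T_adjoint R_T)

lemma norm_T: "norm (T V) = norm V"
  by (simp add: norm_eq_sqrt_inner T_inner)

definition c :: real where "c = sqrt (norm \<mu> / 2)"

lemma c_square: "c * c = norm \<mu> / 2"
  by (simp add: c_def)

lemma norm_c_T: "(norm (c *\<^sub>R T V))\<^sup>2 = norm \<mu> / 2 * (norm V)\<^sup>2"
proof -
  have "(norm (c *\<^sub>R T V))\<^sup>2 = c * c * (norm V)\<^sup>2"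
    by (simp add: norm_T power_mult_distrib power2_eq_square[of c])
  then show ?thesis by (simp only: c_square)
qed

lemma pi_rep_weyl: "pi_rep R \<mu> g = weyl (c *\<^sub>R T (fst g)) (\<mu> \<bullet> snd g)"
proof (intro ext)
  fix F \<zeta>
  have "norm \<mu> * (\<mu> \<bullet> snd g / norm \<mu>) = \<mu> \<bullet> snd g" using \<mu> by simp
  moreover have "norm \<mu> / 4 * (norm (T (fst g)))\<^sup>2 = (norm (c *\<^sub>R T (fst g)))\<^sup>2 / 2"
    by (simp only: norm_c_T norm_T)
  moreover have "complex_of_real c * (\<Sum>i\<in>UNIV. \<zeta> $ i * cnj (T (fst g) $ i)) = herm \<zeta> (c *\<^sub>R T (fst g))"
    by (simp only: herm_scaleR_right) (simp only: herm_def)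
  ultimately show "pi_rep R \<mu> g F \<zeta> = weyl (c *\<^sub>R T (fst g)) (\<mu> \<bullet> snd g) F \<zeta>"
    unfolding pi_rep_def pi_heis_def weyl_def T_def[symmetric] c_def[symmetric]
    by (simp only:)
qed

text \<open>In these coordinates J_\<mu> is multiplication by i |\<mu>|, so \<open>herm\<close>
  carries the form \<mu>([V, W]) in its imaginary part.\<close>

lemma Im_herm_T: "norm \<mu> * Im (herm (T V) (T W)) = - (\<mu> \<bullet> center_bracket br V W)"
proof -
  have "\<mu> \<bullet> center_bracket br V W = norm \<mu> * (R \<mu> (\<i> *s T V) \<bullet> W)"
    using J_inner[of \<mu> V W] by (simp add: J_frame)
  also have "R \<mu> (\<i> *s T V) \<bullet> W = Re (herm (\<i> *s T V) (T W))"
    by (simp only: Re_herm T_adjoint)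
  also have "\<dots> = - Im (herm (T V) (T W))"
    by (simp add: herm_smult_left)
  finally show ?thesis by simp
qed

section \<open>The complex structure of \<lambda> in the coordinates of \<mu>\<close>

definition U :: "'v \<Rightarrow> 'v" where "U V = (1 / norm lam) *\<^sub>R J_map br lam V"

lemma U_linear: "linear U"
  unfolding U_def by (rule linearI) (simp_all add: linear_add[OF J_linear] linear_scale[OF J_linear] algebra_simps)

lemma U_U: "U (U V) = - V"
  using lam by (simp add: U_def linear_scale[OF J_linear] J_map_square power2_eq_square)

lemma inner_U: "V \<bullet> U V = 0"
proof -
  have "J_map br lam V \<bullet> V = 0" by (simp add: J_inner bracket_self)
  then show ?thesis by (simp add: U_def inner_commute)
qed

lemma norm_U: "norm (U V) = norm V"
  using lam by (simp add: U_def norm_J)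

text \<open>The squared radius c^2 / |\<lambda>|^2 of the circles in Fock coordinates: the curve has
  radius 1 / |\<lambda>|, and the representation scales by c.\<close>

definition K :: real where "K = norm \<mu> / (2 * (norm lam)\<^sup>2)"
definition \<kappa> :: real where "\<kappa> = \<mu> \<bullet> lam / (norm \<mu> * norm lam)"
definition S' :: "complex^'n \<Rightarrow> complex^'n" where "S' w = T (U (R \<mu> w)) - (\<i> * of_real \<kappa>) *s w"

lemma K_pos: "K > 0" using lam \<mu> by (simp add: K_def)

lemma K_\<kappa>: "K * \<kappa> = of_int k"
  unfolding K_def \<kappa>_def pairing using lam \<mu> by (simp add: field_simps power2_eq_square power3_eq_cube)

lemma sqrt_K: "sqrt K = c / norm lam"
  using lam by (simp add: K_def c_def real_sqrt_divide real_sqrt_mult)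

text \<open>For M = J_\<lambda> / |\<lambda>| in coordinates, the Clifford relation divided by
  |\<mu>| |\<lambda>| reads i M + M i = - 2 \<kappa>. The map i \<kappa> satisfies the same
  equation, so the difference anticommutes with i.\<close>

lemma S'_anticommute: "S' (\<i> *s w) = - (\<i> *s S' w)"
proof -
  have "J_map br \<mu> (J_map br lam (R \<mu> w)) + J_map br lam (J_map br \<mu> (R \<mu> w)) = - ((2 * (\<mu> \<bullet> lam)) *\<^sub>R R \<mu> w)"
    by (rule J_anticommute)
  moreover have "J_map br lam V = norm lam *\<^sub>R U V" for V
    using lam by (simp add: U_def)
  ultimately have "(norm \<mu> * norm lam) *\<^sub>R (R \<mu> (\<i> *s T (U (R \<mu> w))) + U (R \<mu> (\<i> *s w))) = - ((2 * (\<mu> \<bullet> lam)) *\<^sub>R R \<mu> w)"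
    by (simp add: J_frame T_R linear_scale[OF T_linear] linear_scale[OF R_linear] linear_scale[OF U_linear]
        smult_scaleR algebra_simps)
  then have "(1 / (norm \<mu> * norm lam)) *\<^sub>R ((norm \<mu> * norm lam) *\<^sub>R (R \<mu> (\<i> *s T (U (R \<mu> w))) + U (R \<mu> (\<i> *s w))))
      = (1 / (norm \<mu> * norm lam)) *\<^sub>R (- ((2 * (\<mu> \<bullet> lam)) *\<^sub>R R \<mu> w))"
    by simp
  then have "R \<mu> (\<i> *s T (U (R \<mu> w))) + U (R \<mu> (\<i> *s w)) = - ((2 * \<kappa>) *\<^sub>R R \<mu> w)"
    using lam \<mu> by (simp add: \<kappa>_def)
  then have "T (R \<mu> (\<i> *s T (U (R \<mu> w))) + U (R \<mu> (\<i> *s w))) = T (- ((2 * \<kappa>) *\<^sub>R R \<mu> w))"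
    by simp
  then have "\<i> *s T (U (R \<mu> w)) + T (U (R \<mu> (\<i> *s w))) = - ((2 * \<kappa>) *\<^sub>R w)"
    by (simp add: linear_add[OF T_linear] linear_neg[OF T_linear] linear_scale[OF T_linear] T_R)
  then have e: "T (U (R \<mu> (\<i> *s w))) = - ((2 * \<kappa>) *\<^sub>R w) - \<i> *s T (U (R \<mu> w))"
    by (simp add: algebra_simps eq_diff_eq)
  show ?thesis
    unfolding S'_def e by (simp add: vec_eq_iff) (simp add: scaleR_conv_of_real algebra_simps)
qed

lemma S'_add: "S' (x + y) = S' x + S' y"
  by (simp add: S'_def linear_add[OF T_linear] linear_add[OF U_linear] linear_add[OF R_linear] smult_add_right)

lemma S'_scaleR: "S' (r *\<^sub>R x) = r *\<^sub>R S' x"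
  by (simp add: S'_def linear_scale[OF T_linear] linear_scale[OF U_linear] linear_scale[OF R_linear] smult_scaleR scaleR_diff_right)

lemma S'_smult: "S' (z *s x) = cnj z *s S' x"
proof -
  have "z *s x = Re z *\<^sub>R x + Im z *\<^sub>R (\<i> *s x)"
    by (simp add: vec_eq_iff complex_eq_iff)
  then have "S' (z *s x) = Re z *\<^sub>R S' x - Im z *\<^sub>R (\<i> *s S' x)"
    by (simp add: S'_add S'_scaleR S'_anticommute)
  also have "\<dots> = cnj z *s S' x"
    by (simp add: vec_eq_iff complex_eq_iff)
  finally show ?thesis .
qed

text \<open>Antilinearity makes \<open>w \<mapsto> herm w (S' w)\<close> homogeneous of complex degree two, so it
  vanishes as soon as its real part does.\<close>

lemma S'_orth: "herm w (S' w) = 0"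
proof -
  have Re0: "Re (herm v (S' v)) = 0" for v
  proof -
    have "v \<bullet> T (U (R \<mu> v)) = 0"
      by (simp add: T_adjoint inner_U)
    moreover have "Re (herm v ((\<i> * of_real \<kappa>) *s v)) = 0"
      by (simp add: herm_smult_right herm_self)
    ultimately show ?thesis
      by (simp add: S'_def herm_diff_right Re_herm)
  qed
  define q where "q = csqrt \<i>"
  have q: "q * (q * x) = \<i> * x" for x
    unfolding mult.assoc[symmetric] power2_eq_square[symmetric] q_def power2_csqrt ..
  have "herm (q *s w) (S' (q *s w)) = \<i> * herm w (S' w)"
    by (simp add: S'_smult herm_smult_left herm_smult_right q)
  then have "Re (\<i> * herm w (S' w)) = 0"
    using Re0[of "q *s w"] by (simp only:)
  then show ?thesis
    using Re0[of w] by (simp add: complex_eq_iff)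
qed

lemma S'_square: "S' (S' w) = - (of_real (1 - \<kappa>\<^sup>2) *s w)"
proof -
  have e: "T (U (R \<mu> v)) = (\<i> * of_real \<kappa>) *s v + S' v" for v
    by (simp add: S'_def)
  have "T (U (R \<mu> (T (U (R \<mu> w))))) = - w"
    by (simp add: R_T U_U linear_neg[OF T_linear] T_R)
  then have "(\<i> * of_real \<kappa>) *s ((\<i> * of_real \<kappa>) *s w + S' w) + (S' ((\<i> * of_real \<kappa>) *s w) + S' (S' w)) = - w"
    unfolding e S'_add by simp
  then show ?thesis
    unfolding S'_smult by (simp add: vec_eq_iff power2_eq_square algebra_simps)
qed

section \<open>From the X-ray hypothesis to the vanishing of the Fourier transform\<close>

lemma superposition:
  assumes "integrable lborel f" "F \<in> fock_space"
  shows "weyl_superposition (\<lambda>g. - (c *\<^sub>R T (fst g))) (\<lambda>g. - (\<mu> \<bullet> snd g)) f F"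
proof
  have T_cont: "continuous_on UNIV T"
    using T_linear by (simp add: linear_continuous_on linear_conv_bounded_linear)
  show "continuous_on UNIV (\<lambda>g. - (c *\<^sub>R T (fst g)))"
    by (intro continuous_intros continuous_on_compose2[OF T_cont]) auto
  show "continuous_on UNIV (\<lambda>g. - (\<mu> \<bullet> snd g))"
    by (intro continuous_intros)
qed (rule assms)+

lemma superposition_zero:
  fixes f :: "'v \<times> 'z \<Rightarrow> complex" and F :: "complex^'n \<Rightarrow> complex"
  assumes f: "integrable lborel f" and F: "F \<in> fock_space"
    and xr: "\<And>\<nu>. norm \<nu> = 1 \<Longrightarrow> xray_zero br \<nu> lam f"
    and dim: "CARD('n) > 1 \<or> odd k"
  shows "(LINT g|lborel. f g * weyl (- (c *\<^sub>R T (fst g))) (- (\<mu> \<bullet> snd g)) F z) = 0"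
proof -
  interpret Wp: weyl_superposition "\<lambda>g. - (c *\<^sub>R T (fst g))" "\<lambda>g. - (\<mu> \<bullet> snd g)" f F
    using f F by (rule superposition)
  obtain C where C: "C \<ge> 0" "\<And>\<zeta>. cmod (F \<zeta>) \<le> C * exp ((norm \<zeta>)\<^sup>2 / 2)"
    using fock_space_growth[OF F] by blast
  interpret Sl: circle_slices Wp.\<psi> S' K \<kappa> k
  proof
    fix w z :: "complex^'n" assume w: "norm w = 1"
    \<comment> \<open>The norm of a is 1 / |\<lambda>|, so J_\<lambda> a is a unit vector and serves
      as the direction of the curve.\<close>
    define a where "a = (1 / norm lam) *\<^sub>R R \<mu> w"
    have norm_a: "norm a = 1 / norm lam"
      by (simp add: a_def norm_R w)
    define X where "X s = cos (norm lam * s) *\<^sub>R a + sin (norm lam * s) *\<^sub>R U a" for s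
    define V where "V s = (s / (2 * norm lam)) *\<^sub>R sgn lam" for s
    define P where "P g = weyl (- (c *\<^sub>R T (fst g))) (- (\<mu> \<bullet> snd g)) F z" for g :: "'v \<times> 'z"
    \<comment> \<open>One turn takes time L and advances the centre by \<delta>, the generator of
      the lattice.\<close>
    define L where "L = 2 * pi / norm lam"
    define \<delta> where "\<delta> = pi / (norm lam)\<^sup>2"
    have L: "L > 0" and \<delta>: "\<delta> > 0" using lam by (simp_all add: L_def \<delta>_def)
    have X_per: "X (s + of_int j * L) = X s" for s j
    proof -
      have "norm lam * (s + of_int j * L) = norm lam * s + of_int j * (2 * pi)"
        using lam by (simp add: L_def field_simps)
      then show ?thesis
        unfolding X_def by (simp add: cos_add sin_add mult.commute[of _ "2 * pi"])
    qed
    have V_per: "V (s + of_int j * L) = V s + (of_int j * \<delta>) *\<^sub>R sgn lam" for s j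
      using lam by (simp add: V_def L_def \<delta>_def field_simps power2_eq_square flip: scaleR_add_left)
    have sgn1: "sgn lam \<bullet> sgn lam = 1"
      using lam by (simp add: sgn_div_norm power2_norm_eq_inner[symmetric] power2_eq_square)
    \<comment> \<open>The central character is trivial on the lattice; this makes P periodic along
      the curve and gives the twist its frequency k.\<close>
    have \<mu>_sgn: "\<mu> \<bullet> sgn lam * \<delta> = 2 * pi * of_int k"
      using lam pairing by (simp add: sgn_div_norm \<delta>_def field_simps power2_eq_square power3_eq_cube)
    interpret G: group_slice "center_bracket br" X V P f "Gamma_fund lam" L "C * exp ((norm z)\<^sup>2 / 2)"
    proof (rule group_slice.intro)
      show "bounded_bilinear (center_bracket br)" by (rule bracket_bounded_bilinear)
      show "center_bracket br x x = 0" for x by (rule bracket_self)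
      show "continuous_on UNIV X" unfolding X_def by (intro continuous_intros)
      show "continuous_on UNIV V" unfolding V_def using lam by (intro continuous_intros) auto
      show "continuous_on UNIV P"
      proof -
        have "continuous_on UNIV (\<lambda>g :: 'v \<times> 'z. (g, z))" by (intro continuous_intros)
        from continuous_on_compose2[OF Wp.continuous_weyl this] show ?thesis
          by (simp add: P_def)
      qed
      show "cmod (P g) \<le> C * exp ((norm z)\<^sup>2 / 2)" for g
        unfolding P_def using C(2) by (rule weyl_growth)
      show "integrable lborel f" by (rule f)
      show "Gamma_fund lam \<in> sets borel" by (rule Gamma_fund_borel)
      show "L > 0" by (rule L)
      have "norm (J_map br lam a) = 1"
        using lam by (simp add: norm_J norm_a)
      from xray_zero_AE[OF xr[OF this]]
      show "AE g in lborel. g \<in> Gamma_fund lam \<longrightarrow>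
          (LINT s|lborel. f (fst g + X s, snd g + V s + (1/2) *\<^sub>R center_bracket br (fst g) (X s))) = 0"
        unfolding xray_def geodesic_J[OF lam] gmult_def fst_conv snd_conv X_def V_def U_def .
    next
      fix g :: "'v \<times> 'z"
      define \<alpha> where "\<alpha> = snd g \<bullet> sgn lam"
      define p where "p = center_bracket br (fst g) a \<bullet> sgn lam"
      define q where "q = center_bracket br (fst g) (U a) \<bullet> sgn lam"
      \<comment> \<open>The component of g \<gamma>(s)^-1 along \<lambda>, which alone decides
        membership in the fundamental domain: affine in s plus a bounded oscillation.\<close>
      define y where "y s = \<alpha> - s / (2 * norm lam) - (cos (norm lam * s) * p + sin (norm lam * s) * q) / 2" for s
      have fund: "(fst g - X s, snd g - V s - (1/2) *\<^sub>R center_bracket br (fst g) (X s)) \<in> Gamma_fund lam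
          \<longleftrightarrow> 0 \<le> y s \<and> y s < \<delta>" for s
      proof -
        have "(snd g - V s - (1/2) *\<^sub>R center_bracket br (fst g) (X s)) \<bullet> sgn lam = y s"
          unfolding X_def V_def y_def \<alpha>_def p_def q_def
            bounded_bilinear.add_right[OF bracket_bounded_bilinear] bounded_bilinear.scaleR_right[OF bracket_bounded_bilinear]
          by (simp add: inner_diff_left inner_add_left sgn1)
        then show ?thesis by (simp add: Gamma_fund_def \<delta>_def)
      qed
      show "\<exists>N. \<forall>s. (fst g - X s, snd g - V s - (1/2) *\<^sub>R center_bracket br (fst g) (X s)) \<in> Gamma_fund lam \<longrightarrow>
          - (real N * L) \<le> s \<and> s < real N * L"
      proof -
        \<comment> \<open>Beyond this value of |s| the linear part of y outweighs the constant, the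
          oscillation and the width \<delta>.\<close>
        define Q where "Q = 2 * norm lam * (\<bar>\<alpha>\<bar> + \<bar>p\<bar> + \<bar>q\<bar> + \<delta>)"
        obtain N where N: "real N > Q / L" using reals_Archimedean2 by blast
        have "- (real N * L) \<le> s \<and> s < real N * L" if "0 \<le> y s" "y s < \<delta>" for s
        proof -
          have gen: "\<bar>x\<bar> \<le> \<bar>a\<bar> + r + t + d"
            if "\<bar>u\<bar> \<le> 1 * r" "\<bar>v\<bar> \<le> 1 * t" "0 \<le> a - x - (u + v) / 2" "a - x - (u + v) / 2 < d" "0 < d"
            for a d r t u v x :: real
          proof -
            have "- r \<le> u" "u \<le> r" "- t \<le> v" "v \<le> t"
              using that(1,2) by (simp_all add: abs_le_iff)
            then show ?thesis
              using that(3-5) abs_ge_self[of a] abs_ge_minus_self[of a]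
              by (intro abs_leI) (simp_all add: field_simps)
          qed
          have "\<bar>cos (norm lam * s) * p\<bar> \<le> 1 * \<bar>p\<bar>" "\<bar>sin (norm lam * s) * q\<bar> \<le> 1 * \<bar>q\<bar>"
            unfolding abs_mult by (intro mult_right_mono; simp)+
          then have "\<bar>s / (2 * norm lam)\<bar> \<le> \<bar>\<alpha>\<bar> + \<bar>p\<bar> + \<bar>q\<bar> + \<delta>"
            using that[unfolded y_def] \<delta> by (rule gen)
          then have "\<bar>s\<bar> \<le> Q"
            using lam by (simp add: Q_def field_simps)
          moreover have "Q < real N * L"
            using N L by (simp add: field_simps)
          ultimately show ?thesis by linarith
        qed
        then show ?thesis unfolding fund by blast
      qed
      show "\<exists>!j. (fst g - X (s + of_int j * L),
          snd g - V (s + of_int j * L) - (1/2) *\<^sub>R center_bracket br (fst g) (X (s + of_int j * L))) \<in> Gamma_fund lam" for s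
      proof -
        have "y (s + of_int j * L) = y s - of_int j * \<delta>" for j
        proof -
          have "norm lam * (s + of_int j * L) = norm lam * s + of_int j * (2 * pi)"
            using lam by (simp add: L_def field_simps)
          moreover have "(s + of_int j * L) / (2 * norm lam) = s / (2 * norm lam) + of_int j * \<delta>"
            using lam by (simp add: L_def \<delta>_def field_simps power2_eq_square)
          ultimately show ?thesis
            unfolding y_def by (simp add: cos_add sin_add mult.commute[of _ "2 * pi"])
        qed
        then show ?thesis
          unfolding fund using exists_unique_shift[OF \<delta>, of "y s"] by simp
      qed
      show "P (fst g - X (s + of_int j * L), snd g - V (s + of_int j * L) - (1/2) *\<^sub>R center_bracket br (fst g) (X (s + of_int j * L)))
          = P (fst g - X s, snd g - V s - (1/2) *\<^sub>R center_bracket br (fst g) (X s))" for s j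
      proof -
        define u where "u = snd g - V s - (1/2) *\<^sub>R center_bracket br (fst g) (X s)"
        have u: "snd g - V (s + of_int j * L) - (1/2) *\<^sub>R center_bracket br (fst g) (X s) = u - (of_int j * \<delta>) *\<^sub>R sgn lam"
          by (simp add: u_def V_per)
        have "\<mu> \<bullet> (of_int j * \<delta>) *\<^sub>R sgn lam = 2 * pi * of_int (j * k)"
          using \<mu>_sgn by (simp add: mult_ac)
        then have "- (\<mu> \<bullet> (u - (of_int j * \<delta>) *\<^sub>R sgn lam)) = - (\<mu> \<bullet> u) + 2 * pi * of_int (j * k)"
          by (simp add: inner_diff_right)
        then have "weyl b (- (\<mu> \<bullet> (u - (of_int j * \<delta>) *\<^sub>R sgn lam))) F z = weyl b (- (\<mu> \<bullet> u)) F z" for b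
          by (simp only: weyl_add_2pi)
        then show ?thesis
          by (simp only: P_def fst_conv snd_conv X_per u u_def)
      qed
    qed
    \<comment> \<open>The slice integrand times exp (- K / 2), the Gaussian constant of the Weyl
      operator, which is the same at all t because every point b of the circle has |b|^2 =
      K.\<close>
    define E where "E t = of_real (exp (- K / 2)) * (cis (2 * pi * of_int k * t) *
        (exp (- (of_real (sqrt K) * herm z (cos (2 * pi * t) *\<^sub>R w + sin (2 * pi * t) *\<^sub>R ((\<i> * of_real \<kappa>) *s w + S' w)))) *
         Wp.\<psi> (z + sqrt K *\<^sub>R (cos (2 * pi * t) *\<^sub>R w + sin (2 * pi * t) *\<^sub>R ((\<i> * of_real \<kappa>) *s w + S' w)))))" for t
    have key: "(LINT g|lborel. f g * P (G.m' g (L * t))) = E t" for t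
    proof -
      define s where "s = L * t"
      define b where "b = c *\<^sub>R T (X s)"
      \<comment> \<open>As P g is the value at z of \<pi>(g)^-1 F, this is the rule \<pi>(g
        \<gamma>^-1)^-1 = \<pi>(\<gamma>) \<pi>(g)^-1.\<close>
      have comp: "P (G.m' g s) = weyl b (\<mu> \<bullet> V s) (weyl (- (c *\<^sub>R T (fst g))) (- (\<mu> \<bullet> snd g)) F) z" for g
      proof -
        have "- (c *\<^sub>R T (fst g)) + b = - (c *\<^sub>R T (fst g - X s))"
          by (simp add: b_def linear_diff[OF T_linear] algebra_simps)
        moreover have "- (\<mu> \<bullet> snd g) + \<mu> \<bullet> V s - Im (herm b (- (c *\<^sub>R T (fst g))))
            = - (\<mu> \<bullet> (snd g - V s - (1/2) *\<^sub>R center_bracket br (fst g) (X s)))"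
        proof -
          have "Im (herm b (- (c *\<^sub>R T (fst g)))) = - (c * c * Im (herm (T (X s)) (T (fst g))))"
            by (simp add: b_def herm_minus_right herm_scaleR_left herm_scaleR_right)
          also have "\<dots> = (\<mu> \<bullet> center_bracket br (X s) (fst g)) / 2"
            unfolding c_square using Im_herm_T[of "X s" "fst g"] by simp
          also have "\<dots> = - (\<mu> \<bullet> center_bracket br (fst g) (X s)) / 2"
            using bracket_commute[of "X s" "fst g"] by simp
          finally show ?thesis by (simp add: inner_diff_right)
        qed
        ultimately show ?thesis
          by (simp only: weyl_weyl P_def G.m'_def fst_conv snd_conv)
      qed
      have "(LINT g|lborel. f g * P (G.m' g s)) = weyl b (\<mu> \<bullet> V s) Wp.\<psi> z"
      proof -
        define e where "e = exp (\<i> * of_real (\<mu> \<bullet> V s) - herm z b - of_real ((norm b)\<^sup>2 / 2))"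
        have "f g * P (G.m' g s) = e * (f g * weyl (- (c *\<^sub>R T (fst g))) (- (\<mu> \<bullet> snd g)) F (z + b))" for g
          unfolding comp weyl_def[of b] e_def by (simp only: mult.left_commute)
        then have "(LINT g|lborel. f g * P (G.m' g s)) = e * Wp.\<psi> (z + b)"
          by (simp only: integral_mult_right_zero Wp.\<psi>_def)
        then show ?thesis by (simp only: weyl_def[of b] e_def)
      qed
      also have "\<dots> = E t"
      proof -
        have Ta: "T a = (1 / norm lam) *\<^sub>R w"
          by (simp add: a_def linear_scale[OF T_linear] T_R)
        have TUa: "T (U a) = (1 / norm lam) *\<^sub>R ((\<i> * of_real \<kappa>) *s w + S' w)"
          by (simp add: a_def linear_scale[OF T_linear] linear_scale[OF U_linear] S'_def)
        have angle: "norm lam * s = 2 * pi * t" using lam by (simp add: s_def L_def)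
        have b: "b = sqrt K *\<^sub>R (cos (2 * pi * t) *\<^sub>R w + sin (2 * pi * t) *\<^sub>R ((\<i> * of_real \<kappa>) *s w + S' w))"
          unfolding b_def X_def angle sqrt_K
          by (simp add: linear_add[OF T_linear] linear_scale[OF T_linear] Ta TUa scaleR_add_right mult_ac)
        have phase: "\<mu> \<bullet> V s = 2 * pi * of_int k * t"
          using \<mu>_sgn lam by (simp add: V_def s_def L_def \<delta>_def field_simps power2_eq_square)
        have "norm b ^ 2 = K"
        proof -
          have "(norm (X s))\<^sup>2 = ((cos (norm lam * s))\<^sup>2 + (sin (norm lam * s))\<^sup>2) * (norm a)\<^sup>2"
          proof -
            have "U a \<bullet> U a = a \<bullet> a"
              using norm_U[of a] by (simp add: norm_eq)
            then have "(norm (x *\<^sub>R a + y *\<^sub>R U a))\<^sup>2 = (x\<^sup>2 + y\<^sup>2) * (norm a)\<^sup>2" for x y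
              unfolding power2_norm_eq_inner
              by (simp add: inner_add_left inner_add_right inner_U inner_commute[of "U a" a])
                 (simp add: power2_eq_square algebra_simps)
            then show ?thesis unfolding X_def .
          qed
          also have "\<dots> = (1 / norm lam)\<^sup>2"
            by (simp add: norm_a)
          finally show ?thesis
            unfolding b_def norm_c_T by (simp add: K_def power_divide)
        qed
        then have "\<i> * of_real (\<mu> \<bullet> V s) - herm z b - of_real ((norm b)\<^sup>2 / 2)
            = of_real (- K / 2) + (\<i> * of_real (2 * pi * of_int k * t) + - herm z b)"
          unfolding phase by simp
        then have "exp (\<i> * of_real (\<mu> \<bullet> V s) - herm z b - of_real ((norm b)\<^sup>2 / 2))
            = of_real (exp (- K / 2)) * (cis (2 * pi * of_int k * t) * exp (- herm z b))"
          by (simp only: exp_add exp_of_real cis_conv_exp)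
        then have "weyl b (\<mu> \<bullet> V s) Wp.\<psi> z
            = of_real (exp (- K / 2)) * (cis (2 * pi * of_int k * t) * (exp (- herm z b) * Wp.\<psi> (z + b)))"
          by (simp only: weyl_def mult.assoc)
        then show ?thesis
          unfolding E_def b herm_scaleR_right .
      qed
      finally show ?thesis by (simp add: s_def)
    qed
    have "of_real L * circle_mean (\<lambda>t. E t) = 0"
      using G.slice_vanishes unfolding integral_rescale_01[OF L] key .
    then have "circle_mean (\<lambda>t. E t) = 0" using L by simp
    then show "circle_mean (\<lambda>t. cis (2 * pi * of_int k * t) *
        (exp (- (of_real (sqrt K) * herm z (cos (2 * pi * t) *\<^sub>R w + sin (2 * pi * t) *\<^sub>R ((\<i> * of_real \<kappa>) *s w + S' w)))) *
         Wp.\<psi> (z + sqrt K *\<^sub>R (cos (2 * pi * t) *\<^sub>R w + sin (2 * pi * t) *\<^sub>R ((\<i> * of_real \<kappa>) *s w + S' w))))) = 0"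
      unfolding E_def set_integral_mult_right by simp
  qed (rule Wp.\<psi>_continuous Wp.\<psi>_line_holomorphic K_pos K_\<kappa> S'_add S'_smult S'_orth S'_square)+
  show ?thesis
    using Sl.annihilated[OF dim, of z] by (simp add: Wp.\<psi>_def)
qed

lemma fourier_zero:
  fixes f :: "'v \<times> 'z \<Rightarrow> complex"
  assumes f: "integrable lborel f"
    and xr: "\<And>\<nu>. norm \<nu> = 1 \<Longrightarrow> xray_zero br \<nu> lam f"
    and dim: "CARD('n) > 1 \<or> odd k"
  shows "fock_op_zero (group_fourier R f \<mu>)"
  unfolding fock_op_zero_def
proof
  fix F :: "complex^'n \<Rightarrow> complex" assume F: "F \<in> fock_space"
  interpret Wp: weyl_superposition "\<lambda>g. - (c *\<^sub>R T (fst g))" "\<lambda>g. - (\<mu> \<bullet> snd g)" f F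
    using f F by (rule superposition)
  have \<psi>0: "Wp.\<psi> z = 0" for z
    using superposition_zero[OF f F xr dim] by (simp add: Wp.\<psi>_def)
  have rhs: "(LINT g|lborel. f g * fock_inner (fock_adjoint (pi_rep R \<mu> g) F) H) = 0" if "H \<in> fock_space" for H
    using Wp.fock_inner_superposition_zero[OF \<psi>0 that] by (simp add: pi_rep_weyl fock_adjoint_weyl[OF F])
  show "group_fourier R f \<mu> F = (\<lambda>_. 0)"
    unfolding group_fourier_def
  proof (rule the_equality)
    have "(\<lambda>_. 0) \<in> (fock_space :: (complex^'n \<Rightarrow> complex) set)"
      by (auto simp: fock_space_def holomorphic_Cn_def intro!: exI[of _ "\<lambda>_. 0"])
    then show "((\<lambda>_. 0) :: complex^'n \<Rightarrow> complex) \<in> fock_space \<and> (\<forall>H\<in>fock_space. fock_inner (\<lambda>_. 0) H =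
        (LINT g|lborel. f g * fock_inner (fock_adjoint (pi_rep R \<mu> g) F) H))"
      by (simp add: rhs) (simp add: fock_inner_def)
    fix Q :: "complex^'n \<Rightarrow> complex"
    assume "Q \<in> fock_space \<and> (\<forall>H\<in>fock_space. fock_inner Q H =
        (LINT g|lborel. f g * fock_inner (fock_adjoint (pi_rep R \<mu> g) F) H))"
    then have "Q \<in> fock_space" "fock_inner Q Q = 0" using rhs by auto
    then show "Q = (\<lambda>_. 0)" using fock_inner_self_zero by blast
  qed
qed

end

theorem corollary2p10:
  fixes br :: "'v::euclidean_space \<times> 'z::euclidean_space \<Rightarrow> 'v \<times> 'z \<Rightarrow> 'v \<times> 'z"
    and R :: "'z \<Rightarrow> complex^'n \<Rightarrow> 'v"
    and f :: "'v \<times> 'z \<Rightarrow> complex"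
    and lam :: 'z
  assumes "h_type_algebra br"
    and "DIM('v) = 2 * CARD('n)"
    and "frame_choice br R"
    and "integrable lborel f"
    and "lam \<noteq> 0"
    and "\<And>\<nu>. norm \<nu> = 1 \<Longrightarrow> xray_zero br \<nu> lam f"
  shows "(CARD('n) > 1 \<longrightarrow> (\<forall>\<mu> \<in> Gamma_dual lam - {0}. fock_op_zero (group_fourier R f \<mu>))) \<and>
    (CARD('n) = 1 \<longrightarrow> (\<forall>\<mu> \<in> Gamma_dual_odd lam. fock_op_zero (group_fourier R f \<mu>)))"
proof -
  have main: "fock_op_zero (group_fourier R f \<mu>)"
    if "\<mu> \<noteq> 0" "\<mu> \<bullet> lam = 2 * norm lam ^ 3 * of_int k" "CARD('n) > 1 \<or> odd k" for \<mu> k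
  proof -
    have "h_type_frame br R lam \<mu> k"
      using that assms by (simp add: h_type_frame_def h_type_frame_axioms_def)
    from h_type_frame.fourier_zero[OF this assms(4,6) that(3)] show ?thesis .
  qed
  show ?thesis
  proof (intro conjI impI ballI)
    fix \<mu> assume "CARD('n) > 1" "\<mu> \<in> Gamma_dual lam - {0}"
    then show "fock_op_zero (group_fourier R f \<mu>)"
      using main by (auto simp: Gamma_dual_def)
  next
    fix \<mu> assume "\<mu> \<in> Gamma_dual_odd lam"
    then obtain k :: int where k: "\<mu> \<bullet> lam = 2 * norm lam ^ 3 * of_int (2 * k + 1)"
      by (auto simp: Gamma_dual_odd_def)
    \<comment> \<open>An odd multiple of 2 |\<lambda>|^3 is nonzero, so \<mu> = 0 does not occur
      among the odd frequencies.\<close>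
    moreover have "real_of_int (2 * k + 1) \<noteq> 0"
      by (simp only: of_int_eq_0_iff) presburger
    ultimately have "\<mu> \<noteq> 0"
      using assms(5) by auto
    then show "fock_op_zero (group_fourier R f \<mu>)"
      using main[OF _ k] by simp
  qed
qed

end
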